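(* Let $s>\frac32$, $M>0$ with $M\neq1$, $\sigma_2,\sigma_3\in\{1,-1\}$, $\delta,D\in\mathbb{R}$, $W>0$ be fixed. Let $(\alpha_1,\alpha_2)\in\mathbb{R}^2$ be the unique solution of $$\tfrac1M\alpha_2+D=-\sigma_3\alpha_1,\qquad \tfrac1M\alpha_1+M=-\sigma_3\alpha_2,$$ and set $$L_1=-i\delta\alpha_1\left(\overline\psi\,\partial_x^2\psi-\psi\,\partial_x^2\overline\psi\right),\qquad L_2=-\tfrac{i}{M}\delta\alpha_2\left(\overline\psi\,\partial_x\psi-\psi\,\partial_x\overline\psi\right).$$ For $\epsilon>0$ consider the modified Zakharov–Rubenchik system $$\begin{cases}\partial_t\psi-\sigma_3\partial_x\psi-i\epsilon\delta\partial_x^2\psi+i\epsilon\left\{\sigma_2|\psi|^2+W(\rho+D\partial_x\phi)\right\}\psi=0,\\ \partial_t\rho+\partial_x^2\phi+D\partial_x(|\psi|^2)+\epsilon L_1=0,\\ \partial_t\phi+\frac1{M^2}\rho+|\psi|^2+\epsilon L_2=0,\end{cases}$$ with $\psi$ complex-valued and $\rho,\phi$ real-valued. Let $Z=H^s(\mathbb{T})\times H^s(\mathbb{T})\times H^{s+1}(\mathbb{T})$ and $\tilde Z=H^{s-2}(\mathbb{T})\times H^{s-2}(\mathbb{T})\times H^{s-1}(\mathbb{T})$ (first component complex-valued, second and third real-valued). Then the existence time is of order $\epsilon^{-1}$: for every $\tilde\Psi_0=(\psi_0,\rho_0,\phi_0)\in Z$ there is a constant $c>0$, independent of $\epsilon$,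 such that for every $\epsilon>0$ the system has a unique solution $\tilde\Psi=(\psi,\rho,\phi)\in C([0,T];Z)\cap C^1([0,T];\tilde Z)$ with $\tilde\Psi(0)=\tilde\Psi_0$ and $T=c\,\epsilon^{-1}$.
   Context: $\mathbb{T}=\mathbb{R}/2\pi\mathbb{Z}$. For $r\in\mathbb{R}$, $H^r(\mathbb{T})$ is the Sobolev space of periodic distributions $f$ with $\|f\|_r=\big(2\pi\sum_{k\in\mathbb{Z}}(1+k^2)^r|\widehat f(k)|^2\big)^{1/2}<\infty$, where $\widehat f(k)=\frac1{2\pi}\langle f,e^{-ikx}\rangle$. Products of such spaces carry the sum of the component norms. Derivatives in $x$ are distributional; time derivatives are taken in $\tilde Z$ and the system is understood to hold in $\tilde Z$ for every $t\in[0,T]$. For $\psi\in H^s(\mathbb{T})$ with $s>3/2$, the expression $\overline\psi\,\partial_x^2\psi-\psi\,\partial_x^2\overline\psi$ is understood as $\partial_x\left(\overline\psi\,\partial_x\psi-\psi\,\partial_x\overline\psi\right)\in H^{s-2}(\mathbb{T})$. *)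

theory Defs
  imports "HOL-Analysis.Analysis"
begin

section \<open>Periodic distributions\<close>

abbreviation Dx :: "(real \<Rightarrow> complex) \<Rightarrow> real \<Rightarrow> complex"
  where "Dx f \<equiv> (\<lambda>x. vector_derivative f (at x))"

definition test_functions :: "(real \<Rightarrow> complex) set" where
  "test_functions =
     {f. (\<forall>x. f (x + 2 * pi) = f x) \<and> (\<forall>n x. ((Dx ^^ n) f) differentiable (at x))}"

definition test_seminorm :: "nat \<Rightarrow> (real \<Rightarrow> complex) \<Rightarrow> real" where
  "test_seminorm N f = (\<Sum>n\<le>N. SUP x\<in>{0..2 * pi}. cmod ((Dx ^^ n) f x))"

text \<open>A periodic distribution is a complex-linear functional on the smooth periodic functions,
  continuous for the seminorms above; it is \<open>undefined\<close> off \<^const>\<open>test_functions\<close>, so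
  that equality of distributions is equality of functionals on test functions.\<close>

definition distributions :: "((real \<Rightarrow> complex) \<Rightarrow> complex) set" where
  "distributions =
     {u \<in> extensional test_functions.
        (\<forall>f\<in>test_functions. \<forall>g\<in>test_functions. \<forall>a b.
            u (\<lambda>x. a * f x + b * g x) = a * u f + b * u g) \<and>
        (\<exists>C N. \<forall>f\<in>test_functions. cmod (u f) \<le> C * test_seminorm N f)}"

lemma Dx_pow_test: "f \<in> test_functions \<Longrightarrow> ((Dx ^^ n) f) differentiable (at x)"
  by (simp add: test_functions_def)

lemma Dx_pow_vec:
  "f \<in> test_functions \<Longrightarrow> ((Dx ^^ n) f has_vector_derivative (Dx ^^ Suc n) f x) (at x)"
  using Dx_pow_test[of f n x] by (simp add: vector_derivative_works)

lemma Dx_pow_cont: "f \<in> test_functions \<Longrightarrow> continuous_on A ((Dx ^^ n) f)"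
  by (intro continuous_at_imp_continuous_on ballI has_vector_derivative_continuous[OF Dx_pow_vec])

lemma Dx_pow_lin:
  assumes "f \<in> test_functions" "g \<in> test_functions"
  shows "(Dx ^^ n) (\<lambda>x. a * f x + b * g x) = (\<lambda>x. a * (Dx ^^ n) f x + b * (Dx ^^ n) g x)"
proof (induction n)
  case (Suc n)
  have "((\<lambda>x. a * (Dx ^^ n) f x + b * (Dx ^^ n) g x) has_vector_derivative
      a * (Dx ^^ Suc n) f x + b * (Dx ^^ Suc n) g x) (at x)" for x
    by (intro has_vector_derivative_add has_vector_derivative_mult_right Dx_pow_vec assms)
  then have "Dx (\<lambda>x. a * (Dx ^^ n) f x + b * (Dx ^^ n) g x)
      = (\<lambda>x. a * (Dx ^^ Suc n) f x + b * (Dx ^^ Suc n) g x)"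
    by (intro ext vector_derivative_at)
  then show ?case by (simp add: Suc)
qed simp

lemma Dx_pow_cnj:
  assumes "f \<in> test_functions"
  shows "(Dx ^^ n) (\<lambda>x. cnj (f x)) = (\<lambda>x. cnj ((Dx ^^ n) f x))"
proof (induction n)
  case (Suc n)
  have "((\<lambda>x. cnj ((Dx ^^ n) f x)) has_vector_derivative cnj ((Dx ^^ Suc n) f x)) (at x)" for x
    by (intro has_vector_derivative_cnj Dx_pow_vec assms)
  then have "Dx (\<lambda>x. cnj ((Dx ^^ n) f x)) = (\<lambda>x. cnj ((Dx ^^ Suc n) f x))"
    by (intro ext vector_derivative_at)
  then show ?case by (simp add: Suc)
qed simp

lemma test_functions_lin:
  assumes "f \<in> test_functions" "g \<in> test_functions"
  shows "(\<lambda>x. a * f x + b * g x) \<in> test_functions"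
proof -
  have "(\<lambda>x. a * (Dx ^^ n) f x + b * (Dx ^^ n) g x) differentiable (at x)" for n x
    by (intro differentiable_add differentiable_mult differentiable_const Dx_pow_test assms)
  then show ?thesis
    using assms unfolding test_functions_def
    by (auto simp: Dx_pow_lin[OF assms])
qed

lemma test_functions_cnj:
  assumes "f \<in> test_functions"
  shows "(\<lambda>x. cnj (f x)) \<in> test_functions"
proof -
  have "(\<lambda>x. cnj ((Dx ^^ n) f x)) differentiable (at x)" for n x
    using has_vector_derivative_cnj[OF Dx_pow_vec[OF assms, of n x]]
    by (auto simp: has_vector_derivative_def differentiable_def)
  then show ?thesis
    using assms unfolding test_functions_def
    by (auto simp: Dx_pow_cnj[OF assms])
qed

lemma Dx_pow_Dx: "(Dx ^^ n) (Dx f) = (Dx ^^ Suc n) f"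
  by (metis funpow_swap1 funpow.simps(2) comp_apply)

lemma test_functions_Dx:
  assumes "f \<in> test_functions"
  shows "Dx f \<in> test_functions"
proof -
  have "Dx f (x + 2 * pi) = Dx f x" for x
  proof -
    have "(f has_vector_derivative Dx f (x + 2 * pi)) (at (x + 2 * pi))"
      using Dx_pow_vec[OF assms, of 0] by simp
    then have "((f \<circ> (\<lambda>x. x + 2 * pi)) has_vector_derivative (1 *\<^sub>R Dx f (x + 2 * pi))) (at x)"
      by (intro vector_diff_chain_at) (auto intro!: derivative_eq_intros)
    moreover have "f \<circ> (\<lambda>x. x + 2 * pi) = f"
      using assms by (auto simp: test_functions_def)
    ultimately show ?thesis
      by (simp add: vector_derivative_at)
  qed
  moreover have "(Dx ^^ n) (Dx f) differentiable (at x)" for n x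
    unfolding Dx_pow_Dx by (rule Dx_pow_test[OF assms])
  ultimately show ?thesis
    unfolding test_functions_def by blast
qed

lemma test_functions_exp:
  "(\<lambda>x. exp (\<i> * of_int k * of_real x)) \<in> test_functions" (is "?e \<in> _")
proof -
  have D: "((\<lambda>x. (\<i> * of_int k) ^ n * exp (\<i> * of_int k * of_real x)) has_vector_derivative
        (\<i> * of_int k) ^ Suc n * exp (\<i> * of_int k * of_real x)) (at x)" for n and x :: real
  proof -
    have "((\<lambda>z. (\<i> * of_int k) ^ n * exp (\<i> * of_int k * z)) has_field_derivative
        (\<i> * of_int k) ^ Suc n * exp (\<i> * of_int k * of_real x)) (at (of_real x))"
      by (auto intro!: derivative_eq_intros)
    then show ?thesis by (rule has_vector_derivative_real_field)
  qed
  have P: "(Dx ^^ n) ?e = (\<lambda>x. (\<i> * of_int k) ^ n * exp (\<i> * of_int k * of_real x))" for n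
  proof (induction n)
    case (Suc n)
    have "Dx (\<lambda>x. (\<i> * of_int k) ^ n * exp (\<i> * of_int k * of_real x)) =
      (\<lambda>x. (\<i> * of_int k) ^ Suc n * exp (\<i> * of_int k * of_real x))"
      using D by (intro ext vector_derivative_at)
    then show ?case by (simp add: Suc)
  qed simp
  have "exp (\<i> * of_int k * of_real (x + 2 * pi)) = exp (\<i> * of_int k * of_real x)" for x
  proof -
    have "\<i> * of_int k * of_real (x + 2 * pi)
        = \<i> * of_int k * of_real x + of_int (2 * k) * (of_real pi * \<i>)"
      by (simp add: algebra_simps)
    then show ?thesis
      using exp_plus_2pin[of "\<i> * of_int k * of_real x" k]
      by (simp add: algebra_simps)
  qed
  moreover have "(\<lambda>x. (\<i> * of_int k) ^ n * exp (\<i> * of_int k * of_real x)) differentiable (at x)"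
    for n and x :: real
    using D[of n x] by (auto simp: has_vector_derivative_def differentiable_def)
  ultimately show ?thesis
    unfolding test_functions_def mem_Collect_eq P by blast
qed

lemma test_sup_upper:
  assumes "f \<in> test_functions" "x \<in> {0..2 * pi}"
  shows "cmod ((Dx ^^ n) f x) \<le> (SUP x\<in>{0..2 * pi}. cmod ((Dx ^^ n) f x))"
proof -
  have "compact ((\<lambda>x. cmod ((Dx ^^ n) f x)) ` {0..2 * pi})"
    by (intro compact_continuous_image continuous_on_norm Dx_pow_cont assms) auto
  then show ?thesis
    using assms(2) by (intro cSUP_upper) (auto dest: compact_imp_bounded bounded_imp_bdd_above)
qed

lemma test_sup_nonneg:
  assumes "f \<in> test_functions"
  shows "0 \<le> (SUP x\<in>{0..2 * pi}. cmod ((Dx ^^ n) f x))"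
  using test_sup_upper[OF assms, of 0 n] by (simp add: order_trans[OF norm_ge_zero])

lemma test_seminorm_nonneg: "f \<in> test_functions \<Longrightarrow> 0 \<le> test_seminorm N f"
  unfolding test_seminorm_def by (intro sum_nonneg test_sup_nonneg)

lemma test_seminorm_mono: "f \<in> test_functions \<Longrightarrow> N \<le> N' \<Longrightarrow> test_seminorm N f \<le> test_seminorm N' f"
  unfolding test_seminorm_def by (intro sum_mono2) (auto intro: test_sup_nonneg)

lemma test_seminorm_Dx:
  assumes "f \<in> test_functions"
  shows "test_seminorm N (Dx f) \<le> test_seminorm (Suc N) f"
  using test_sup_nonneg[OF assms, of 0] unfolding test_seminorm_def Dx_pow_Dx sum.atMost_Suc_shift
  by simp

lemma test_seminorm_cnj:
  "f \<in> test_functions \<Longrightarrow> test_seminorm N (\<lambda>x. cnj (f x)) = test_seminorm N f"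
  by (simp add: test_seminorm_def Dx_pow_cnj)

lemma distributionsI:
  assumes "u \<in> extensional test_functions"
    and "\<And>f g a b. f \<in> test_functions \<Longrightarrow> g \<in> test_functions \<Longrightarrow>
            u (\<lambda>x. a * f x + b * g x) = a * u f + b * u g"
    and "\<And>f. f \<in> test_functions \<Longrightarrow> cmod (u f) \<le> C * test_seminorm N f"
  shows "u \<in> distributions"
  using assms unfolding distributions_def by blast

lemma distributions_lin:
  assumes "u \<in> distributions" "f \<in> test_functions" "g \<in> test_functions"
  shows "u (\<lambda>x. a * f x + b * g x) = a * u f + b * u g"
  using assms unfolding distributions_def by blast

lemma distributions_bound:
  assumes "u \<in> distributions"
  obtains C N where "C \<ge> 0" "\<And>f. f \<in> test_functions \<Longrightarrow> cmod (u f) \<le> C * test_seminorm N f"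
proof -
  obtain C N where CN: "\<And>f. f \<in> test_functions \<Longrightarrow> cmod (u f) \<le> C * test_seminorm N f"
    using assms unfolding distributions_def by blast
  have "cmod (u f) \<le> \<bar>C\<bar> * test_seminorm N f" if "f \<in> test_functions" for f
    using CN[OF that] test_seminorm_nonneg[OF that, of N]
    by (meson abs_ge_self mult_right_mono order_trans)
  then show ?thesis using that[of "\<bar>C\<bar>" N] by simp
qed

lemma distributions_comb:
  assumes u: "u \<in> distributions" and v: "v \<in> distributions"
  shows "(\<lambda>f\<in>test_functions. a * u f + b * v f) \<in> distributions"
proof -
  obtain C N where 1: "C \<ge> 0" "\<And>f. f \<in> test_functions \<Longrightarrow> cmod (u f) \<le> C * test_seminorm N f"
    using distributions_bound[OF u] by blast
  obtain C' N' where 2: "C' \<ge> 0" "\<And>f. f \<in> test_functions \<Longrightarrow> cmod (v f) \<le> C' * test_seminorm N' f"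
    using distributions_bound[OF v] by blast
  show ?thesis
  proof (rule distributionsI)
    fix f assume f: "f \<in> test_functions"
    let ?S = "test_seminorm (max N N') f"
    have "cmod (u f) \<le> C * ?S" "cmod (v f) \<le> C' * ?S"
      using 1 2 f test_seminorm_mono[OF f, of N "max N N'"] test_seminorm_mono[OF f, of N' "max N N'"]
      by (meson max.cobounded1 max.cobounded2 mult_left_mono order_trans)+
    then have "cmod (a * u f + b * v f) \<le> cmod a * (C * ?S) + cmod b * (C' * ?S)"
      by (intro norm_triangle_le) (simp add: norm_mult add_mono mult_left_mono)
    then show "cmod ((\<lambda>f\<in>test_functions. a * u f + b * v f) f) \<le> (cmod a * C + cmod b * C') * ?S"
      using f by (simp add: algebra_simps)
  qed (auto simp: test_functions_lin distributions_lin u v algebra_simps)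
qed

lemma distributions_zero: "(\<lambda>f\<in>test_functions. 0) \<in> distributions"
  by (rule distributionsI[where C = 0]) (auto simp: test_functions_lin)

lemma distributions_deriv:
  assumes "u \<in> distributions"
  shows "(\<lambda>f\<in>test_functions. - u (Dx f)) \<in> distributions"
proof -
  obtain C N where 1: "C \<ge> 0" "\<And>f. f \<in> test_functions \<Longrightarrow> cmod (u f) \<le> C * test_seminorm N f"
    using distributions_bound[OF assms] by blast
  show ?thesis
  proof (rule distributionsI)
    fix f assume f: "f \<in> test_functions"
    show "cmod ((\<lambda>f\<in>test_functions. - u (Dx f)) f) \<le> C * test_seminorm (Suc N) f"
      using 1(2)[OF test_functions_Dx[OF f]] mult_left_mono[OF test_seminorm_Dx[OF f, of N] 1(1)] f
      by simp
  next
    fix f g a b assume fg: "f \<in> test_functions" "g \<in> test_functions"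
    have "Dx (\<lambda>x. a * f x + b * g x) = (\<lambda>x. a * Dx f x + b * Dx g x)"
      using Dx_pow_lin[OF fg, of 1] by simp
    then show "(\<lambda>f\<in>test_functions. - u (Dx f)) (\<lambda>x. a * f x + b * g x)
        = a * (\<lambda>f\<in>test_functions. - u (Dx f)) f + b * (\<lambda>f\<in>test_functions. - u (Dx f)) g"
      using fg by (simp add: test_functions_lin distributions_lin[OF assms] test_functions_Dx)
  qed auto
qed

lemma distributions_cnj:
  assumes "u \<in> distributions"
  shows "(\<lambda>f\<in>test_functions. cnj (u (\<lambda>x. cnj (f x)))) \<in> distributions"
proof -
  obtain C N where 1: "C \<ge> 0" "\<And>f. f \<in> test_functions \<Longrightarrow> cmod (u f) \<le> C * test_seminorm N f"
    using distributions_bound[OF assms] by blast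
  show ?thesis
    by (rule distributionsI[where C = C and N = N])
      (use 1(2)[OF test_functions_cnj] in
        \<open>auto simp: test_functions_lin distributions_lin[OF assms] test_functions_cnj test_seminorm_cnj\<close>)
qed

lemma distributions_continuous:
  fixes h :: "real \<Rightarrow> complex"
  assumes h: "continuous_on {0..2 * pi} h"
  shows "(\<lambda>f\<in>test_functions. integral {0..2 * pi} (\<lambda>x. h x * f x)) \<in> distributions"
proof -
  have cont: "continuous_on {0..2 * pi} (\<lambda>x. h x * f x)" if "f \<in> test_functions" for f
    using Dx_pow_cont[OF that, of _ 0] by (intro continuous_on_mult h) simp
  have int: "(\<lambda>x. h x * f x) integrable_on {0..2 * pi}" if "f \<in> test_functions" for f
    by (intro integrable_continuous_interval cont that)
  have "compact (h ` {0..2 * pi})"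
    by (intro compact_continuous_image h) auto
  then obtain B where B: "\<And>x. x \<in> {0..2 * pi} \<Longrightarrow> cmod (h x) \<le> B" "B > 0"
    using bounded_pos[of "h ` {0..2 * pi}"] compact_imp_bounded by (metis image_eqI)
  show ?thesis
  proof (rule distributionsI)
    fix f assume f: "f \<in> test_functions"
    have "cmod (h x * f x) \<le> B * test_seminorm 0 f" if "x \<in> {0..2 * pi}" for x
      using test_sup_upper[OF f that, of 0] B(1)[OF that] B(2)
      by (auto simp: norm_mult test_seminorm_def intro!: mult_mono)
    then have "cmod (integral {0..2 * pi} (\<lambda>x. h x * f x)) \<le> B * test_seminorm 0 f * (2 * pi - 0)"
      by (intro integral_bound cont f) auto
    then show "cmod ((\<lambda>f\<in>test_functions. integral {0..2 * pi} (\<lambda>x. h x * f x)) f)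
        \<le> (2 * pi * B) * test_seminorm 0 f"
      using f by (simp add: algebra_simps)
  next
    fix f g a b assume fg: "f \<in> test_functions" "g \<in> test_functions"
    have "integral {0..2 * pi} (\<lambda>x. h x * (a * f x + b * g x))
        = integral {0..2 * pi} (\<lambda>x. a * (h x * f x) + b * (h x * g x))"
      by (simp add: algebra_simps)
    also have "\<dots> = a * integral {0..2 * pi} (\<lambda>x. h x * f x) + b * integral {0..2 * pi} (\<lambda>x. h x * g x)"
      using int[OF fg(1)] int[OF fg(2)]
      by (subst integral_add) (auto intro!: integrable_on_mult_right)
    finally show "(\<lambda>f\<in>test_functions. integral {0..2 * pi} (\<lambda>x. h x * f x)) (\<lambda>x. a * f x + b * g x)
        = a * (\<lambda>f\<in>test_functions. integral {0..2 * pi} (\<lambda>x. h x * f x)) f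
        + b * (\<lambda>f\<in>test_functions. integral {0..2 * pi} (\<lambda>x. h x * f x)) g"
      using fg by (simp add: test_functions_lin)
  qed auto
qed

typedef pdist = distributions morphisms pairing Abs_pdist
  using distributions_zero by blast

definition pd_comb :: "complex \<Rightarrow> pdist \<Rightarrow> complex \<Rightarrow> pdist \<Rightarrow> pdist" where
  "pd_comb a u b v = Abs_pdist (\<lambda>f\<in>test_functions. a * pairing u f + b * pairing v f)"

definition pd_scale :: "complex \<Rightarrow> pdist \<Rightarrow> pdist"  (infixr "*\<^sub>C" 75) where
  "a *\<^sub>C u = pd_comb a u 0 u"

instantiation pdist :: real_vector
begin

definition zero_pdist :: pdist where "0 = Abs_pdist (\<lambda>f\<in>test_functions. 0)"
definition plus_pdist :: "pdist \<Rightarrow> pdist \<Rightarrow> pdist" where "u + v = pd_comb 1 u 1 v"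
definition minus_pdist :: "pdist \<Rightarrow> pdist \<Rightarrow> pdist" where "u - v = pd_comb 1 u (- 1) v"
definition uminus_pdist :: "pdist \<Rightarrow> pdist" where "- u = (- 1) *\<^sub>C u"
definition scaleR_pdist :: "real \<Rightarrow> pdist \<Rightarrow> pdist" where "r *\<^sub>R u = of_real r *\<^sub>C (u :: pdist)"

lemma pairing_comb: "pairing (pd_comb a u b v) = (\<lambda>f\<in>test_functions. a * pairing u f + b * pairing v f)"
  by (simp add: pd_comb_def Abs_pdist_inverse distributions_comb pairing)

lemma pairing_zero: "pairing 0 = (\<lambda>f\<in>test_functions. 0)"
  by (simp add: zero_pdist_def Abs_pdist_inverse distributions_zero)

lemma pdist_eqI: "(\<And>f. f \<in> test_functions \<Longrightarrow> pairing u f = pairing v f) \<Longrightarrow> u = v"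
proof -
  assume *: "\<And>f. f \<in> test_functions \<Longrightarrow> pairing u f = pairing v f"
  have "pairing u \<in> extensional test_functions" "pairing v \<in> extensional test_functions"
    using pairing[of u] pairing[of v] by (auto simp: distributions_def)
  then have "pairing u = pairing v" using * by (rule extensionalityI)
  then show "u = v" by (simp add: pairing_inject)
qed

instance
  by standard
    (auto intro!: pdist_eqI simp: plus_pdist_def minus_pdist_def uminus_pdist_def scaleR_pdist_def
       pd_scale_def pairing_comb pairing_zero algebra_simps)

end

definition pd_deriv :: "pdist \<Rightarrow> pdist"  ("\<partial>\<^sub>x _" [81] 80) where
  "\<partial>\<^sub>x u = Abs_pdist (\<lambda>f\<in>test_functions. - pairing u (Dx f))"

definition pd_cnj :: "pdist \<Rightarrow> pdist" where
  "pd_cnj u = Abs_pdist (\<lambda>f\<in>test_functions. cnj (pairing u (\<lambda>x. cnj (f x))))"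

lemma pairing_deriv: "pairing (\<partial>\<^sub>x u) = (\<lambda>f\<in>test_functions. - pairing u (Dx f))"
  by (simp add: pd_deriv_def Abs_pdist_inverse distributions_deriv pairing)

lemma pairing_cnj: "pairing (pd_cnj u) = (\<lambda>f\<in>test_functions. cnj (pairing u (\<lambda>x. cnj (f x))))"
  by (simp add: pd_cnj_def Abs_pdist_inverse distributions_cnj pairing)

definition pd_of_fun :: "(real \<Rightarrow> complex) \<Rightarrow> pdist" where
  "pd_of_fun h = Abs_pdist (\<lambda>f\<in>test_functions. integral {0..2 * pi} (\<lambda>x. h x * f x))"

lemma pairing_of_fun:
  "continuous_on {0..2 * pi} h \<Longrightarrow>
     pairing (pd_of_fun h) = (\<lambda>f\<in>test_functions. integral {0..2 * pi} (\<lambda>x. h x * f x))"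
  by (simp add: pd_of_fun_def Abs_pdist_inverse distributions_continuous)

text \<open>Products are pointwise products of continuous representatives, and have no meaning when a
  factor is not a continuous function. All factors multiplied below lie in \<open>H\<^sup>r\<close> with
  \<open>r > 1/2\<close> and are therefore continuous by Sobolev embedding.\<close>

definition pd_fun :: "pdist \<Rightarrow> real \<Rightarrow> complex" where
  "pd_fun u = (THE h. continuous_on UNIV h \<and> (\<forall>x. h (x + 2 * pi) = h x) \<and> u = pd_of_fun h)"

definition pd_mult :: "pdist \<Rightarrow> pdist \<Rightarrow> pdist"  (infixl "\<cdot>\<^sub>d" 70) where
  "u \<cdot>\<^sub>d v = pd_of_fun (\<lambda>x. pd_fun u x * pd_fun v x)"

abbreviation pd_abs2 :: "pdist \<Rightarrow> pdist" where
  "pd_abs2 u \<equiv> u \<cdot>\<^sub>d pd_cnj u"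


section \<open>Sobolev spaces\<close>

definition fcoeff :: "pdist \<Rightarrow> int \<Rightarrow> complex" where
  "fcoeff u k = pairing u (\<lambda>x. exp (\<i> * of_int (- k) * of_real x)) / (2 * pi)"

definition sobolev :: "real \<Rightarrow> pdist set" where
  "sobolev r = {u. (\<lambda>k::int. (1 + (real_of_int k)\<^sup>2) powr r * (cmod (fcoeff u k))\<^sup>2) summable_on UNIV}"

definition sobolev_norm :: "real \<Rightarrow> pdist \<Rightarrow> real" where
  "sobolev_norm r u =
     sqrt (2 * pi * (\<Sum>\<^sub>\<infinity>k::int. (1 + (real_of_int k)\<^sup>2) powr r * (cmod (fcoeff u k))\<^sup>2))"

definition sobolev_real :: "real \<Rightarrow> pdist set" where
  "sobolev_real r = {u \<in> sobolev r. pd_cnj u = u}"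

text \<open>\<open>Z_space s\<close> is the space \<open>Z\<close>, and \<open>Z_space (s - 2)\<close> is \<open>Z\<close> with a tilde.\<close>

definition Z_space :: "real \<Rightarrow> (pdist \<times> pdist \<times> pdist) set" where
  "Z_space r = sobolev r \<times> sobolev_real r \<times> sobolev_real (r + 1)"

definition Z_norm :: "real \<Rightarrow> pdist \<times> pdist \<times> pdist \<Rightarrow> real" where
  "Z_norm r = (\<lambda>(\<psi>, \<rho>, \<phi>). sobolev_norm r \<psi> + sobolev_norm r \<rho> + sobolev_norm (r + 1) \<phi>)"

text \<open>\<open>X\<close> carries the norm \<open>N\<close>; only the values of a curve on \<open>[0,T]\<close> matter.\<close>

definition C0_curve :: "'a::real_vector set \<Rightarrow> ('a \<Rightarrow> real) \<Rightarrow> real \<Rightarrow> (real \<Rightarrow> 'a) \<Rightarrow> bool" where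
  "C0_curve X N T u \<longleftrightarrow>
     (\<forall>t\<in>{0..T}. u t \<in> X \<and> ((\<lambda>\<tau>. N (u \<tau> - u t)) \<longlongrightarrow> 0) (at t within {0..T}))"

definition C1_curve ::
  "'a::real_vector set \<Rightarrow> ('a \<Rightarrow> real) \<Rightarrow> real \<Rightarrow> (real \<Rightarrow> 'a) \<Rightarrow> (real \<Rightarrow> 'a) \<Rightarrow> bool" where
  "C1_curve X N T u u' \<longleftrightarrow> C0_curve X N T u \<and> C0_curve X N T u' \<and>
     (\<forall>t\<in>{0..T}.
        ((\<lambda>\<tau>. N ((1 / (\<tau> - t)) *\<^sub>R (u \<tau> - u t) - u' t)) \<longlongrightarrow> 0) (at t within {0..T}))"


section \<open>The modified Zakharov-Rubenchik system\<close>

text \<open>The expression \<open>cnj \<psi> \<psi>\<^sub>x\<^sub>x - \<psi> (cnj \<psi>)\<^sub>x\<^sub>x\<close> in the first correction is read as the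
  \<open>x\<close>-derivative of \<open>cnj \<psi> \<psi>\<^sub>x - \<psi> (cnj \<psi>)\<^sub>x\<close>, since \<open>\<psi>\<^sub>x\<^sub>x\<close> need not be a function.\<close>

definition pd_current :: "pdist \<Rightarrow> pdist" where
  "pd_current \<psi> = pd_cnj \<psi> \<cdot>\<^sub>d (\<partial>\<^sub>x \<psi>) - \<psi> \<cdot>\<^sub>d (\<partial>\<^sub>x (pd_cnj \<psi>))"

definition L1 :: "real \<Rightarrow> real \<Rightarrow> pdist \<Rightarrow> pdist" where
  "L1 \<delta> \<alpha>1 \<psi> = (- \<i> * of_real \<delta> * of_real \<alpha>1) *\<^sub>C (\<partial>\<^sub>x (pd_current \<psi>))"

definition L2 :: "real \<Rightarrow> real \<Rightarrow> real \<Rightarrow> pdist \<Rightarrow> pdist" where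
  "L2 M \<delta> \<alpha>2 \<psi> = (- (\<i> / of_real M) * of_real \<delta> * of_real \<alpha>2) *\<^sub>C pd_current \<psi>"

definition alpha_system :: "real \<Rightarrow> real \<Rightarrow> real \<Rightarrow> real \<Rightarrow> real \<Rightarrow> bool" where
  "alpha_system M \<sigma>3 D \<alpha>1 \<alpha>2 \<longleftrightarrow>
     1 / M * \<alpha>2 + D = - \<sigma>3 * \<alpha>1 \<and> 1 / M * \<alpha>1 + M = - \<sigma>3 * \<alpha>2"

lemma alpha_system_unique:
  assumes "M > 0" "M \<noteq> 1" "\<sigma>3 \<in> {1, -1}"
  shows "\<exists>!(\<alpha>1, \<alpha>2). alpha_system M \<sigma>3 D \<alpha>1 \<alpha>2"
proof -
  have M: "M\<^sup>2 - 1 \<noteq> 0"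
    using assms(1,2) by (simp add: power2_eq_1_iff)
  let ?a = "M * M * (1 - \<sigma>3 * D) / (M\<^sup>2 - 1)"
  let ?b = "M * (D - \<sigma>3 * M\<^sup>2) / (M\<^sup>2 - 1)"
  have "alpha_system M \<sigma>3 D a b \<longleftrightarrow> a = ?a \<and> b = ?b" for a b
  proof -
    have "alpha_system M \<sigma>3 D a b \<longleftrightarrow> b + M * D = - \<sigma>3 * M * a \<and> a + M * M = - \<sigma>3 * M * b"
      using assms(1) unfolding alpha_system_def by (simp add: field_simps)
    also have "\<dots> \<longleftrightarrow> a * (M\<^sup>2 - 1) = M * M * (1 - \<sigma>3 * D) \<and> b * (M\<^sup>2 - 1) = M * (D - \<sigma>3 * M\<^sup>2)"
      (is "?l \<longleftrightarrow> ?r")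
    proof
      assume ?l
      then have 1: "b = - \<sigma>3 * M * a - M * D" "a = - \<sigma>3 * M * b - M * M" by auto
      have s: "\<sigma>3 * \<sigma>3 = 1" using assms(3) by auto
      show ?r using 1 s by (intro conjI; algebra)
    next
      assume ?r
      moreover have s: "\<sigma>3 * \<sigma>3 = 1" using assms(3) by auto
      ultimately have "(b + M * D + \<sigma>3 * M * a) * (M\<^sup>2 - 1) = 0" "(a + M * M + \<sigma>3 * M * b) * (M\<^sup>2 - 1) = 0"
        by algebra+
      then have "b + M * D + \<sigma>3 * M * a = 0" "a + M * M + \<sigma>3 * M * b = 0"
        using M by simp_all
      then show ?l by (simp add: add_eq_0_iff2)
    qed
    also have "\<dots> \<longleftrightarrow> a = ?a \<and> b = ?b"
      using M by (auto simp: eq_divide_eq)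
    finally show ?thesis .
  qed
  then show ?thesis
    by (intro ex1I[of _ "(?a, ?b)"]) auto
qed

definition mZR_system ::
  "real \<Rightarrow> real \<Rightarrow> real \<Rightarrow> real \<Rightarrow> real \<Rightarrow> real \<Rightarrow> real \<Rightarrow> real \<Rightarrow> real \<Rightarrow>
   pdist \<times> pdist \<times> pdist \<Rightarrow> pdist \<times> pdist \<times> pdist \<Rightarrow> bool" where
  "mZR_system M \<sigma>2 \<sigma>3 \<delta> D W \<alpha>1 \<alpha>2 \<epsilon> = (\<lambda>(\<psi>, \<rho>, \<phi>) (\<psi>\<^sub>t, \<rho>\<^sub>t, \<phi>\<^sub>t).
     \<psi>\<^sub>t - \<sigma>3 *\<^sub>R (\<partial>\<^sub>x \<psi>) - (\<i> * of_real \<epsilon> * of_real \<delta>) *\<^sub>C (\<partial>\<^sub>x (\<partial>\<^sub>x \<psi>))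
       + (\<i> * of_real \<epsilon>) *\<^sub>C ((\<sigma>2 *\<^sub>R pd_abs2 \<psi> + W *\<^sub>R (\<rho> + D *\<^sub>R (\<partial>\<^sub>x \<phi>))) \<cdot>\<^sub>d \<psi>) = 0 \<and>
     \<rho>\<^sub>t + (\<partial>\<^sub>x (\<partial>\<^sub>x \<phi>)) + D *\<^sub>R (\<partial>\<^sub>x (pd_abs2 \<psi>)) + \<epsilon> *\<^sub>R L1 \<delta> \<alpha>1 \<psi> = 0 \<and>
     \<phi>\<^sub>t + (1 / M\<^sup>2) *\<^sub>R \<rho> + pd_abs2 \<psi> + \<epsilon> *\<^sub>R L2 M \<delta> \<alpha>2 \<psi> = 0)"

definition mZR_solution ::
  "real \<Rightarrow> real \<Rightarrow> real \<Rightarrow> real \<Rightarrow> real \<Rightarrow> real \<Rightarrow> real \<Rightarrow> real \<Rightarrow> real \<Rightarrow> real \<Rightarrow> real \<Rightarrow>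
   pdist \<times> pdist \<times> pdist \<Rightarrow> (real \<Rightarrow> pdist \<times> pdist \<times> pdist) \<Rightarrow> bool" where
  "mZR_solution s M \<sigma>2 \<sigma>3 \<delta> D W \<alpha>1 \<alpha>2 \<epsilon> T \<Psi>\<^sub>0 \<Psi> \<longleftrightarrow>
     C0_curve (Z_space s) (Z_norm s) T \<Psi> \<and>
     (\<exists>\<Psi>\<^sub>t. C1_curve (Z_space (s - 2)) (Z_norm (s - 2)) T \<Psi> \<Psi>\<^sub>t \<and>
        (\<forall>t\<in>{0..T}. mZR_system M \<sigma>2 \<sigma>3 \<delta> D W \<alpha>1 \<alpha>2 \<epsilon> (\<Psi> t) (\<Psi>\<^sub>t t))) \<and>
     \<Psi> 0 = \<Psi>\<^sub>0"

end

theory Submission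
  imports Defs
begin

text \<open>Because the potential in the Schroedinger equation is real, the density \<open>n = |\<psi>|\<^sup>2\<close> satisfies
  \<open>n\<^sub>t = \<sigma>3 n\<^sub>x + \<i> \<epsilon> \<delta> J\<^sub>x\<close> with the current \<open>J\<close> of \<open>\<psi>\<close>. The corrections \<open>L1\<close>, \<open>L2\<close> and the choice of
  \<open>\<alpha>1\<close>, \<open>\<alpha>2\<close> are such that \<open>\<rho> - \<alpha>1 n\<close> and \<open>\<phi>\<^sub>x - (\<alpha>2 / M) n\<close> solve the free wave equation exactly, so they
  are explicit in Fourier variables and bounded in \<open>H\<^sup>s\<close> uniformly in time. What remains is a nonlinear
  Schroedinger equation for \<open>\<psi>\<close> whose nonlinearity is \<open>\<epsilon>\<close> times a locally Lipschitz map of the algebra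
  \<open>H\<^sup>s\<close>; in the interaction picture it is an ordinary differential equation in a sequence space, which
  Picard iteration solves up to a time of order \<open>1 / \<epsilon>\<close>. Uniqueness follows by running the same
  reduction on an arbitrary solution.\<close>

section \<open>Fourier series\<close>

text \<open>The obstacle is a loss of derivatives: for \<open>\<psi>\<close> in H^s the correction
  \<open>L1\<close> only lies in H^(s-2), so the right-hand side of the system is not Lipschitz on
  \<open>Z_space s\<close> and iteration cannot be applied to it directly. The change of unknowns
  works because the current J cancels by the form of \<open>L1\<close> and \<open>L2\<close>, while
  the equations for \<open>\<alpha>1\<close>, \<open>\<alpha>2\<close> say exactly that the leftover
  terms in n recombine into the new unknowns (\<open>wave_algebra\<close>). The Lipschitz constant
  of the reduced nonlinearity does not involve \<epsilon>, so c is the same for every \<epsilon> >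
  0, not only for small ones. A second obstacle is that the time derivative of \<open>\<psi>\<close>
  lies in H^(s-2), whose exponent may be negative, so n_t is not a product of functions. It is
  computed one Fourier mode at a time through the duality of H^1 and H^(-1). All norms are moved to
  one space \<open>l2\<close> of weighted coefficients, where a time derivative need only be checked
  in each mode once the candidate is known to be continuous (\<open>H_C1I\<close>). Finally, the
  x-derivative of \<open>\<phi>\<close> does not see the mean of \<open>\<phi>\<close>, so mode 0 is
  recovered separately by integrating the third equation in time.\<close>

definition ebas :: "int \<Rightarrow> real \<Rightarrow> complex" where
  "ebas k x = exp (\<i> * of_int k * of_real x)"

lemma ebas_test: "ebas k \<in> test_functions"
  using test_functions_exp[of k] by (simp add: ebas_def[abs_def])

lemma norm_ebas [simp]: "cmod (ebas k x) = 1"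
  by (simp add: ebas_def norm_exp_eq_Re)

lemma ebas_add: "ebas (j + k) x = ebas j x * ebas k x"
  by (simp add: ebas_def exp_add [symmetric] algebra_simps)

lemma ebas_0 [simp]: "ebas 0 x = 1"
  by (simp add: ebas_def)

lemma cnj_ebas: "cnj (ebas k x) = ebas (- k) x"
  by (simp add: ebas_def exp_cnj)

lemma ebas_periodic: "ebas k (x + 2 * pi) = ebas k x"
  using ebas_test by (auto simp: test_functions_def)

lemma ebas_deriv: "(ebas k has_vector_derivative \<i> * of_int k * ebas k x) (at x within S)"
proof -
  have "((\<lambda>z. exp (\<i> * of_int k * z)) has_field_derivative
        \<i> * of_int k * exp (\<i> * of_int k * of_real x)) (at (of_real x))"
    by (auto intro!: derivative_eq_intros)
  from has_vector_derivative_real_field[OF this] show ?thesis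
    by (auto simp: ebas_def[abs_def] intro: has_vector_derivative_at_within)
qed

lemma continuous_ebas [continuous_intros]: "continuous_on S (ebas k)"
  by (intro continuous_at_imp_continuous_on ballI has_vector_derivative_continuous[OF ebas_deriv])

lemma integral_ebas: "integral {0..2 * pi} (ebas k) = (if k = 0 then 2 * pi else 0)"
proof (cases "k = 0")
  case False
  have "((\<lambda>x. \<i> * of_int k * ebas k x) has_integral (ebas k (2 * pi) - ebas k 0)) {0..2 * pi}"
    by (intro fundamental_theorem_of_calculus ebas_deriv) auto
  moreover have "ebas k (2 * pi) = ebas k 0" using ebas_periodic[of k 0] by simp
  ultimately have "((\<lambda>x. \<i> * of_int k * ebas k x) has_integral 0) {0..2 * pi}"
    by simp
  from has_integral_mult_right[OF this, of "1 / (\<i> * of_int k)"]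
  have "(ebas k has_integral 0) {0..2 * pi}"
    using False by (simp add: field_simps)
  then show ?thesis using False by (simp add: integral_unique)
qed (simp add: ebas_def[abs_def] scaleR_conv_of_real)

definition fc :: "(real \<Rightarrow> complex) \<Rightarrow> int \<Rightarrow> complex" where
  "fc h k = integral {0..2 * pi} (\<lambda>x. h x * ebas (- k) x) / (2 * pi)"

lemma fc_integrable:
  assumes "continuous_on {0..2 * pi} h"
  shows "(\<lambda>x. h x * ebas k x) integrable_on {0..2 * pi}"
  by (intro integrable_continuous_interval continuous_intros assms)

lemma fc_bound:
  assumes "continuous_on {0..2 * pi} h" "\<And>x. x \<in> {0..2 * pi} \<Longrightarrow> cmod (h x) \<le> B"
  shows "cmod (fc h k) \<le> B"
proof -
  have "norm (integral {0..2 * pi} (\<lambda>x. h x * ebas (- k) x)) \<le> B * (2 * pi - 0)"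
    by (intro integral_bound continuous_intros assms) (auto simp: norm_mult assms)
  then show ?thesis by (simp add: fc_def norm_divide divide_simps)
qed

lemma fc_diff:
  assumes "continuous_on {0..2 * pi} g" "continuous_on {0..2 * pi} h"
  shows "fc (\<lambda>x. g x - h x) k = fc g k - fc h k"
  unfolding fc_def left_diff_distrib
  by (subst integral_diff) (auto intro!: fc_integrable assms simp: diff_divide_distrib)

lemma fc_sum_ebas:
  assumes "finite F"
  shows "fc (\<lambda>x. \<Sum>j\<in>F. c j * ebas j x) k = (if k \<in> F then c k else 0)"
proof -
  have "integral {0..2 * pi} (\<lambda>x. (\<Sum>j\<in>F. c j * ebas j x) * ebas (- k) x)
      = integral {0..2 * pi} (\<lambda>x. \<Sum>j\<in>F. c j * ebas (j - k) x)"
    by (simp add: sum_distrib_right mult.assoc flip: ebas_add)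
  also have "\<dots> = (\<Sum>j\<in>F. integral {0..2 * pi} (\<lambda>x. c j * ebas (j - k) x))"
    by (intro integral_sum assms integrable_continuous_interval continuous_intros)
  also have "\<dots> = (\<Sum>j\<in>F. c j * (if j = k then 2 * pi else 0))"
    by (intro sum.cong refl) (auto simp: integral_ebas)
  also have "\<dots> = (if k \<in> F then c k * (2 * pi) else 0)"
    using assms by (simp add: if_distrib sum.delta cong: if_cong)
  finally show ?thesis by (simp add: fc_def)
qed

section \<open>Density of trigonometric polynomials and completeness of the exponentials\<close>

inductive trig_poly :: "(real \<Rightarrow> complex) \<Rightarrow> bool" where
  basis: "trig_poly (\<lambda>x. c * ebas k x)"
| add: "trig_poly f \<Longrightarrow> trig_poly g \<Longrightarrow> trig_poly (\<lambda>x. f x + g x)"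

lemma trig_poly_mult: "trig_poly f \<Longrightarrow> trig_poly g \<Longrightarrow> trig_poly (\<lambda>x. f x * g x)"
proof (induction rule: trig_poly.induct)
  case (basis c k)
  then show ?case
  proof (induction rule: trig_poly.induct)
    case (basis d j)
    have "(\<lambda>x. c * ebas k x * (d * ebas j x)) = (\<lambda>x. (c * d) * ebas (k + j) x)"
      by (auto simp: ebas_add)
    then show ?case by (metis trig_poly.basis)
  next
    case (add f g)
    then show ?case by (simp add: distrib_left trig_poly.add)
  qed
next
  case (add f1 f2)
  then show ?case by (simp add: distrib_right trig_poly.add)
qed

lemma trig_poly_cmul: "trig_poly f \<Longrightarrow> trig_poly (\<lambda>x. c * f x)"
  using trig_poly_mult[OF trig_poly.basis[of c 0]] by simp

lemma trig_poly_cont: "trig_poly f \<Longrightarrow> continuous_on S f"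
  by (induction rule: trig_poly.induct) (intro continuous_intros; assumption)+

lemma trig_poly_const: "trig_poly (\<lambda>x. c)"
  using trig_poly.basis[of c 0] by simp

text \<open>A real-linear functional of \<open>cis x\<close> is a combination of cos and sin, hence
  of the modes 1 and -1; sums and products of trigonometric polynomials are again such.\<close>

lemma real_polynomial_circle_trig_poly:
  "real_polynomial_function p \<Longrightarrow> trig_poly (\<lambda>x. complex_of_real (p (cis x)))"
proof (induction rule: real_polynomial_function.induct)
  case (linear f)
  interpret bounded_linear f by fact
  have "complex_of_real (f (cis x)) =
      (of_real (f 1) / 2 + of_real (f \<i>) / (2 * \<i>)) * ebas 1 x + (of_real (f 1) / 2 - of_real (f \<i>) / (2 * \<i>)) * ebas (- 1) x" for x
  proof -
    have "cis x = cos x *\<^sub>R 1 + sin x *\<^sub>R \<i>" by (simp add: complex_eq_iff)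
    then have "f (cis x) = cos x * f 1 + sin x * f \<i>"
      by (simp only: add scaleR) (simp add: real_scaleR_def)
    moreover have "ebas 1 x = cis x" "ebas (- 1) x = cnj (cis x)"
      by (simp_all add: ebas_def cis_conv_exp exp_cnj)
    ultimately show ?thesis by (simp add: complex_eq_iff field_simps)
  qed
  then have "(\<lambda>x. complex_of_real (f (cis x))) = (\<lambda>x.
      (of_real (f 1) / 2 + of_real (f \<i>) / (2 * \<i>)) * ebas 1 x + (of_real (f 1) / 2 - of_real (f \<i>) / (2 * \<i>)) * ebas (- 1) x)"
    by blast
  then show ?case by (simp only:) (intro trig_poly.intros)
next
  case (const c)
  show ?case by (rule trig_poly_const)
qed (simp_all add: trig_poly.add trig_poly_mult)

text \<open>Stone-Weierstrass is applied on the unit circle, where polynomials in the real and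
  imaginary parts restrict to trigonometric polynomials.\<close>

lemma trig_poly_dense:
  fixes h :: "real \<Rightarrow> complex"
  assumes cont: "continuous_on UNIV h" and per: "\<And>x. h (x + 2 * pi) = h x" and "e > 0"
  obtains p where "trig_poly p" "\<And>x. x \<in> {0..2 * pi} \<Longrightarrow> cmod (h x - p x) < e"
proof -
  define H where "H z = h (Arg2pi z)" for z
  have Hcis: "H (cis x) = h x" if "x \<in> {0..2 * pi}" for x
  proof (cases "x = 2 * pi")
    case True
    then show ?thesis using per[of 0] by (simp add: H_def cis_2pi Arg2pi_of_real[of 1, simplified])
  next
    case False
    then show ?thesis using that Arg2pi_unique[of 1 x "cis x"] by (auto simp: H_def cis_conv_exp)
  qed
  have sph: "cis ` {0..2 * pi} = sphere 0 1"
  proof (intro equalityI subsetI)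
    fix z :: complex assume "z \<in> sphere 0 1"
    then have "z = cis (Arg2pi z)" "Arg2pi z \<in> {0..2 * pi}"
      using Arg2pi[of z] by (auto simp: cis_conv_exp is_Arg_def intro: less_imp_le)
    then show "z \<in> cis ` {0..2 * pi}" by blast
  qed auto
  have bdd: "compact (h ` {0..2 * pi})"
    by (intro compact_continuous_image continuous_on_subset[OF cont]) auto
  \<comment> \<open>\<open>Arg2pi\<close> jumps at 1, so continuity is read off the graph, which is
    the image of a compact interval under x -> (cis x, h x). Periodicity of \<open>h\<close> enters
    through \<open>Hcis\<close> at the right endpoint.\<close>
  have "continuous_on (sphere 0 1) H"
  proof (rule continuous_from_closed_graph[OF bdd])
    show "H \<in> sphere 0 1 \<rightarrow> h ` {0..2 * pi}"
      unfolding sph[symmetric] using Hcis by auto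
    have "(\<lambda>z. (z, H z)) ` sphere 0 1 = (\<lambda>x. (cis x, h x)) ` {0..2 * pi}"
      unfolding sph[symmetric] image_image using Hcis by (intro image_cong) auto
    moreover have "compact ((\<lambda>x. (cis x, h x)) ` {0..2 * pi})"
      by (intro compact_continuous_image continuous_intros continuous_on_subset[OF cont]) auto
    ultimately show "closed ((\<lambda>z. (z, H z)) ` sphere 0 1)"
      by (simp add: compact_imp_closed)
  qed
  from Stone_Weierstrass_polynomial_function[OF compact_sphere this \<open>e > 0\<close>]
  obtain g where g: "polynomial_function g" "\<And>z. z \<in> sphere 0 1 \<Longrightarrow> cmod (H z - g z) < e"
    by blast
  have "trig_poly (\<lambda>x. complex_of_real ((Re \<circ> g) (cis x)) + \<i> * complex_of_real ((Im \<circ> g) (cis x)))"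
    using g(1) unfolding polynomial_function_def
    by (intro trig_poly.add trig_poly_cmul real_polynomial_circle_trig_poly)
       (use bounded_linear_Re bounded_linear_Im in blast)+
  moreover have "(\<lambda>x. complex_of_real ((Re \<circ> g) (cis x)) + \<i> * complex_of_real ((Im \<circ> g) (cis x))) = (\<lambda>x. g (cis x))"
    by (auto simp: complex_eq_iff)
  ultimately have "trig_poly (\<lambda>x. g (cis x))" by simp
  moreover have "cmod (h x - g (cis x)) < e" if "x \<in> {0..2 * pi}" for x
    using g(2)[of "cis x"] Hcis[OF that] by simp
  ultimately show ?thesis using that by blast
qed

text \<open>\<open>h\<close> is orthogonal to every trigonometric polynomial; subtracting one that
  is uniformly close to \<open>cnj h\<close> makes the integral of |h|^2 arbitrarily small.\<close>

lemma fourier_complete: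
  fixes h :: "real \<Rightarrow> complex"
  assumes cont: "continuous_on UNIV h" and per: "\<And>x. h (x + 2 * pi) = h x" and z: "\<And>k. fc h k = 0"
  shows "h x = 0"
proof -
  have c: "continuous_on S h" for S using cont by (rule continuous_on_subset) auto
  have tp0: "integral {0..2 * pi} (\<lambda>x. h x * p x) = 0" if "trig_poly p" for p
    using that
  proof (induction rule: trig_poly.induct)
    case (basis d k)
    have "integral {0..2 * pi} (\<lambda>x. h x * ebas k x) = 0" using z[of "- k"] by (simp add: fc_def)
    then have "integral {0..2 * pi} (\<lambda>x. d * (h x * ebas k x)) = 0" by simp
    then show ?case by (simp add: mult_ac)
  next
    case (add f g)
    then show ?case
      by (simp only: distrib_left) (subst integral_add;
        (intro integrable_continuous_interval continuous_intros c trig_poly_cont)?; simp)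
  qed
  obtain B where B: "B > 0" "\<And>x. x \<in> {0..2 * pi} \<Longrightarrow> cmod (h x) \<le> B"
    using compact_imp_bounded[OF compact_continuous_image[OF c compact_Icc]] bounded_pos
    by (metis image_eqI)
  define I where "I = integral {0..2 * pi} (\<lambda>x. (cmod (h x))\<^sup>2)"
  have Ic: "integral {0..2 * pi} (\<lambda>x. h x * cnj (h x)) = of_real I"
  proof -
    have "((\<lambda>x. (cmod (h x))\<^sup>2) has_integral I) {0..2 * pi}"
      unfolding I_def by (intro integrable_integral integrable_continuous_interval continuous_intros c)
    from has_integral_linear[OF this bounded_linear_of_real[where 'a = complex]]
    show ?thesis by (simp add: o_def complex_norm_square integral_unique del: of_real_power)
  qed
  have "I \<le> e" if "e > 0" for e
  proof -
    \<comment> \<open>Chosen so that the bound B * d on the integrand, times the length of the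
      period, equals \<open>e\<close>.\<close>
    define d where "d = e / (2 * pi * B)"
    have d: "d > 0" using B that by (simp add: d_def)
    obtain p where p: "trig_poly p" "\<And>x. x \<in> {0..2 * pi} \<Longrightarrow> cmod (cnj (h x) - p x) < d"
      by (rule trig_poly_dense[of "\<lambda>x. cnj (h x)" d]) (auto intro!: continuous_intros c simp: per d)
    have "of_real I = integral {0..2 * pi} (\<lambda>x. h x * cnj (h x)) - integral {0..2 * pi} (\<lambda>x. h x * p x)"
      using Ic tp0[OF p(1)] by simp
    also have "\<dots> = integral {0..2 * pi} (\<lambda>x. h x * (cnj (h x) - p x))"
      unfolding right_diff_distrib
      by (intro integral_diff[symmetric] integrable_continuous_interval continuous_intros c trig_poly_cont p)
    finally have "cmod (of_real I) = cmod (integral {0..2 * pi} (\<lambda>x. h x * (cnj (h x) - p x)))" by simp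
    also have "\<dots> \<le> (B * d) * (2 * pi - 0)"
      using B p(2) by (intro integral_bound continuous_intros c trig_poly_cont p)
 (auto simp: norm_mult intro!: mult_mono intro: less_imp_le)
    also have "\<dots> = e" using B by (simp add: d_def)
    finally show ?thesis by simp
  qed
  then have "I \<le> 0" using field_le_epsilon[of I 0] by simp
  moreover have "I \<ge> 0" unfolding I_def by (intro integral_nonneg integrable_continuous_interval continuous_intros c) auto
  ultimately have "((\<lambda>x. (cmod (h x))\<^sup>2) has_integral 0) (cbox 0 (2 * pi))"
    unfolding I_def cbox_interval has_integral_integrable_integral
    by (auto intro!: integrable_continuous_interval continuous_intros c)
  then have h0: "h y = 0" if "y \<in> {0..2 * pi}" for y
  proof -
    have "continuous_on (cbox 0 (2 * pi)) (\<lambda>x. (cmod (h x))\<^sup>2)"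
      by (intro continuous_intros c)
    from has_integral_0_cbox_imp_0[OF this _ \<open>(_ has_integral 0) _\<close>, of y] that show ?thesis
      using pi_gt_zero by (simp add: box_eq_empty not_le)
  qed
  define m where "m = \<lfloor>x / (2 * pi)\<rfloor>"
  have sh: "h (y + of_nat n * (2 * pi)) = h y" for y n
  proof (induction n)
    case (Suc n)
    then show ?case using per[of "y + of_nat n * (2 * pi)"] by (simp add: algebra_simps)
  qed simp
  have shi: "h (y + of_int n * (2 * pi)) = h y" for y n
  proof (cases "n \<ge> 0")
    case True
    then show ?thesis using sh[of y "nat n"] by simp
  next
    case False
    then show ?thesis using sh[of "y + of_int n * (2 * pi)" "nat (- n)"] by simp
  qed
  have "x - of_int m * (2 * pi) \<in> {0..2 * pi}"
    using floor_correct[of "x / (2 * pi)"] unfolding m_def[symmetric]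
    by (auto simp: field_simps)
  then show ?thesis using h0 shi[of "x - of_int m * (2 * pi)" m] by auto
qed

text \<open>The square of the Japanese bracket. The H^r norm weights squared coefficients by br^r,
  hence the exponent r / 2 wherever coefficients themselves are weighted.\<close>

definition br :: "int \<Rightarrow> real" where "br k = 1 + (real_of_int k)\<^sup>2"

lemma br_ge_1: "br k \<ge> 1" and br_pos [simp]: "br k > 0" and br_nonneg [simp]: "br k \<ge> 0" and br_neq_0 [simp]: "br k \<noteq> 0"
  using zero_le_power2[of "real_of_int k"] by (auto simp: br_def intro: add_pos_nonneg simp: add_nonneg_eq_0_iff)

lemma br_minus [simp]: "br (- k) = br k"
  by (simp add: br_def)

lemma summable_on_int_even:
  fixes f :: "int \<Rightarrow> real"
  assumes nn: "\<And>k. f k \<ge> 0" and even: "\<And>k. f (- k) = f k" and s: "summable (\<lambda>n. f (int n))"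
  shows "f summable_on UNIV"
proof -
  have 1: "(\<lambda>n. f (int n)) summable_on UNIV"
    using s nn by (simp add: summable_on_UNIV_nonneg_real_iff)
  then have 2: "f summable_on range int"
    by (subst summable_on_reindex) (auto simp: o_def inj_on_def)
  have 3: "f summable_on range (\<lambda>n. - int n)"
    by (subst summable_on_reindex) (use 1 in \<open>auto simp: o_def inj_on_def even\<close>)
  have "range int \<union> range (\<lambda>n. - int n) = UNIV"
    by (auto simp: image_iff) (metis int_cases2)
  with summable_on_union[OF 2 3] show ?thesis by simp
qed

text \<open>Comparison with the powers n^(-2r); this is the source of the threshold 1/2 for
  continuity and for products in H^r.\<close>

lemma summable_br:
  assumes "r > 1 / 2"
  shows "(\<lambda>k. br k powr (- r)) summable_on UNIV"
proof (rule summable_on_int_even)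
  have "summable (\<lambda>n. of_nat n powr (- 2 * r) :: real)"
    using assms by (subst summable_real_powr_iff) auto
  then show "summable (\<lambda>n. br (int n) powr (- r))"
  proof (rule summable_comparison_test_ev[rotated])
    have "br (int n) powr (- r) \<le> real n powr (- 2 * r)" if "n \<ge> 1" for n
    proof -
      have "br (int n) powr (- r) \<le> ((real n)\<^sup>2) powr (- r)"
        using that assms by (intro powr_mono2') (auto simp: br_def)
      also have "(real n)\<^sup>2 = real n powr 2" using that by simp
      also have "\<dots> powr (- r) = real n powr (- 2 * r)" by (subst powr_powr) simp
      finally show ?thesis .
    qed
    then show "\<forall>\<^sub>F n in sequentially. norm (br (int n) powr (- r)) \<le> real n powr (- 2 * r)"
      by (auto simp: eventually_sequentially)
  qed
qed auto

lemma infsum_tail_tendsto_0: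
  fixes a :: "int \<Rightarrow> real"
  assumes "a summable_on UNIV"
  shows "((\<lambda>F. infsum a UNIV - sum a F) \<longlongrightarrow> 0) finite_sets_at_top"
  using tendsto_diff[OF tendsto_const[of "infsum a UNIV"] infsum_tendsto[OF assms]] by simp

subsection \<open>Absolutely convergent trigonometric series\<close>

definition ftrig :: "(int \<Rightarrow> complex) \<Rightarrow> real \<Rightarrow> complex" where
  "ftrig c x = (\<Sum>\<^sub>\<infinity>k. c k * ebas k x)"

lemma ftrig_summable:
  assumes "(\<lambda>k. cmod (c k)) summable_on UNIV"
  shows "(\<lambda>k. c k * ebas k x) summable_on A"
proof -
  have "(\<lambda>k. cmod (c k * ebas k x)) summable_on UNIV" using assms by (simp add: norm_mult)
  from abs_summable_summable[OF this] show ?thesis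
    by (rule summable_on_subset) auto
qed

text \<open>The bound is independent of \<open>x\<close> and tends to 0 along finite sets, so it
  yields uniform convergence of the series and allows integration term by term.\<close>

lemma ftrig_tail:
  assumes s: "(\<lambda>k. cmod (c k)) summable_on UNIV" and F: "finite F"
  shows "cmod (ftrig c x - (\<Sum>k\<in>F. c k * ebas k x)) \<le> (\<Sum>\<^sub>\<infinity>k. cmod (c k)) - (\<Sum>k\<in>F. cmod (c k))"
proof -
  have "ftrig c x = (\<Sum>\<^sub>\<infinity>k\<in>F \<union> - F. c k * ebas k x)" by (simp add: ftrig_def)
  also have "\<dots> = (\<Sum>k\<in>F. c k * ebas k x) + (\<Sum>\<^sub>\<infinity>k\<in>-F. c k * ebas k x)"
    by (subst infsum_Un_disjoint) (auto intro: ftrig_summable[OF s] simp: F)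
  finally have "cmod (ftrig c x - (\<Sum>k\<in>F. c k * ebas k x)) = cmod (\<Sum>\<^sub>\<infinity>k\<in>-F. c k * ebas k x)" by simp
  also have "\<dots> \<le> (\<Sum>\<^sub>\<infinity>k\<in>-F. cmod (c k * ebas k x))"
    by (rule norm_infsum_bound) (use summable_on_subset[OF s] in \<open>auto simp: norm_mult\<close>)
  also have "\<dots> = (\<Sum>\<^sub>\<infinity>k\<in>-F. cmod (c k))" by (simp add: norm_mult)
  also have "\<dots> = (\<Sum>\<^sub>\<infinity>k\<in>F \<union> -F. cmod (c k)) - (\<Sum>k\<in>F. cmod (c k))"
    by (subst infsum_Un_disjoint) (use summable_on_subset[OF s] F in auto)
  finally show ?thesis by simp
qed

lemma ftrig_cont:
  assumes s: "(\<lambda>k. cmod (c k)) summable_on UNIV"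
  shows "continuous_on S (ftrig c)"
proof -
  have "uniform_limit S (\<lambda>F x. \<Sum>k\<in>F. c k * ebas k x) (ftrig c) finite_sets_at_top"
    unfolding uniform_limit_iff
  proof (intro allI impI)
    fix e :: real assume "e > 0"
    have fin: "\<forall>\<^sub>F F in finite_subsets_at_top (UNIV :: int set). finite F"
      by (intro eventually_finite_subsets_at_top_weakI)
    from order_tendstoD(2)[OF infsum_tail_tendsto_0[OF s] \<open>e > 0\<close>] fin
    show "\<forall>\<^sub>F F in finite_sets_at_top. \<forall>x\<in>S. dist (\<Sum>k\<in>F. c k * ebas k x) (ftrig c x) < e"
    proof eventually_elim
      case (elim F)
      then show ?case using ftrig_tail[OF s, of F]
        by (auto simp: dist_norm norm_minus_commute intro: le_less_trans)
    qed
  qed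
  then show ?thesis
    by (rule uniform_limit_theorem[rotated]) (auto intro!: always_eventually continuous_intros)
qed

lemma ftrig_periodic: "ftrig c (x + 2 * pi) = ftrig c x"
  by (simp add: ftrig_def ebas_periodic)

text \<open>For every finite \<open>F\<close> containing \<open>k\<close> the truncated sum already
  has coefficient \<open>c k\<close>, so the error is at most the tail of the coefficients outside
  \<open>F\<close>.\<close>

lemma fc_ftrig:
  assumes s: "(\<lambda>k. cmod (c k)) summable_on UNIV"
  shows "fc (ftrig c) k = c k"
proof -
  have "cmod (fc (ftrig c) k - c k) \<le> 0"
  proof (rule tendsto_lowerbound[OF infsum_tail_tendsto_0[OF s]])
    have "cmod (fc (ftrig c) k - c k) \<le> (\<Sum>\<^sub>\<infinity>k. cmod (c k)) - (\<Sum>k\<in>F. cmod (c k))"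
      if F: "finite F" "k \<in> F" for F
    proof -
      have "fc (ftrig c) k - c k = fc (\<lambda>x. ftrig c x - (\<Sum>k\<in>F. c k * ebas k x)) k"
        using F by (subst fc_diff) (auto simp: fc_sum_ebas intro!: ftrig_cont[OF s] continuous_intros)
      also have "cmod \<dots> \<le> (\<Sum>\<^sub>\<infinity>k. cmod (c k)) - (\<Sum>k\<in>F. cmod (c k))"
        by (intro fc_bound ftrig_tail[OF s] continuous_intros ftrig_cont[OF s] F)
      finally show ?thesis .
    qed
    then show "\<forall>\<^sub>F F in finite_sets_at_top. cmod (fc (ftrig c) k - c k) \<le> (\<Sum>\<^sub>\<infinity>k. cmod (c k)) - (\<Sum>k\<in>F. cmod (c k))"
      by (auto simp: eventually_finite_subsets_at_top intro!: exI[of _ "{k}"])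
  qed auto
  then show ?thesis by simp
qed

text \<open>The difference is continuous and periodic with vanishing coefficients. This identifies
  test functions and continuous representatives with their Fourier series.\<close>

lemma ftrig_unique:
  assumes s: "(\<lambda>k. cmod (c k)) summable_on UNIV"
    and cont: "continuous_on UNIV h" and per: "\<And>x. h (x + 2 * pi) = h x" and fc: "\<And>k. fc h k = c k"
  shows "h = ftrig c"
proof
  fix x
  have "continuous_on {0..2 * pi} h" by (rule continuous_on_subset[OF cont]) auto
  then have "h x - ftrig c x = 0"
    by (intro fourier_complete[of "\<lambda>x. h x - ftrig c x"])
       (auto intro!: continuous_intros cont ftrig_cont[OF s] simp: per ftrig_periodic fc_diff fc_ftrig[OF s] ftrig_cont[OF s] fc)
  then show "h x = ftrig c x" by simp
qed

subsection \<open>Test functions\<close>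

lemma test_functions_cont: "f \<in> test_functions \<Longrightarrow> continuous_on S f"
  using Dx_pow_cont[of f S 0] by simp

lemma test_functions_periodic: "f \<in> test_functions \<Longrightarrow> f (x + 2 * pi) = f x"
  by (simp add: test_functions_def)

lemma test_functions_Dx_pow: "f \<in> test_functions \<Longrightarrow> (Dx ^^ n) f \<in> test_functions"
  by (induction n) (auto intro: test_functions_Dx)

text \<open>Integration by parts over one period; the boundary terms cancel by periodicity.\<close>

lemma fc_Dx:
  assumes f: "f \<in> test_functions"
  shows "fc (Dx f) k = \<i> * of_int k * fc f k"
proof -
  have d: "(f has_vector_derivative Dx f x) (at x within S)" for x S
    using Dx_pow_vec[OF f, of 0] by (auto intro: has_vector_derivative_at_within)
  have "((\<lambda>x. f x * ebas (- k) x) has_vector_derivative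
      f x * (\<i> * of_int (- k) * ebas (- k) x) + Dx f x * ebas (- k) x) (at x within S)" for x S
    by (rule has_vector_derivative_mult[OF d ebas_deriv])
  then have "((\<lambda>x. f x * (\<i> * of_int (- k) * ebas (- k) x) + Dx f x * ebas (- k) x) has_integral
      (f (2 * pi) * ebas (- k) (2 * pi) - f 0 * ebas (- k) 0)) {0..2 * pi}"
    by (intro fundamental_theorem_of_calculus) auto
  moreover have "f (2 * pi) * ebas (- k) (2 * pi) = f 0 * ebas (- k) 0"
    using test_functions_periodic[OF f, of 0] ebas_periodic[of "- k" 0] by simp
  moreover have "((\<lambda>x. (- \<i> * of_int k) * (f x * ebas (- k) x)) has_integral (- \<i> * of_int k) * (2 * pi * fc f k)) {0..2 * pi}"
    unfolding fc_def
    by (intro has_integral_mult_right) (auto intro!: integrable_integral fc_integrable test_functions_cont f)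
  ultimately have "((\<lambda>x. (f x * (\<i> * of_int (- k) * ebas (- k) x) + Dx f x * ebas (- k) x) - (- \<i> * of_int k) * (f x * ebas (- k) x))
      has_integral (0 - (- \<i> * of_int k) * (2 * pi * fc f k))) {0..2 * pi}"
    by (intro has_integral_diff) auto
  then have "((\<lambda>x. Dx f x * ebas (- k) x) has_integral (\<i> * of_int k) * (2 * pi * fc f k)) {0..2 * pi}"
    by (simp add: algebra_simps)
  then show ?thesis by (simp add: fc_def integral_unique)
qed

lemma fc_Dx_pow:
  assumes f: "f \<in> test_functions"
  shows "fc ((Dx ^^ n) f) k = (\<i> * of_int k) ^ n * fc f k"
  by (induction n) (auto simp: fc_Dx test_functions_Dx_pow f)

lemma fc_le_test_seminorm:
  assumes f: "f \<in> test_functions" and "n \<le> N"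
  shows "cmod (fc ((Dx ^^ n) f) k) \<le> test_seminorm N f"
proof -
  have "cmod (fc ((Dx ^^ n) f) k) \<le> (SUP x\<in>{0..2 * pi}. cmod ((Dx ^^ n) f x))"
    by (intro fc_bound test_functions_cont test_functions_Dx_pow test_sup_upper f)
  also have "\<dots> \<le> test_seminorm N f"
    unfolding test_seminorm_def using assms by (intro member_le_sum) (auto intro: test_sup_nonneg)
  finally show ?thesis .
qed

text \<open>Up to a factor 2^N, the weight br^N is at most 1 + k^(2N), and k^(2N) times the
  coefficient is, in modulus, the coefficient of the derivative of order 2N.\<close>

lemma fc_test_decay:
  assumes f: "f \<in> test_functions"
  shows "br k ^ N * cmod (fc f k) \<le> 2 ^ (N + 1) * test_seminorm (2 * N) f"
proof -
  define K where "K = (real_of_int k)\<^sup>2"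
  have K: "K \<ge> 0" by (simp add: K_def)
  have "br k ^ N \<le> (2 * max 1 K) ^ N" unfolding br_def K_def[symmetric] using K by (intro power_mono) auto
  also have "\<dots> \<le> 2 ^ N * (1 + K ^ N)"
    unfolding power_mult_distrib using K by (intro mult_left_mono) (auto simp: max_def)
  finally have "br k ^ N * cmod (fc f k) \<le> 2 ^ N * (1 + K ^ N) * cmod (fc f k)"
    by (intro mult_right_mono) auto
  also have "\<dots> = 2 ^ N * (cmod (fc ((Dx ^^ 0) f) k) + cmod (fc ((Dx ^^ (2 * N)) f) k))"
    unfolding fc_Dx_pow[OF f] by (simp add: norm_mult norm_power K_def power_mult distrib_right)
  also have "\<dots> \<le> 2 ^ N * (test_seminorm (2 * N) f + test_seminorm (2 * N) f)"
    by (intro mult_left_mono add_mono fc_le_test_seminorm f) auto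
  finally show ?thesis by simp
qed

lemma fc_test_summable:
  assumes f: "f \<in> test_functions"
  shows "(\<lambda>k. cmod (fc f k)) summable_on UNIV"
proof -
  have "(\<lambda>k. 4 * test_seminorm 2 f * br k powr (- 1)) summable_on UNIV"
    by (intro summable_on_cmult_right summable_br) auto
  then show ?thesis
  proof (rule summable_on_comparison_test)
    show "cmod (fc f k) \<le> 4 * test_seminorm 2 f * br k powr (- 1)" for k
      using fc_test_decay[OF f, of k 1] by (simp add: powr_minus field_simps numeral_2_eq_2)
  qed auto
qed

lemma test_functions_series: "f \<in> test_functions \<Longrightarrow> f = ftrig (fc f)"
  by (rule ftrig_unique) (auto intro: fc_test_summable test_functions_cont simp: test_functions_periodic)

lemma Dx_pow_ebas: "(Dx ^^ n) (ebas k) = (\<lambda>x. (\<i> * of_int k) ^ n * ebas k x)"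
proof (induction n)
  case (Suc n)
  have "((\<lambda>x. (\<i> * of_int k) ^ n * ebas k x) has_vector_derivative (\<i> * of_int k) ^ n * (\<i> * of_int k * ebas k x)) (at x)" for x
    by (intro has_vector_derivative_mult_right ebas_deriv)
  then have "Dx (\<lambda>x. (\<i> * of_int k) ^ n * ebas k x) = (\<lambda>x. (\<i> * of_int k) ^ n * (\<i> * of_int k * ebas k x))"
    by (intro ext vector_derivative_at)
  then show ?case by (simp add: Suc mult_ac)
qed simp

text \<open>The three claims share one induction because linearity of the derivatives and of
  \<open>pairing\<close> is only available on test functions.\<close>

lemma test_functions_sum_ebas:
  assumes "finite F"
  shows "(\<lambda>x. \<Sum>k\<in>F. c k * ebas k x) \<in> test_functions \<and>
    (Dx ^^ n) (\<lambda>x. \<Sum>k\<in>F. c k * ebas k x) = (\<lambda>x. \<Sum>k\<in>F. c k * (\<i> * of_int k) ^ n * ebas k x) \<and>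
    pairing u (\<lambda>x. \<Sum>k\<in>F. c k * ebas k x) = (\<Sum>k\<in>F. c k * pairing u (ebas k))"
  using assms
proof induction
  case empty
  have "(\<lambda>x. 0) \<in> test_functions" using test_functions_lin[OF ebas_test ebas_test, of 0 0 0 0] by simp
  moreover have "(Dx ^^ n) (\<lambda>x. 0) = (\<lambda>x. 0)" using Dx_pow_lin[OF ebas_test ebas_test, of n 0 0 0 0] by simp
  moreover have "pairing u (\<lambda>x. 0) = 0" using distributions_lin[OF pairing ebas_test ebas_test, of u 0 0 0 0] by simp
  ultimately show ?case by simp
next
  case (insert j F)
  define S where "S = (\<lambda>x. \<Sum>k\<in>F. c k * ebas k x)"
  have e: "(\<lambda>x. \<Sum>k\<in>insert j F. c k * ebas k x) = (\<lambda>x. c j * ebas j x + 1 * S x)"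
    using insert by (auto simp: S_def)
  have S: "S \<in> test_functions" using insert by (simp add: S_def)
  show ?case unfolding e
    using test_functions_lin[OF ebas_test[of j] S, where a = "c j" and b = 1]
      Dx_pow_lin[OF ebas_test[of j] S, where a = "c j" and b = 1 and n = n]
      distributions_lin[OF pairing ebas_test[of j] S, where a = "c j" and b = 1] insert
    by (simp add: Dx_pow_ebas S_def[symmetric] mult_ac)
qed

text \<open>A distribution is controlled by finitely many derivatives, and each derivative of
  \<open>f\<close> is the uniform limit of its own truncated Fourier series; so truncation errors
  vanish in the seminorm that controls \<open>u\<close>.\<close>

lemma pairing_series:
  assumes f: "f \<in> test_functions"
  shows "((\<lambda>k. fc f k * pairing u (ebas k)) has_sum pairing u f) UNIV"
proof -
  obtain C N where C: "C \<ge> 0" "\<And>g. g \<in> test_functions \<Longrightarrow> cmod (pairing u g) \<le> C * test_seminorm N g"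
    using distributions_bound[OF pairing] by blast
  define a where "a n k = cmod (fc ((Dx ^^ n) f) k)" for n k
  have sa: "a n summable_on UNIV" for n
    unfolding a_def by (intro fc_test_summable test_functions_Dx_pow f)
  have lim: "((\<lambda>F. C * (\<Sum>n\<le>N. infsum (a n) UNIV - sum (a n) F)) \<longlongrightarrow> C * (\<Sum>n\<le>N. 0)) finite_sets_at_top"
    by (intro tendsto_mult tendsto_const tendsto_sum infsum_tail_tendsto_0 sa)
  have "cmod ((\<Sum>k\<in>F. fc f k * pairing u (ebas k)) - pairing u f) \<le> C * (\<Sum>n\<le>N. infsum (a n) UNIV - sum (a n) F)"
    if F: "finite F" for F
  proof -
    define S where "S = (\<lambda>x. \<Sum>k\<in>F. fc f k * ebas k x)"
    have S: "S \<in> test_functions" "pairing u S = (\<Sum>k\<in>F. fc f k * pairing u (ebas k))"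
      "\<And>n. (Dx ^^ n) S = (\<lambda>x. \<Sum>k\<in>F. fc f k * (\<i> * of_int k) ^ n * ebas k x)"
      using test_functions_sum_ebas[OF F, of "fc f"] by (auto simp: S_def)
    define R where "R = (\<lambda>x. 1 * S x + (-1) * f x)"
    have R: "R \<in> test_functions" unfolding R_def by (intro test_functions_lin S f)
    have "(\<Sum>k\<in>F. fc f k * pairing u (ebas k)) - pairing u f = pairing u R"
      unfolding R_def using S by (subst distributions_lin[OF pairing S(1) f]) simp
    also have "cmod \<dots> \<le> C * test_seminorm N R" by (rule C(2)[OF R])
    also have "\<dots> \<le> C * (\<Sum>n\<le>N. infsum (a n) UNIV - sum (a n) F)"
      unfolding test_seminorm_def
    proof (intro mult_left_mono sum_mono cSUP_least C)
      fix n x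
      have "(Dx ^^ n) R x = (\<Sum>k\<in>F. fc ((Dx ^^ n) f) k * ebas k x) - (Dx ^^ n) f x"
        unfolding R_def Dx_pow_lin[OF S(1) f] S(3) by (simp add: fc_Dx_pow[OF f] mult_ac)
      also have "cmod \<dots> \<le> infsum (a n) UNIV - sum (a n) F"
        using ftrig_tail[OF sa[of n, unfolded a_def] F, of x] test_functions_series[OF test_functions_Dx_pow[OF f, of n]]
        by (simp add: norm_minus_commute a_def[abs_def])
      finally show "cmod ((Dx ^^ n) R x) \<le> infsum (a n) UNIV - sum (a n) F" .
    qed auto
    finally show ?thesis .
  qed
  then have "\<forall>\<^sub>F F in finite_sets_at_top. cmod ((\<Sum>k\<in>F. fc f k * pairing u (ebas k)) - pairing u f)
      \<le> C * (\<Sum>n\<le>N. infsum (a n) UNIV - sum (a n) F)"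
    by (rule eventually_finite_subsets_at_top_weakI)
  moreover have "((\<lambda>F. C * (\<Sum>n\<le>N. infsum (a n) UNIV - sum (a n) F)) \<longlongrightarrow> 0) finite_sets_at_top"
    using lim by simp
  ultimately have "((\<lambda>F. (\<Sum>k\<in>F. fc f k * pairing u (ebas k)) - pairing u f) \<longlongrightarrow> 0) finite_sets_at_top"
    by (rule Lim_null_comparison)
  then show ?thesis
    unfolding has_sum_def by (rule LIM_zero_cancel)
qed

subsection \<open>Fourier coefficients of distributions\<close>

lemma fcoeff_ebas: "fcoeff u k = pairing u (ebas (- k)) / (2 * pi)"
  by (simp add: fcoeff_def ebas_def[abs_def])

text \<open>Turns every later identity between distributions into a computation with Fourier
  coefficients.\<close>

lemma pdist_fcoeff_eqI:
  assumes "\<And>k. fcoeff u k = fcoeff v k"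
  shows "u = v"
proof (rule pdist_eqI)
  fix f assume f: "f \<in> test_functions"
  have "pairing u (ebas k) = pairing v (ebas k)" for k
    using assms[of "- k"] by (simp add: fcoeff_ebas)
  then show "pairing u f = pairing v f"
    using pairing_series[OF f, of u] pairing_series[OF f, of v] has_sum_unique by auto
qed

text \<open>Parseval form of the pairing: the factor 2 pi and the index - k undo the normalisation
  and the reflection in \<open>fcoeff\<close>.\<close>

definition pd_of_coeffs :: "(int \<Rightarrow> complex) \<Rightarrow> pdist" where
  "pd_of_coeffs c = Abs_pdist (\<lambda>f\<in>test_functions. \<Sum>\<^sub>\<infinity>k. 2 * of_real pi * c k * fc f (- k))"

lemma fc_lin:
  assumes "f \<in> test_functions" "g \<in> test_functions"
  shows "fc (\<lambda>x. a * f x + b * g x) k = a * fc f k + b * fc g k"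
proof -
  have "integral {0..2 * pi} (\<lambda>x. (a * f x + b * g x) * ebas (- k) x)
     = integral {0..2 * pi} (\<lambda>x. a * (f x * ebas (- k) x) + b * (g x * ebas (- k) x))"
    by (simp add: algebra_simps)
  also have "\<dots> = a * integral {0..2 * pi} (\<lambda>x. f x * ebas (- k) x) + b * integral {0..2 * pi} (\<lambda>x. g x * ebas (- k) x)"
    by (subst integral_add) (auto intro!: integrable_on_mult_right fc_integrable test_functions_cont assms)
  finally show ?thesis by (simp add: fc_def add_divide_distrib)
qed

text \<open>Coefficients growing like br^N are paired with test coefficients decaying like
  br^(-N-1), which leaves the summable br^(-1).\<close>

lemma pd_of_coeffs_distribution:
  assumes c: "\<And>k. cmod (c k) \<le> C * br k ^ N"
  shows "(\<lambda>f\<in>test_functions. \<Sum>\<^sub>\<infinity>k. 2 * of_real pi * c k * fc f (- k)) \<in> distributions" (is "?U \<in> _")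
proof -
  \<comment> \<open>The power 2 ^ (N + 2) is the constant of \<open>fc_test_decay\<close> at order N
    + 1.\<close>
  define K where "K = 2 * pi * \<bar>C\<bar> * 2 ^ (N + 2)"
  have b: "cmod (2 * of_real pi * c k * fc f (- k)) \<le> K * test_seminorm (2 * (N + 1)) f * br k powr (- 1)"
    if f: "f \<in> test_functions" for f k
  proof -
    have "br k * (br k ^ N * cmod (fc f (- k))) \<le> 2 ^ (N + 2) * test_seminorm (2 * (N + 1)) f"
      using fc_test_decay[OF f, of "- k" "N + 1"] by (simp add: mult_ac)
    then have 1: "br k ^ N * cmod (fc f (- k)) \<le> 2 ^ (N + 2) * test_seminorm (2 * (N + 1)) f * br k powr (- 1)"
      by (simp add: powr_minus field_simps)
    have "cmod (c k) \<le> \<bar>C\<bar> * br k ^ N"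
      using c[of k] by (rule order_trans) (intro mult_right_mono; simp)
    then have "cmod (2 * of_real pi * c k * fc f (- k)) \<le> 2 * pi * (\<bar>C\<bar> * br k ^ N) * cmod (fc f (- k))"
      by (simp add: norm_mult mult_right_mono)
    also have "\<dots> = 2 * pi * \<bar>C\<bar> * (br k ^ N * cmod (fc f (- k)))" by simp
    also have "\<dots> \<le> 2 * pi * \<bar>C\<bar> * (2 ^ (N + 2) * test_seminorm (2 * (N + 1)) f * br k powr (- 1))"
      by (intro mult_left_mono 1) auto
    finally show ?thesis by (simp add: K_def mult_ac)
  qed
  have s: "(\<lambda>k. K * test_seminorm (2 * (N + 1)) f * br k powr (- 1)) summable_on UNIV" for f
    by (intro summable_on_cmult_right summable_br) auto
  have as: "(\<lambda>k. cmod (2 * of_real pi * c k * fc f (- k))) summable_on UNIV" if f: "f \<in> test_functions" for f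
    by (rule summable_on_comparison_test[OF s b]) (use f in auto)
  show ?thesis
  proof (rule distributionsI)
    fix f assume f: "f \<in> test_functions"
    have "cmod (\<Sum>\<^sub>\<infinity>k. 2 * of_real pi * c k * fc f (- k)) \<le> (\<Sum>\<^sub>\<infinity>k. cmod (2 * of_real pi * c k * fc f (- k)))"
      by (rule norm_infsum_bound[OF as[OF f]])
    also have "\<dots> \<le> (\<Sum>\<^sub>\<infinity>k. K * test_seminorm (2 * (N + 1)) f * br k powr (- 1))"
      by (intro infsum_mono as f s b)
    also have "\<dots> = (K * (\<Sum>\<^sub>\<infinity>k. br k powr (- 1))) * test_seminorm (2 * (N + 1)) f"
      by (subst infsum_cmult_right', simp only: mult_ac)
    finally show "cmod (?U f)
        \<le> (K * (\<Sum>\<^sub>\<infinity>k. br k powr (- 1))) * test_seminorm (2 * (N + 1)) f"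
      using f by simp
  next
    fix f g a b assume f: "f \<in> test_functions" "g \<in> test_functions"
    have "(\<Sum>\<^sub>\<infinity>k. 2 * of_real pi * c k * fc (\<lambda>x. a * f x + b * g x) (- k))
        = (\<Sum>\<^sub>\<infinity>k. a * (2 * of_real pi * c k * fc f (- k)) + b * (2 * of_real pi * c k * fc g (- k)))"
      by (simp add: fc_lin f algebra_simps)
    also have "\<dots> = a * (\<Sum>\<^sub>\<infinity>k. 2 * of_real pi * c k * fc f (- k)) + b * (\<Sum>\<^sub>\<infinity>k. 2 * of_real pi * c k * fc g (- k))"
      using abs_summable_summable[OF as] f
      by (subst infsum_add) (auto intro!: summable_on_cmult_right simp: infsum_cmult_right)
    finally show "?U (\<lambda>x. a * f x + b * g x) =
         a * ?U f +
         b * ?U g"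
      using f by (simp add: test_functions_lin)
  qed auto
qed

lemma fc_ebas: "fc (ebas j) k = (if j = k then 1 else 0)"
  using fc_sum_ebas[of "{j}" "\<lambda>_. 1" k] by auto

lemma fcoeff_pd_of_coeffs:
  assumes c: "\<And>k. cmod (c k) \<le> C * br k ^ N"
  shows "fcoeff (pd_of_coeffs c) k = c k"
proof -
  have "pairing (pd_of_coeffs c) (ebas (- k)) = (\<Sum>\<^sub>\<infinity>j. 2 * of_real pi * c j * fc (ebas (- k)) (- j))"
    by (simp add: pd_of_coeffs_def Abs_pdist_inverse[OF pd_of_coeffs_distribution[OF c]] ebas_test)
  also have "\<dots> = (\<Sum>\<^sub>\<infinity>j\<in>{k}. 2 * of_real pi * c j)"
    by (rule infsum_cong_neutral) (auto simp: fc_ebas)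
  finally show ?thesis by (simp add: fcoeff_ebas)
qed

lemma fcoeff_comb: "fcoeff (pd_comb a u b v) k = a * fcoeff u k + b * fcoeff v k"
  by (simp add: fcoeff_ebas pairing_comb ebas_test add_divide_distrib)

lemma fcoeff_simps [simp]:
  "fcoeff (u + v) k = fcoeff u k + fcoeff v k"
  "fcoeff (u - v) k = fcoeff u k - fcoeff v k"
  "fcoeff (- u) k = - fcoeff u k"
  "fcoeff (c *\<^sub>C u) k = c * fcoeff u k"
  "fcoeff (r *\<^sub>R u) k = of_real r * fcoeff u k"
  "fcoeff 0 k = 0"
  by (simp_all add: plus_pdist_def minus_pdist_def uminus_pdist_def scaleR_pdist_def pd_scale_def fcoeff_comb)
     (simp add: fcoeff_ebas pairing_zero ebas_test)

lemma fcoeff_deriv [simp]: "fcoeff (\<partial>\<^sub>x u) k = \<i> * of_int k * fcoeff u k"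
proof -
  have "Dx (ebas (- k)) = (\<lambda>x. (- \<i> * of_int k) * ebas (- k) x + 0 * ebas (- k) x)"
    using Dx_pow_ebas[of 1 "- k"] by simp
  then have "pairing u (Dx (ebas (- k))) = (- \<i> * of_int k) * pairing u (ebas (- k))"
    by (simp only: distributions_lin[OF pairing ebas_test ebas_test]) simp
  then show ?thesis by (simp add: fcoeff_ebas pairing_deriv ebas_test)
qed

lemma fcoeff_cnj [simp]: "fcoeff (pd_cnj u) k = cnj (fcoeff u (- k))"
  by (simp add: fcoeff_ebas pairing_cnj ebas_test cnj_ebas)

lemma fcoeff_of_fun:
  assumes "continuous_on {0..2 * pi} h"
  shows "fcoeff (pd_of_fun h) k = fc h k"
  by (simp add: fcoeff_ebas pairing_of_fun[OF assms] ebas_test fc_def)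

text \<open>Resolves the definite description in \<open>pd_fun\<close>: the Fourier series is a
  continuous representative, and completeness of the exponentials excludes any other.\<close>

lemma pd_fun_eq_ftrig:
  assumes s: "(\<lambda>k. cmod (fcoeff u k)) summable_on UNIV"
  shows "pd_fun u = ftrig (fcoeff u)"
  unfolding pd_fun_def
proof (rule the_equality)
  show "continuous_on UNIV (ftrig (fcoeff u)) \<and> (\<forall>x. ftrig (fcoeff u) (x + 2 * pi) = ftrig (fcoeff u) x) \<and>
      u = pd_of_fun (ftrig (fcoeff u))"
    by (auto intro!: ftrig_cont s pdist_fcoeff_eqI simp: ftrig_periodic fcoeff_of_fun[OF ftrig_cont[OF s]] fc_ftrig[OF s])
next
  fix h assume h: "continuous_on UNIV h \<and> (\<forall>x. h (x + 2 * pi) = h x) \<and> u = pd_of_fun h"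
  then have "continuous_on {0..2 * pi} h" using continuous_on_subset by blast
  then show "h = ftrig (fcoeff u)"
    using h by (intro ftrig_unique s) (auto simp: fcoeff_of_fun)
qed

subsection \<open>Products are convolutions\<close>

definition conv :: "(int \<Rightarrow> complex) \<Rightarrow> (int \<Rightarrow> complex) \<Rightarrow> int \<Rightarrow> complex" where
  "conv a b k = (\<Sum>\<^sub>\<infinity>j. a j * b (k - j))"

text \<open>The change of variables that turns a double sum over (i, j) into a sum over the total
  frequency k = i + j and the first index.\<close>

lemma bij_conv: "bij_betw (\<lambda>(k, j). (j, k - j)) (UNIV :: (int \<times> int) set) UNIV"
  by (rule bij_betwI[of _ _ _ "\<lambda>(i, j). (i + j, i)"]) auto

text \<open>Fubini for the absolutely convergent double series, after
  \<open>bij_conv\<close>.\<close>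

lemma conv_ftrig:
  assumes a: "(\<lambda>k. cmod (a k)) summable_on UNIV" and b: "(\<lambda>k. cmod (b k)) summable_on UNIV"
  shows "(\<lambda>k. cmod (conv a b k)) summable_on UNIV" "ftrig (conv a b) x = ftrig a x * ftrig b x"
proof -
  have s1: "(\<lambda>(i, j). cmod (a i) * cmod (b j)) summable_on UNIV \<times> UNIV"
    by (rule summable_on_SigmaI[where g = "\<lambda>i. cmod (a i) * (\<Sum>\<^sub>\<infinity>j. cmod (b j))"])
       (auto intro!: has_sum_cmult_right has_sum_infsum b summable_on_cmult_left a)
  then have s2: "(\<lambda>(k, j). cmod (a j) * cmod (b (k - j))) summable_on UNIV \<times> UNIV"
    using summable_on_reindex_bij_betw[OF bij_conv, of "\<lambda>(i, j). cmod (a i) * cmod (b j)"] by (simp add: case_prod_unfold)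
  have "(\<lambda>k. \<Sum>\<^sub>\<infinity>j. cmod (a j) * cmod (b (k - j))) summable_on UNIV"
    using summable_on_Sigma_banach[OF s2] by simp
  then show "(\<lambda>k. cmod (conv a b k)) summable_on UNIV"
  proof (rule summable_on_comparison_test)
    fix k
    have "(\<lambda>j. cmod (a j * b (k - j))) summable_on UNIV"
      using summable_on_SigmaD1[OF s2, of k] by (simp add: norm_mult)
    from norm_infsum_bound[OF this] show "cmod (conv a b k) \<le> (\<Sum>\<^sub>\<infinity>j. cmod (a j) * cmod (b (k - j)))"
      by (simp add: conv_def norm_mult)
  qed auto
  define A where "A i = a i * ebas i x" for i
  define B where "B i = b i * ebas i x" for i
  have "(\<lambda>p. cmod (case p of (i, j) \<Rightarrow> A i * B j)) summable_on UNIV \<times> UNIV"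
    using s1 by (simp add: A_def B_def norm_mult case_prod_unfold)
  from abs_summable_summable[OF this] have t1: "(\<lambda>(i, j). A i * B j) summable_on UNIV \<times> UNIV" .
  then have t2: "(\<lambda>(k, j). A j * B (k - j)) summable_on UNIV \<times> UNIV"
    using summable_on_reindex_bij_betw[OF bij_conv, of "\<lambda>(i, j). A i * B j"] by (simp add: case_prod_unfold)
  have "ftrig (conv a b) x = (\<Sum>\<^sub>\<infinity>k. \<Sum>\<^sub>\<infinity>j. A j * B (k - j))"
    unfolding ftrig_def conv_def
  proof (rule infsum_cong)
    fix k
    have "A j * B (k - j) = a j * b (k - j) * ebas k x" for j
      using ebas_add[of j "k - j" x] by (simp add: A_def B_def)
    then show "(\<Sum>\<^sub>\<infinity>j. a j * b (k - j)) * ebas k x = (\<Sum>\<^sub>\<infinity>j. A j * B (k - j))"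
      by (simp add: infsum_cmult_left')
  qed
  also have "\<dots> = (\<Sum>\<^sub>\<infinity>(k, j)\<in>UNIV \<times> UNIV. A j * B (k - j))" by (rule infsum_Sigma'_banach[OF t2])
  also have "\<dots> = (\<Sum>\<^sub>\<infinity>(i, j)\<in>UNIV \<times> UNIV. A i * B j)"
    using infsum_reindex_bij_betw[OF bij_conv, of "\<lambda>(i, j). A i * B j"] by (simp add: case_prod_unfold)
  also have "\<dots> = (\<Sum>\<^sub>\<infinity>i. \<Sum>\<^sub>\<infinity>j. A i * B j)" by (rule infsum_Sigma'_banach[OF t1, symmetric])
  also have "\<dots> = ftrig a x * ftrig b x"
    by (simp add: infsum_cmult_left' infsum_cmult_right' ftrig_def A_def B_def)
  finally show "ftrig (conv a b) x = ftrig a x * ftrig b x" .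
qed

text \<open>The Wiener algebra of absolutely convergent Fourier series. On it \<open>pd_fun\<close>
  is the sum of the series, so \<open>pd_mult\<close> is a genuine product given by convolution; it
  contains H^r for r > 1/2 by \<open>sobolev_wiener\<close>.\<close>

definition wiener :: "pdist set" where
  "wiener = {u. (\<lambda>k. cmod (fcoeff u k)) summable_on UNIV}"

lemma fcoeff_mult:
  assumes "u \<in> wiener" "v \<in> wiener"
  shows "fcoeff (u \<cdot>\<^sub>d v) k = conv (fcoeff u) (fcoeff v) k"
proof -
  note s = assms[unfolded wiener_def mem_Collect_eq]
  have "(\<lambda>x. pd_fun u x * pd_fun v x) = ftrig (conv (fcoeff u) (fcoeff v))"
    using s by (simp add: pd_fun_eq_ftrig conv_ftrig(2) fun_eq_iff)
  then show ?thesis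
    unfolding pd_mult_def using conv_ftrig(1)[OF s] by (simp add: fcoeff_of_fun ftrig_cont fc_ftrig)
qed

lemma wiener_mult:
  assumes "u \<in> wiener" "v \<in> wiener"
  shows "u \<cdot>\<^sub>d v \<in> wiener"
  using conv_ftrig(1)[of "fcoeff u" "fcoeff v"] assms by (simp add: wiener_def fcoeff_mult[OF assms])

lemma pd_fun_mult:
  assumes "u \<in> wiener" "v \<in> wiener"
  shows "pd_fun (u \<cdot>\<^sub>d v) x = pd_fun u x * pd_fun v x"
proof -
  have "fcoeff (u \<cdot>\<^sub>d v) = conv (fcoeff u) (fcoeff v)" using fcoeff_mult[OF assms] by auto
  then show ?thesis
    using assms wiener_mult[OF assms] by (simp add: wiener_def pd_fun_eq_ftrig conv_ftrig(2))
qed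

lemma wiener_eqI:
  assumes "u \<in> wiener" "v \<in> wiener" "\<And>x. pd_fun u x = pd_fun v x"
  shows "u = v"
proof (rule pdist_fcoeff_eqI)
  fix k
  have "ftrig (fcoeff u) = ftrig (fcoeff v)"
    using assms by (auto simp: wiener_def pd_fun_eq_ftrig)
  then show "fcoeff u k = fcoeff v k"
    using assms(1,2) fc_ftrig[of "fcoeff u" k] fc_ftrig[of "fcoeff v" k] by (simp add: wiener_def)
qed

lemma pd_mult_commute: "u \<cdot>\<^sub>d v = v \<cdot>\<^sub>d u"
  by (simp add: pd_mult_def mult.commute)

lemma pd_mult_assoc:
  assumes "u \<in> wiener" "v \<in> wiener" "w \<in> wiener"
  shows "(u \<cdot>\<^sub>d v) \<cdot>\<^sub>d w = u \<cdot>\<^sub>d (v \<cdot>\<^sub>d w)"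
  by (rule wiener_eqI) (auto simp: pd_fun_mult wiener_mult assms)

lemma wiener_cnj: "u \<in> wiener \<Longrightarrow> pd_cnj u \<in> wiener"
  using summable_on_reindex_bij_betw[OF bij_uminus, of "\<lambda>k. cmod (fcoeff u k)"] by (simp add: wiener_def)

section \<open>Square summable sequences\<close>

text \<open>One Banach space serves as the model of all H^r: the weight depending on r is absorbed
  into the coordinate map \<open>emb\<close>, so maps between different Sobolev spaces become
  operators on the same type.\<close>

typedef l2 = "{a :: int \<Rightarrow> complex. (\<lambda>k. (cmod (a k))\<^sup>2) summable_on UNIV}" morphisms cf Abs_l2
  by (rule exI[of _ "\<lambda>_. 0"]) simp

lemma cf_summable: "(\<lambda>k. (cmod (cf x k))\<^sup>2) summable_on A"
  using cf[of x] by (auto intro: summable_on_subset)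

lemma cf_Abs: "(\<lambda>k. (cmod (a k))\<^sup>2) summable_on UNIV \<Longrightarrow> cf (Abs_l2 a) k = a k"
  by (simp add: Abs_l2_inverse)

lemma l2_eqI: "(\<And>k. cf x k = cf y k) \<Longrightarrow> x = y"
  by (metis cf_inject ext)

lemma cf_mult_summable:
  assumes "bij_betw g UNIV (UNIV :: int set)"
  shows "(\<lambda>k. cmod (cf x k) * cmod (cf y (g k))) summable_on UNIV"
proof -
  have "(\<lambda>k. (cmod (cf x k))\<^sup>2 + (cmod (cf y (g k)))\<^sup>2) summable_on UNIV"
    using cf_summable[of y UNIV] summable_on_reindex_bij_betw[OF assms, of "\<lambda>k. (cmod (cf y k))\<^sup>2"]
    by (intro summable_on_add cf_summable) auto
  then show ?thesis
  proof (rule summable_on_comparison_test)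
    show "cmod (cf x k) * cmod (cf y (g k)) \<le> (cmod (cf x k))\<^sup>2 + (cmod (cf y (g k)))\<^sup>2" for k
      using sum_squares_bound[of "cmod (cf x k)" "cmod (cf y (g k))"]
        mult_nonneg_nonneg[OF norm_ge_zero[of "cf x k"] norm_ge_zero[of "cf y (g k)"]] by linarith
  qed auto
qed

instantiation l2 :: real_vector
begin

definition zero_l2 :: l2 where "0 = Abs_l2 (\<lambda>_. 0)"
definition plus_l2 :: "l2 \<Rightarrow> l2 \<Rightarrow> l2" where "x + y = Abs_l2 (\<lambda>k. cf x k + cf y k)"
definition minus_l2 :: "l2 \<Rightarrow> l2 \<Rightarrow> l2" where "x - y = Abs_l2 (\<lambda>k. cf x k - cf y k)"
definition uminus_l2 :: "l2 \<Rightarrow> l2" where "- x = Abs_l2 (\<lambda>k. - cf x k)"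
definition scaleR_l2 :: "real \<Rightarrow> l2 \<Rightarrow> l2" where "r *\<^sub>R x = Abs_l2 (\<lambda>k. of_real r * cf x k)"

lemma cf_zero [simp]: "cf 0 k = 0"
  by (simp add: zero_l2_def cf_Abs)

lemma cf_lin_summable: "(\<lambda>k. (cmod (of_real a * cf x k + of_real b * cf y k))\<^sup>2) summable_on UNIV"
proof -
  have "(\<lambda>k. 2 * a\<^sup>2 * (cmod (cf x k))\<^sup>2 + 2 * b\<^sup>2 * (cmod (cf y k))\<^sup>2) summable_on UNIV"
    by (intro summable_on_add summable_on_cmult_right cf_summable)
  then show ?thesis
  proof (rule summable_on_comparison_test)
    fix k
    have "cmod (of_real a * cf x k + of_real b * cf y k) \<le> \<bar>a\<bar> * cmod (cf x k) + \<bar>b\<bar> * cmod (cf y k)"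
      using norm_triangle_ineq[of "of_real a * cf x k" "of_real b * cf y k"] by (simp add: norm_mult)
    then have "(cmod (of_real a * cf x k + of_real b * cf y k))\<^sup>2 \<le> (\<bar>a\<bar> * cmod (cf x k) + \<bar>b\<bar> * cmod (cf y k))\<^sup>2"
      by (intro power_mono) auto
    also have "\<dots> \<le> 2 * (\<bar>a\<bar> * cmod (cf x k))\<^sup>2 + 2 * (\<bar>b\<bar> * cmod (cf y k))\<^sup>2"
      using sum_squares_bound[of "\<bar>a\<bar> * cmod (cf x k)" "\<bar>b\<bar> * cmod (cf y k)"]
      unfolding power2_sum by linarith
    finally show "(cmod (of_real a * cf x k + of_real b * cf y k))\<^sup>2
        \<le> 2 * a\<^sup>2 * (cmod (cf x k))\<^sup>2 + 2 * b\<^sup>2 * (cmod (cf y k))\<^sup>2"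
      by (simp add: power_mult_distrib)
  qed auto
qed

lemma cf_plus [simp]: "cf (x + y) k = cf x k + cf y k"
  using cf_lin_summable[of 1 x 1 y] by (simp add: plus_l2_def cf_Abs)
lemma cf_minus [simp]: "cf (x - y) k = cf x k - cf y k"
  using cf_lin_summable[of 1 x "-1" y] by (simp add: minus_l2_def cf_Abs)
lemma cf_uminus [simp]: "cf (- x) k = - cf x k"
  using cf_lin_summable[of "-1" x 0 x] by (simp add: uminus_l2_def cf_Abs)
lemma cf_scaleR [simp]: "cf (r *\<^sub>R x) k = of_real r * cf x k"
  using cf_lin_summable[of r x 0 x] by (simp add: scaleR_l2_def cf_Abs)

instance
  by standard (auto intro!: l2_eqI simp: algebra_simps)

end

text \<open>A real inner product is used because the triangle inequality then comes with the
  class.\<close>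

instantiation l2 :: real_inner
begin

definition inner_l2 :: "l2 \<Rightarrow> l2 \<Rightarrow> real" where "inner (x :: l2) y = (\<Sum>\<^sub>\<infinity>k. Re (cf x k * cnj (cf y k)))"
definition norm_l2 :: "l2 \<Rightarrow> real" where "norm (x :: l2) = sqrt (\<Sum>\<^sub>\<infinity>k. (cmod (cf x k))\<^sup>2)"
definition sgn_l2 :: "l2 \<Rightarrow> l2" where "sgn (x :: l2) = x /\<^sub>R norm x"
definition dist_l2 :: "l2 \<Rightarrow> l2 \<Rightarrow> real" where "dist (x :: l2) y = norm (x - y)"
definition uniformity_l2 :: "(l2 \<times> l2) filter" where
  "uniformity = (INF e\<in>{0<..}. principal {(x :: l2, y). dist x y < e})"
definition open_l2 :: "l2 set \<Rightarrow> bool" where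
  "open (U :: l2 set) \<longleftrightarrow> (\<forall>x\<in>U. \<forall>\<^sub>F (x', y) in uniformity. x' = x \<longrightarrow> y \<in> U)"

lemma inner_l2_summable: "(\<lambda>k. Re (cf x k * cnj (cf y k))) summable_on UNIV"
proof -
  have "(\<lambda>k. norm (Re (cf x k * cnj (cf y k)))) summable_on UNIV"
    by (rule summable_on_comparison_test[OF cf_mult_summable[of id x y]])
       (simp_all only: id_apply bij_id norm_ge_zero, metis abs_Re_le_cmod complex_mod_cnj norm_mult real_norm_def)
  then show ?thesis by (rule abs_summable_summable)
qed

lemma inner_l2_self: "Re (cf x k * cnj (cf x k)) = (cmod (cf x k))\<^sup>2"
  by (simp add: complex_norm_square[symmetric] del: of_real_power)

instance
proof
  fix x y z :: l2 and r :: real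
  show "inner x y = inner y x"
    unfolding inner_l2_def by (intro infsum_cong) simp
  show "inner (x + y) z = inner x z + inner y z"
    unfolding inner_l2_def
    by (subst infsum_add[symmetric, OF inner_l2_summable inner_l2_summable]) (simp add: algebra_simps)
  show "inner (r *\<^sub>R x) y = r * inner x y"
    unfolding inner_l2_def by (subst infsum_cmult_right'[symmetric]) (simp add: algebra_simps)
  show "0 \<le> inner x x"
    unfolding inner_l2_def inner_l2_self by (intro infsum_nonneg) auto
  show "inner x x = 0 \<longleftrightarrow> x = 0"
  proof
    assume "inner x x = 0"
    then have "(cmod (cf x k))\<^sup>2 = 0" for k
      unfolding inner_l2_def inner_l2_self
      by (intro nonneg_infsum_le_0D[of "\<lambda>k. (cmod (cf x k))\<^sup>2" UNIV]) (auto intro: cf_summable)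
    then show "x = 0" by (intro l2_eqI) simp
  qed (simp add: inner_l2_def)
  show "norm x = sqrt (inner x x)"
    unfolding inner_l2_def inner_l2_self norm_l2_def ..
qed (simp_all add: dist_l2_def sgn_l2_def uniformity_l2_def open_l2_def)

end

lemma norm_l2_sq: "(norm (x :: l2))\<^sup>2 = (\<Sum>\<^sub>\<infinity>k. (cmod (cf x k))\<^sup>2)"
  unfolding norm_l2_def by (intro real_sqrt_pow2 infsum_nonneg) auto

lemma sum_cf_le_norm: "finite F \<Longrightarrow> (\<Sum>k\<in>F. (cmod (cf x k))\<^sup>2) \<le> (norm x)\<^sup>2"
  unfolding norm_l2_sq by (intro finite_sum_le_infsum cf_summable) auto

lemma L2_set_cf_le: "finite F \<Longrightarrow> L2_set (\<lambda>k. cmod (cf x k)) F \<le> norm x"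
  unfolding L2_set_def using sum_cf_le_norm[of F x] by (intro real_le_lsqrt) (auto intro: sum_nonneg)

lemma cf_le_norm: "cmod (cf x k) \<le> norm x"
  using L2_set_cf_le[of "{k}" x] by simp

lemma norm_l2_le:
  assumes "B \<ge> 0" "\<And>F. finite F \<Longrightarrow> (\<Sum>k\<in>F. (cmod (cf x k))\<^sup>2) \<le> B\<^sup>2"
  shows "norm x \<le> B"
proof -
  have "(norm x)\<^sup>2 \<le> B\<^sup>2"
    unfolding norm_l2_sq by (intro infsum_le_finite_sums cf_summable assms) auto
  then show ?thesis using assms(1) by (rule power2_le_imp_le)
qed

text \<open>A single bound on the finite partial sums yields both membership and the norm estimate;
  multipliers and convolutions are both constructed this way.\<close>

lemma Abs_l2_bounded:
  assumes "B \<ge> 0" "\<And>F. finite F \<Longrightarrow> (\<Sum>k\<in>F. (cmod (a k))\<^sup>2) \<le> B\<^sup>2"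
  shows "cf (Abs_l2 a) k = a k" "norm (Abs_l2 a) \<le> B"
proof -
  have "(\<lambda>k. (cmod (a k))\<^sup>2) summable_on UNIV"
    by (rule nonneg_bdd_above_summable_on) (auto intro!: bdd_aboveI2[of _ _ "B\<^sup>2"] assms)
  then show *: "cf (Abs_l2 a) k = a k" for k by (rule cf_Abs)
  show "norm (Abs_l2 a) \<le> B" by (intro norm_l2_le assms(1)) (simp add: * assms)
qed

instance l2 :: banach
proof
  fix X :: "nat \<Rightarrow> l2"
  assume X: "Cauchy X"
  have "Cauchy (\<lambda>n. cf (X n) k)" for k
  proof (rule metric_CauchyI)
    fix e :: real assume "e > 0"
    from metric_CauchyD[OF X this] obtain N where "\<And>m n. m \<ge> N \<Longrightarrow> n \<ge> N \<Longrightarrow> dist (X m) (X n) < e" by blast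
    then show "\<exists>N. \<forall>m\<ge>N. \<forall>n\<ge>N. dist (cf (X m) k) (cf (X n) k) < e"
      unfolding dist_norm cf_minus[symmetric] using cf_le_norm by (blast intro: le_less_trans)
  qed
  then have "\<forall>k. \<exists>l. (\<lambda>n. cf (X n) k) \<longlonglongrightarrow> l"
    by (simp add: Cauchy_convergent_iff convergent_def)
  then obtain a where a: "\<And>k. (\<lambda>n. cf (X n) k) \<longlonglongrightarrow> a k"
    by metis
  \<comment> \<open>The Cauchy estimate is applied to finite partial sums, where the limit in the
    second index may be taken termwise.\<close>
  have close: "\<exists>N. \<forall>n\<ge>N. \<forall>F. finite F \<longrightarrow> (\<Sum>k\<in>F. (cmod (cf (X n) k - a k))\<^sup>2) \<le> e\<^sup>2" if "e > 0" for e
  proof -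
    from metric_CauchyD[OF X that] obtain N where N: "\<And>m n. m \<ge> N \<Longrightarrow> n \<ge> N \<Longrightarrow> dist (X m) (X n) < e" by blast
    have "(\<Sum>k\<in>F. (cmod (cf (X n) k - a k))\<^sup>2) \<le> e\<^sup>2" if "n \<ge> N" "finite F" for n F
    proof (rule tendsto_upperbound)
      show "(\<lambda>m. \<Sum>k\<in>F. (cmod (cf (X n) k - cf (X m) k))\<^sup>2) \<longlonglongrightarrow> (\<Sum>k\<in>F. (cmod (cf (X n) k - a k))\<^sup>2)"
        by (intro tendsto_intros a)
      have "(\<Sum>k\<in>F. (cmod (cf (X n) k - cf (X m) k))\<^sup>2) \<le> e\<^sup>2" if "m \<ge> N" for m
      proof -
        have "(\<Sum>k\<in>F. (cmod (cf (X n - X m) k))\<^sup>2) \<le> (norm (X n - X m))\<^sup>2"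
          by (rule sum_cf_le_norm) fact
        also have "\<dots> \<le> e\<^sup>2"
          using N[OF \<open>n \<ge> N\<close> \<open>m \<ge> N\<close>] by (intro power_mono) (auto simp: dist_norm)
        finally show ?thesis by simp
      qed
      then show "\<forall>\<^sub>F m in sequentially. (\<Sum>k\<in>F. (cmod (cf (X n) k - cf (X m) k))\<^sup>2) \<le> e\<^sup>2"
        by (auto simp: eventually_sequentially)
    qed auto
    then show ?thesis by blast
  qed
  obtain N where N: "\<And>F. finite F \<Longrightarrow> (\<Sum>k\<in>F. (cmod (cf (X N) k - a k))\<^sup>2) \<le> 1\<^sup>2"
    using close[of 1] by auto
  \<comment> \<open>Only the difference from \<open>X N\<close> is known to be square summable at
    this point, so the limit is built as a correction of \<open>X N\<close>.\<close>
  define L where "L = X N - Abs_l2 (\<lambda>k. cf (X N) k - a k)"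
  have L: "cf L k = a k" for k
    unfolding L_def cf_minus by (subst Abs_l2_bounded(1)[of 1]) (use N in auto)
  have "X \<longlonglongrightarrow> L"
  proof (rule metric_LIMSEQ_I)
    fix e :: real assume "e > 0"
    then obtain N where N: "\<And>n F. n \<ge> N \<Longrightarrow> finite F \<Longrightarrow> (\<Sum>k\<in>F. (cmod (cf (X n) k - a k))\<^sup>2) \<le> (e / 2)\<^sup>2"
      using close[of "e / 2"] by auto
    have "norm (X n - L) \<le> e / 2" if "n \<ge> N" for n
      by (rule norm_l2_le) (use N[OF that] \<open>e > 0\<close> in \<open>auto simp: L\<close>)
    then show "\<exists>N. \<forall>n\<ge>N. dist (X n) L < e"
      using \<open>e > 0\<close> by (force simp: dist_norm)
  qed
  then show "convergent X" by (auto simp: convergent_def)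
qed

lemma bounded_linear_cf: "bounded_linear (\<lambda>x. cf x k)"
  by (rule bounded_linear_intro[where K = 1]) (auto simp: cf_le_norm scaleR_conv_of_real)

lemmas continuous_on_cf = bounded_linear.continuous_on[OF bounded_linear_cf]

subsection \<open>Multipliers\<close>

text \<open>For an unbounded \<open>m\<close> the product may fail to be square summable and the
  value is unspecified; hence each use comes with a bound on \<open>m\<close>.\<close>

definition mulop :: "(int \<Rightarrow> complex) \<Rightarrow> l2 \<Rightarrow> l2" where
  "mulop m x = Abs_l2 (\<lambda>k. m k * cf x k)"

lemma mulop_bound:
  assumes m: "\<And>k. cmod (m k) \<le> B"
  shows "cf (mulop m x) k = m k * cf x k" "norm (mulop m x) \<le> B * norm x"
proof -
  have B: "B \<ge> 0" using m[of 0] norm_ge_zero order_trans by blast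
  have "(\<Sum>k\<in>F. (cmod (m k * cf x k))\<^sup>2) \<le> (B * norm x)\<^sup>2" if F: "finite F" for F
  proof -
    have "(\<Sum>k\<in>F. (cmod (m k * cf x k))\<^sup>2) \<le> (\<Sum>k\<in>F. B\<^sup>2 * (cmod (cf x k))\<^sup>2)"
      unfolding norm_mult power_mult_distrib by (intro sum_mono mult_right_mono power_mono m) auto
    also have "\<dots> \<le> (B * norm x)\<^sup>2"
      unfolding sum_distrib_left[symmetric] power_mult_distrib by (intro mult_left_mono sum_cf_le_norm F) auto
    finally show ?thesis .
  qed
  from Abs_l2_bounded[of "B * norm x", OF _ this] B
  show "cf (mulop m x) k = m k * cf x k" "norm (mulop m x) \<le> B * norm x"
    unfolding mulop_def by auto
qed

lemma bounded_linear_mulop: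
  assumes m: "\<And>k. cmod (m k) \<le> B"
  shows "bounded_linear (mulop m)"
  by (rule bounded_linear_intro[where K = B])
     (auto intro!: l2_eqI simp: mulop_bound(1)[OF m] algebra_simps
       intro: order_trans[OF mulop_bound(2)[OF m]])

text \<open>Coordinate form of \<open>pd_cnj\<close>.\<close>

definition cnjop :: "l2 \<Rightarrow> l2" where
  "cnjop x = Abs_l2 (\<lambda>k. cnj (cf x (- k)))"

lemma cf_cnjop [simp]: "cf (cnjop x) k = cnj (cf x (- k))"
  unfolding cnjop_def
  using summable_on_reindex_bij_betw[OF bij_uminus, of "\<lambda>k. (cmod (cf x k))\<^sup>2"] cf_summable[of x UNIV]
  by (simp add: cf_Abs)

lemma norm_cnjop [simp]: "norm (cnjop x) = norm x"
  unfolding norm_l2_def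
  using infsum_reindex_bij_betw[OF bij_uminus, of "\<lambda>k. (cmod (cf x k))\<^sup>2"] by simp

lemma bounded_linear_cnjop: "bounded_linear cnjop"
  by (rule bounded_linear_intro[where K = 1]) (auto intro!: l2_eqI)

lemma cnjop_diff: "cnjop (x - y) = cnjop x - cnjop y"
  by (auto intro: l2_eqI)

text \<open>The unitary group with frequencies \<open>\<theta>\<close>. As \<open>\<theta>\<close>
  may be unbounded, continuity in time can be expected only strongly, that is, along each fixed
  vector.\<close>

definition phase :: "(int \<Rightarrow> real) \<Rightarrow> real \<Rightarrow> l2 \<Rightarrow> l2" where
  "phase \<theta> t = mulop (\<lambda>k. cis (\<theta> k * t))"

lemma cf_phase [simp]: "cf (phase \<theta> t x) k = cis (\<theta> k * t) * cf x k"
  unfolding phase_def by (rule mulop_bound[where B = 1]) simp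

lemma norm_phase [simp]: "norm (phase \<theta> t x) = norm x"
  by (simp add: norm_l2_def norm_mult)

lemma phase_diff: "phase \<theta> t (x - y) = phase \<theta> t x - phase \<theta> t y"
  by (auto intro: l2_eqI simp: algebra_simps)

lemma phase_inverse [simp]: "phase \<theta> (- t) (phase \<theta> t x) = x" "phase \<theta> t (phase \<theta> (- t) x) = x"
  by (auto intro!: l2_eqI simp: cis_mult mult.assoc[symmetric])

lemma phase_0 [simp]: "phase \<theta> 0 x = x"
  by (auto intro: l2_eqI)

definition unit_l2 :: "int \<Rightarrow> complex \<Rightarrow> l2" where
  "unit_l2 j z = Abs_l2 (\<lambda>k. if k = j then z else 0)"

lemma cf_unit_l2 [simp]: "cf (unit_l2 j z) k = (if k = j then z else 0)"
  unfolding unit_l2_def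
  by (rule cf_Abs, rule finite_nonzero_values_imp_summable_on, rule finite_subset[of _ "{j}"]) auto

lemma norm_unit_l2 [simp]: "norm (unit_l2 j z) = cmod z"
proof -
  have "(\<Sum>\<^sub>\<infinity>k. (cmod (cf (unit_l2 j z) k))\<^sup>2) = (\<Sum>\<^sub>\<infinity>k\<in>{j}. (cmod z)\<^sup>2)"
    by (rule infsum_cong_neutral) auto
  then show ?thesis by (simp add: norm_l2_def)
qed

lemma bounded_linear_unit_l2: "bounded_linear (unit_l2 j)"
  by (rule bounded_linear_intro[where K = 1]) (auto intro!: l2_eqI simp: scaleR_conv_of_real)

lemma cf_sum: "cf (\<Sum>i\<in>F. f i) k = (\<Sum>i\<in>F. cf (f i) k)"
  by (induction F rule: infinite_finite_induct) auto

lemma l2_truncation_tendsto: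
  "((\<lambda>F. \<Sum>j\<in>F. unit_l2 j (cf x j)) \<longlongrightarrow> x) finite_sets_at_top"
proof -
  have fin: "\<forall>\<^sub>F F in finite_subsets_at_top (UNIV :: int set). finite F"
    by (intro eventually_finite_subsets_at_top_weakI)
  have n: "norm ((\<Sum>j\<in>F. unit_l2 j (cf x j)) - x) = sqrt (infsum (\<lambda>k. (cmod (cf x k))\<^sup>2) UNIV - (\<Sum>k\<in>F. (cmod (cf x k))\<^sup>2))"
    if F: "finite F" for F
  proof -
    have c: "cf (\<Sum>j\<in>F. unit_l2 j (cf x j)) k = (if k \<in> F then cf x k else 0)" for k
      using F by (simp add: cf_sum)
    have "infsum (\<lambda>k. (cmod (cf x k))\<^sup>2) UNIV = infsum (\<lambda>k. (cmod (cf x k))\<^sup>2) (F \<union> - F)" by simp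
    also have "\<dots> = (\<Sum>k\<in>F. (cmod (cf x k))\<^sup>2) + infsum (\<lambda>k. (cmod (cf x k))\<^sup>2) (- F)"
      by (subst infsum_Un_disjoint) (auto intro: cf_summable simp: F)
    also have "infsum (\<lambda>k. (cmod (cf x k))\<^sup>2) (- F) = infsum (\<lambda>k. (cmod (cf ((\<Sum>j\<in>F. unit_l2 j (cf x j)) - x) k))\<^sup>2) UNIV"
      by (rule infsum_cong_neutral) (auto simp: c)
    finally show ?thesis by (simp add: norm_l2_def)
  qed
  have "((\<lambda>F. sqrt (infsum (\<lambda>k. (cmod (cf x k))\<^sup>2) UNIV - (\<Sum>k\<in>F. (cmod (cf x k))\<^sup>2))) \<longlongrightarrow> sqrt 0) finite_sets_at_top"
    by (intro tendsto_real_sqrt infsum_tail_tendsto_0 cf_summable)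
  then have "((\<lambda>F. norm ((\<Sum>j\<in>F. unit_l2 j (cf x j)) - x)) \<longlongrightarrow> sqrt 0) finite_sets_at_top"
    by (rule Lim_transform_eventually) (auto intro: eventually_mono[OF fin] simp: n)
  then show ?thesis
    by (simp add: tendsto_norm_zero_iff LIM_zero_iff)
qed

text \<open>On a finite truncation of \<open>x\<close> this is a finite sum of continuous functions,
  and truncations converge uniformly in \<open>t\<close> because \<open>phase\<close> is an
  isometry.\<close>

lemma continuous_on_phase_const: "continuous_on S (\<lambda>t. phase \<theta> t x)"
proof -
  have "uniform_limit S (\<lambda>F t. phase \<theta> t (\<Sum>j\<in>F. unit_l2 j (cf x j))) (\<lambda>t. phase \<theta> t x) finite_sets_at_top"
    unfolding uniform_limit_iff dist_norm phase_diff[symmetric] norm_phase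
    using tendstoD[OF l2_truncation_tendsto[of x]] by (auto simp: dist_norm)
  moreover have "continuous_on S (\<lambda>t. phase \<theta> t (\<Sum>j\<in>F. unit_l2 j (cf x j)))" for F
  proof -
    have "phase \<theta> t (\<Sum>j\<in>F. unit_l2 j (cf x j)) = (\<Sum>j\<in>F. unit_l2 j (cis (\<theta> j * t) * cf x j))" for t
      by (rule l2_eqI) (auto simp: cf_sum sum_distrib_left intro!: sum.cong)
    then show ?thesis
      by (auto intro!: continuous_intros bounded_linear.continuous_on[OF bounded_linear_unit_l2])
  qed
  ultimately show ?thesis
    by (intro uniform_limit_theorem[where F = "finite_sets_at_top"]) auto
qed

text \<open>Split the increment into moving the time with the vector frozen (strong continuity) and
  moving the vector (isometry).\<close>

lemma continuous_on_phase:
  assumes "continuous_on S g" "continuous_on S w"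
  shows "continuous_on S (\<lambda>t. phase \<theta> (g t) (w t))"
  unfolding continuous_on_def
proof
  fix t assume t: "t \<in> S"
  have "((\<lambda>s. phase \<theta> (g s) (w t)) \<longlongrightarrow> phase \<theta> (g t) (w t)) (at t within S)"
    using continuous_on_compose2[OF continuous_on_phase_const[of UNIV \<theta> "w t"] assms(1)] t
    by (auto simp: continuous_on_def)
  moreover have "((\<lambda>s. phase \<theta> (g s) (w s - w t)) \<longlongrightarrow> 0) (at t within S)"
  proof (rule tendsto_norm_zero_cancel)
    have "(w \<longlongrightarrow> w t) (at t within S)" using assms(2) t by (simp add: continuous_on_def)
    then show "((\<lambda>s. norm (phase \<theta> (g s) (w s - w t))) \<longlongrightarrow> 0) (at t within S)"
      unfolding norm_phase by (rule tendsto_norm_zero[OF LIM_zero])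
  qed
  ultimately have "((\<lambda>s. phase \<theta> (g s) (w t) + phase \<theta> (g s) (w s - w t)) \<longlongrightarrow> phase \<theta> (g t) (w t) + 0) (at t within S)"
    by (rule tendsto_add)
  then show "((\<lambda>s. phase \<theta> (g s) (w s)) \<longlongrightarrow> phase \<theta> (g t) (w t)) (at t within S)"
    by (simp add: phase_diff)
qed

subsection \<open>Weighted convolutions\<close>

text \<open>One coefficient of a weighted convolution. It is used with \<open>conv_weight\<close>
  for products inside H^r and with \<open>dual_weight\<close> for the product of H^1 and
  H^(-1).\<close>

definition l2_pair :: "(int \<Rightarrow> real) \<Rightarrow> int \<Rightarrow> l2 \<Rightarrow> l2 \<Rightarrow> complex" where
  "l2_pair m k x y = (\<Sum>\<^sub>\<infinity>j. of_real (m j) * (cf x j * cf y (k - j)))"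

lemma bij_minus_int: "bij_betw (\<lambda>j. k - j) UNIV (UNIV :: int set)"
  by (rule bij_betwI[of _ _ _ "\<lambda>j. k - j"]) auto

lemma l2_pair_summable:
  assumes m: "\<And>j. \<bar>m j\<bar> \<le> B"
  shows "(\<lambda>j. cmod (of_real (m j) * (cf x j * cf y (k - j)))) summable_on UNIV"
proof (rule summable_on_comparison_test)
  show "(\<lambda>j. B * (cmod (cf x j) * cmod (cf y (k - j)))) summable_on UNIV"
    by (intro summable_on_cmult_right cf_mult_summable bij_minus_int)
  show "cmod (of_real (m j) * (cf x j * cf y (k - j))) \<le> B * (cmod (cf x j) * cmod (cf y (k - j)))" for j
    using m[of j] by (auto simp: norm_mult intro!: mult_right_mono)
qed auto

lemma L2_set_cf_shift_le: "finite F \<Longrightarrow> L2_set (\<lambda>j. cmod (cf y (k - j))) F \<le> norm y"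
proof -
  assume F: "finite F"
  have "(\<Sum>j\<in>F. (cmod (cf y (k - j)))\<^sup>2) = (\<Sum>j\<in>(\<lambda>j. k - j) ` F. (cmod (cf y j))\<^sup>2)"
    by (subst sum.reindex) (auto simp: inj_on_def)
  then have "L2_set (\<lambda>j. cmod (cf y (k - j))) F = L2_set (\<lambda>j. cmod (cf y j)) ((\<lambda>j. k - j) ` F)"
    by (simp add: L2_set_def)
  then show ?thesis using L2_set_cf_le[of "(\<lambda>j. k - j) ` F" y] F by simp
qed

lemma bounded_bilinear_l2_pair:
  assumes m: "\<And>j. \<bar>m j\<bar> \<le> B"
  shows "bounded_bilinear (l2_pair m k)"
proof
  note s = abs_summable_summable[OF l2_pair_summable[of m, OF m]]
  have B: "B \<ge> 0" using m[of 0] by linarith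
  fix x x' y y' :: l2 and r :: real
  show "l2_pair m k (x + x') y = l2_pair m k x y + l2_pair m k x' y"
    unfolding l2_pair_def by (subst infsum_add[OF s s, symmetric]) (simp add: algebra_simps)
  show "l2_pair m k x (y + y') = l2_pair m k x y + l2_pair m k x y'"
    unfolding l2_pair_def by (subst infsum_add[OF s s, symmetric]) (simp add: algebra_simps)
  show "l2_pair m k (r *\<^sub>R x) y = r *\<^sub>R l2_pair m k x y"
    unfolding l2_pair_def scaleR_conv_of_real
    by (subst infsum_cmult_right'[symmetric]) (simp add: algebra_simps)
  show "l2_pair m k x (r *\<^sub>R y) = r *\<^sub>R l2_pair m k x y"
    unfolding l2_pair_def scaleR_conv_of_real
    by (subst infsum_cmult_right'[symmetric]) (simp add: algebra_simps)
  have "cmod (l2_pair m k x y) \<le> norm x * norm y * B" for x y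
  proof -
    have "cmod (l2_pair m k x y) \<le> (\<Sum>\<^sub>\<infinity>j. cmod (of_real (m j) * (cf x j * cf y (k - j))))"
      unfolding l2_pair_def by (rule norm_infsum_bound[OF l2_pair_summable[of m, OF m]])
    also have "\<dots> \<le> norm x * norm y * B"
    proof (rule infsum_le_finite_sums[OF l2_pair_summable[of m, OF m]])
      fix F :: "int set" assume F: "finite F"
      have "(\<Sum>j\<in>F. cmod (of_real (m j) * (cf x j * cf y (k - j)))) \<le> (\<Sum>j\<in>F. B * (\<bar>cmod (cf x j)\<bar> * \<bar>cmod (cf y (k - j))\<bar>))"
        using m by (intro sum_mono) (auto simp: norm_mult intro!: mult_right_mono)
      also have "\<dots> \<le> B * (L2_set (\<lambda>j. cmod (cf x j)) F * L2_set (\<lambda>j. cmod (cf y (k - j))) F)"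
        unfolding sum_distrib_left[symmetric] by (intro mult_left_mono L2_set_mult_ineq B)
      also have "\<dots> \<le> B * (norm x * norm y)"
        by (intro mult_left_mono mult_mono L2_set_cf_le L2_set_cf_shift_le F B) (auto simp: L2_set_nonneg)
      finally show "(\<Sum>j\<in>F. cmod (of_real (m j) * (cf x j * cf y (k - j)))) \<le> norm x * norm y * B"
        by (simp add: mult_ac)
    qed
    finally show ?thesis .
  qed
  then show "\<exists>K. \<forall>x y. norm (l2_pair m k x y) \<le> norm x * norm y * K" by blast
qed

text \<open>The weight that turns convolution of Fourier coefficients into an operation on the
  weighted coefficients produced by \<open>emb r\<close>.\<close>

definition conv_weight :: "real \<Rightarrow> int \<Rightarrow> int \<Rightarrow> real" where
  "conv_weight r k j = br k powr (r / 2) * (br j powr (- r / 2) * br (k - j) powr (- r / 2))"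

lemma br_triangle: "br k \<le> 2 * (br j + br (k - j))"
proof -
  define p q where "p = real_of_int j" and "q = real_of_int (k - j)"
  have "(real_of_int k)\<^sup>2 = (p + q)\<^sup>2" by (simp add: p_def q_def)
  also have "\<dots> \<le> 2 * (p\<^sup>2 + q\<^sup>2)"
    using zero_le_power2[of "p - q"] by (simp add: power2_eq_square algebra_simps)
  finally show ?thesis by (simp add: br_def p_def q_def)
qed

text \<open>Of the two frequencies j and k - j, at least one has weight \<open>br\<close> no less
  than a quarter of \<open>br k\<close>; its negative power absorbs the growing factor and the other
  negative power remains.\<close>

lemma conv_weight_sq:
  assumes "r \<ge> 0"
  shows "(conv_weight r k j)\<^sup>2 \<le> 4 powr r * (br j powr (- r) + br (k - j) powr (- r))"
proof -
  have "br k \<le> 4 * max (br j) (br (k - j))" using br_triangle[of k j] by (auto simp: max_def)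
  then have "br k powr r \<le> (4 * max (br j) (br (k - j))) powr r"
    using assms by (intro powr_mono2) auto
  also have "\<dots> = 4 powr r * (max (br j) (br (k - j))) powr r"
    by (subst powr_mult) auto
  also have "\<dots> \<le> 4 powr r * (br j powr r + br (k - j) powr r)"
    by (intro mult_left_mono) (auto simp: max_def)
  finally have "br k powr r * (br j powr (- r) * br (k - j) powr (- r))
      \<le> 4 powr r * (br j powr r + br (k - j) powr r) * (br j powr (- r) * br (k - j) powr (- r))"
    by (intro mult_right_mono) auto
  also have "\<dots> = 4 powr r * (br j powr (- r) + br (k - j) powr (- r))"
    by (simp add: powr_minus field_simps)
  also have "br k powr r * (br j powr (- r) * br (k - j) powr (- r)) = (conv_weight r k j)\<^sup>2"
  proof -
    have sq: "(br i powr (a / 2))\<^sup>2 = br i powr a" for i a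
      by (simp add: power2_eq_square flip: powr_add)
    show ?thesis unfolding conv_weight_def power_mult_distrib sq by simp
  qed
  finally show ?thesis .
qed

text \<open>Bounds the l2 norm in j of \<open>conv_weight r k\<close>, uniformly in k. The factor 2
  stands for the two terms of \<open>conv_weight_sq\<close>, which have the same sum.\<close>

definition conv_const :: "real \<Rightarrow> real" where
  "conv_const r = sqrt (4 powr r * (2 * (\<Sum>\<^sub>\<infinity>j. br j powr (- r))))"

lemma conv_const_sq:
  "(conv_const r)\<^sup>2 = 4 powr r * (2 * (\<Sum>\<^sub>\<infinity>j. br j powr (- r)))" "conv_const r \<ge> 0"
  unfolding conv_const_def by (auto intro!: real_sqrt_pow2 mult_nonneg_nonneg infsum_nonneg)

lemma sum_conv_weight_sq:
  assumes r: "r > 1 / 2" and F: "finite F"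
  shows "(\<Sum>j\<in>F. (conv_weight r k j)\<^sup>2) \<le> (conv_const r)\<^sup>2"
proof -
  have s: "(\<Sum>j\<in>F. br j powr (- r)) \<le> (\<Sum>\<^sub>\<infinity>j. br j powr (- r))" if "finite F" for F
    using that by (intro finite_sum_le_infsum summable_br r) auto
  have "(\<Sum>j\<in>F. (conv_weight r k j)\<^sup>2) \<le> (\<Sum>j\<in>F. 4 powr r * (br j powr (- r) + br (k - j) powr (- r)))"
    using r by (intro sum_mono conv_weight_sq) auto
  also have "\<dots> = 4 powr r * ((\<Sum>j\<in>F. br j powr (- r)) + (\<Sum>j\<in>(\<lambda>j. k - j) ` F. br j powr (- r)))"
    by (subst sum.reindex) (auto simp: inj_on_def sum_distrib_left[symmetric] sum.distrib)
  also have "\<dots> \<le> 4 powr r * ((\<Sum>\<^sub>\<infinity>j. br j powr (- r)) + (\<Sum>\<^sub>\<infinity>j. br j powr (- r)))"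
    using F by (intro mult_left_mono add_mono s) auto
  finally show ?thesis by (simp add: conv_const_sq)
qed

lemma conv_weight_bound:
  assumes r: "r > 1 / 2"
  shows "\<bar>conv_weight r k j\<bar> \<le> conv_const r"
  by (rule power2_le_imp_le) (use sum_conv_weight_sq[OF r, of "{j}" k] conv_const_sq(2)[of r] in auto)

definition convop :: "real \<Rightarrow> l2 \<Rightarrow> l2 \<Rightarrow> l2" where
  "convop r x y = Abs_l2 (\<lambda>k. l2_pair (conv_weight r k) k x y)"

text \<open>The algebra property of H^r for r > 1/2: Cauchy-Schwarz in j with the uniform bound on
  the weight, followed by a sum over k.\<close>

lemma convop_bound:
  assumes r: "r > 1 / 2"
  shows "cf (convop r x y) k = l2_pair (conv_weight r k) k x y"
    "norm (convop r x y) \<le> conv_const r * (norm x * norm y)"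
proof -
  \<comment> \<open>Convolution of the squared coefficients; by Fubini its total is the product of
    the squared norms.\<close>
  define S where "S k = (\<Sum>\<^sub>\<infinity>j. (cmod (cf x j))\<^sup>2 * (cmod (cf y (k - j)))\<^sup>2)" for k
  have s1: "(\<lambda>(i, j). (cmod (cf x i))\<^sup>2 * (cmod (cf y j))\<^sup>2) summable_on UNIV \<times> UNIV"
    by (rule summable_on_SigmaI[where g = "\<lambda>i. (cmod (cf x i))\<^sup>2 * (\<Sum>\<^sub>\<infinity>j. (cmod (cf y j))\<^sup>2)"])
       (auto intro!: has_sum_cmult_right has_sum_infsum summable_on_cmult_left cf_summable)
  then have s2: "(\<lambda>(k, j). (cmod (cf x j))\<^sup>2 * (cmod (cf y (k - j)))\<^sup>2) summable_on UNIV \<times> UNIV"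
    using summable_on_reindex_bij_betw[OF bij_conv, of "\<lambda>(i, j). (cmod (cf x i))\<^sup>2 * (cmod (cf y j))\<^sup>2"] by (simp add: case_prod_unfold)
  have sS: "S summable_on UNIV"
    unfolding S_def using summable_on_Sigma_banach[OF s2] by simp
  have si: "(\<lambda>j. (cmod (cf x j))\<^sup>2 * (cmod (cf y (k - j)))\<^sup>2) summable_on UNIV" for k
    using summable_on_SigmaD1[OF s2, of k] by simp
  have "infsum S UNIV = (\<Sum>\<^sub>\<infinity>(k, j)\<in>UNIV \<times> UNIV. (cmod (cf x j))\<^sup>2 * (cmod (cf y (k - j)))\<^sup>2)"
    unfolding S_def by (rule infsum_Sigma'_banach[OF s2])
  also have "\<dots> = (\<Sum>\<^sub>\<infinity>(i, j)\<in>UNIV \<times> UNIV. (cmod (cf x i))\<^sup>2 * (cmod (cf y j))\<^sup>2)"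
    using infsum_reindex_bij_betw[OF bij_conv, of "\<lambda>(i, j). (cmod (cf x i))\<^sup>2 * (cmod (cf y j))\<^sup>2"] by (simp add: case_prod_unfold)
  also have "\<dots> = (\<Sum>\<^sub>\<infinity>i. \<Sum>\<^sub>\<infinity>j. (cmod (cf x i))\<^sup>2 * (cmod (cf y j))\<^sup>2)" by (rule infsum_Sigma'_banach[OF s1, symmetric])
  also have "\<dots> = (norm x)\<^sup>2 * (norm y)\<^sup>2"
    by (simp add: infsum_cmult_left' infsum_cmult_right' norm_l2_sq)
  finally have iS: "infsum S UNIV = (norm x)\<^sup>2 * (norm y)\<^sup>2" .
  have S0: "S k \<ge> 0" for k unfolding S_def by (intro infsum_nonneg) auto
  have p: "(cmod (l2_pair (conv_weight r k) k x y))\<^sup>2 \<le> (conv_const r)\<^sup>2 * S k" for k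
  proof -
    note sm = l2_pair_summable[of "conv_weight r k", OF conv_weight_bound[OF r]]
    have "cmod (l2_pair (conv_weight r k) k x y) \<le> (\<Sum>\<^sub>\<infinity>j. cmod (of_real (conv_weight r k j) * (cf x j * cf y (k - j))))"
      unfolding l2_pair_def by (rule norm_infsum_bound[OF sm])
    also have "\<dots> \<le> conv_const r * sqrt (S k)"
    proof (rule infsum_le_finite_sums[OF sm])
      fix F :: "int set" assume F: "finite F"
      have "(\<Sum>j\<in>F. cmod (of_real (conv_weight r k j) * (cf x j * cf y (k - j))))
          = (\<Sum>j\<in>F. \<bar>conv_weight r k j\<bar> * \<bar>cmod (cf x j) * cmod (cf y (k - j))\<bar>)"
        by (simp add: norm_mult)
      also have "\<dots> \<le> L2_set (conv_weight r k) F * L2_set (\<lambda>j. cmod (cf x j) * cmod (cf y (k - j))) F"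
        by (rule L2_set_mult_ineq)
      also have "\<dots> \<le> conv_const r * sqrt (S k)"
      proof (rule mult_mono)
        show "L2_set (conv_weight r k) F \<le> conv_const r"
          unfolding L2_set_def using sum_conv_weight_sq[OF r F] conv_const_sq(2) by (intro real_le_lsqrt) (auto intro: sum_nonneg)
        show "L2_set (\<lambda>j. cmod (cf x j) * cmod (cf y (k - j))) F \<le> sqrt (S k)"
          unfolding L2_set_def S_def power_mult_distrib
          by (intro real_sqrt_le_mono finite_sum_le_infsum si F) auto
      qed (auto simp: L2_set_nonneg conv_const_sq)
      finally show "(\<Sum>j\<in>F. cmod (of_real (conv_weight r k j) * (cf x j * cf y (k - j)))) \<le> conv_const r * sqrt (S k)" .
    qed
    finally have "(cmod (l2_pair (conv_weight r k) k x y))\<^sup>2 \<le> (conv_const r * sqrt (S k))\<^sup>2"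
      by (intro power_mono) auto
    then show ?thesis by (simp add: power_mult_distrib S0)
  qed
  have "(\<Sum>k\<in>F. (cmod (l2_pair (conv_weight r k) k x y))\<^sup>2) \<le> (conv_const r * (norm x * norm y))\<^sup>2" if F: "finite F" for F
  proof -
    have "(\<Sum>k\<in>F. (cmod (l2_pair (conv_weight r k) k x y))\<^sup>2) \<le> (\<Sum>k\<in>F. (conv_const r)\<^sup>2 * S k)"
      by (intro sum_mono p)
    also have "\<dots> \<le> (conv_const r)\<^sup>2 * infsum S UNIV"
      unfolding sum_distrib_left[symmetric] by (intro mult_left_mono finite_sum_le_infsum sS F S0) auto
    finally show ?thesis by (simp add: iS power_mult_distrib)
  qed
  from Abs_l2_bounded[OF _ this] show
    "cf (convop r x y) k = l2_pair (conv_weight r k) k x y" "norm (convop r x y) \<le> conv_const r * (norm x * norm y)"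
    unfolding convop_def by (auto intro!: mult_nonneg_nonneg simp: conv_const_sq)
qed

lemma bounded_bilinear_convop:
  assumes r: "r > 1 / 2"
  shows "bounded_bilinear (convop r)"
proof
  interpret b: bounded_bilinear "l2_pair (conv_weight r k) k" for k
    by (rule bounded_bilinear_l2_pair[OF conv_weight_bound[OF r]])
  fix x x' y y' :: l2 and a :: real
  note c = convop_bound(1)[OF r]
  show "convop r (x + x') y = convop r x y + convop r x' y"
    by (intro l2_eqI) (simp add: c b.add_left)
  show "convop r x (y + y') = convop r x y + convop r x y'"
    by (intro l2_eqI) (simp add: c b.add_right)
  show "convop r (a *\<^sub>R x) y = a *\<^sub>R convop r x y"
    by (intro l2_eqI) (simp add: c b.scaleR_left scaleR_conv_of_real)
  show "convop r x (a *\<^sub>R y) = a *\<^sub>R convop r x y"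
    by (intro l2_eqI) (simp add: c b.scaleR_right scaleR_conv_of_real)
  show "\<exists>K. \<forall>x y. norm (convop r x y) \<le> norm x * norm y * K"
    using convop_bound(2)[OF r] by (intro exI[of _ "conv_const r"]) (auto simp: mult_ac)
qed

section \<open>Ordinary differential equations in Banach spaces\<close>

text \<open>Translates the difference quotients in \<open>C1_curve\<close> into the usual notion of
  derivative.\<close>

lemma has_vector_derivative_quotient:
  "(f has_vector_derivative d) (at t within S) \<longleftrightarrow>
   ((\<lambda>\<tau>. norm ((1 / (\<tau> - t)) *\<^sub>R (f \<tau> - f t) - d)) \<longlongrightarrow> 0) (at t within S)"
proof -
  have eq: "norm ((1 / norm (\<tau> - t)) *\<^sub>R (f \<tau> - (f t + (\<tau> - t) *\<^sub>R d))) = norm ((1 / (\<tau> - t)) *\<^sub>R (f \<tau> - f t) - d)"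
    if "\<tau> \<noteq> t" for \<tau>
  proof -
    have "(1 / (\<tau> - t)) *\<^sub>R (f \<tau> - f t) - d = (1 / (\<tau> - t)) *\<^sub>R (f \<tau> - (f t + (\<tau> - t) *\<^sub>R d))"
      using that by (simp add: scaleR_diff_right scaleR_add_right)
    then show ?thesis by simp
  qed
  have "(f has_vector_derivative d) (at t within S) \<longleftrightarrow>
     ((\<lambda>y. norm ((1 / norm (y - t)) *\<^sub>R (f y - (f t + (y - t) *\<^sub>R d)))) \<longlongrightarrow> 0) (at t within S)"
    unfolding has_vector_derivative_def has_derivative_within tendsto_norm_zero_iff
    by (simp add: bounded_linear_scaleR_left)
  also have "\<dots> \<longleftrightarrow> ((\<lambda>\<tau>. norm ((1 / (\<tau> - t)) *\<^sub>R (f \<tau> - f t) - d)) \<longlongrightarrow> 0) (at t within S)"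
    by (rule tendsto_cong, unfold eventually_at_filter, rule always_eventually) (use eq in blast)
  finally show ?thesis .
qed

lemma integral_norm_le:
  fixes f :: "real \<Rightarrow> 'a :: banach"
  assumes "continuous_on {a..b} f" "\<And>t. t \<in> {a..b} \<Longrightarrow> norm (f t) \<le> B" "a \<le> b"
  shows "norm (integral {a..b} f) \<le> B * (b - a)"
  using assms by (intro integral_bound) auto

text \<open>\<open>K * T \<le> 1\<close> keeps the iterates in the unit ball about \<open>w0\<close>
  and \<open>L * T \<le> 1 / 2\<close> makes the iteration a contraction. Continuity of
  \<open>G\<close> is asked only along continuous curves, which is the form that strongly continuous
  phases provide.\<close>

lemma picard_local_existence:
  fixes G :: "real \<Rightarrow> 'a :: banach \<Rightarrow> 'a"
  assumes T: "T \<ge> 0"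
    and cont: "\<And>w. continuous_on {0..T} w \<Longrightarrow> continuous_on {0..T} (\<lambda>t. G t (w t))"
    and bound: "\<And>t x. t \<in> {0..T} \<Longrightarrow> norm (x - w0) \<le> 1 \<Longrightarrow> norm (G t x) \<le> K"
    and lip: "\<And>t x y. t \<in> {0..T} \<Longrightarrow> norm (x - w0) \<le> 1 \<Longrightarrow> norm (y - w0) \<le> 1 \<Longrightarrow>
        norm (G t x - G t y) \<le> L * norm (x - y)"
    and TK: "K * T \<le> 1" and TL: "L * T \<le> 1 / 2" and L: "L \<ge> 0"
  obtains w where "continuous_on {0..T} w" "w 0 = w0"
    "\<And>t. t \<in> {0..T} \<Longrightarrow> (w has_vector_derivative G t (w t)) (at t within {0..T})"
proof -
  \<comment> \<open>Clamping time to the interval extends curves to the whole line, so that the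
    fixed point theorem can be used in the complete space of bounded continuous functions.\<close>
  define cl where "cl t = max 0 (min T t)" for t
  have cl: "cl t \<in> {0..T}" "t \<in> {0..T} \<Longrightarrow> cl t = t" for t using T by (auto simp: cl_def)
  have "norm (G 0 w0) \<le> K" using bound[of 0 w0] T by simp
  then have K: "K \<ge> 0" using norm_ge_zero[of "G 0 w0"] by linarith
  define S where "S = PiC UNIV (\<lambda>_ :: real. cball w0 1)"
  have S: "w \<in> S \<longleftrightarrow> (\<forall>t. norm (apply_bcontfun w t - w0) \<le> 1)" for w
    by (auto simp: S_def mem_PiC_iff dist_norm norm_minus_commute)
  define J where "J w t = w0 + integral {0..cl t} (\<lambda>s. G s (apply_bcontfun w s))" for w t
  have Gc: "continuous_on {0..T} (\<lambda>s. G s (apply_bcontfun w s))" for w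
    by (intro cont) simp
  have sub: "{0..cl t} \<subseteq> {0..T}" for t using cl by auto
  have Jb: "norm (J w t - w0) \<le> 1" if "w \<in> S" for w t
  proof -
    have "norm (integral {0..cl t} (\<lambda>s. G s (apply_bcontfun w s))) \<le> K * (cl t - 0)"
      using that sub[of t] cl(1)[of t]
      by (intro integral_norm_le continuous_on_subset[OF Gc] bound) (auto simp: S)
    also have "\<dots> \<le> K * T" using cl(1)[of t] by (intro mult_left_mono K) auto
    finally show ?thesis using TK by (simp add: J_def)
  qed
  have Jc: "continuous_on UNIV (J w)" for w
  proof -
    have "continuous_on {0..T} (\<lambda>t. integral {0..t} (\<lambda>s. G s (apply_bcontfun w s)))"
      by (rule indefinite_integral_continuous_1[OF integrable_continuous_interval[OF Gc]])
    moreover have "continuous_on UNIV cl" unfolding cl_def by (intro continuous_intros)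
    ultimately have "continuous_on UNIV (\<lambda>t. integral {0..cl t} (\<lambda>s. G s (apply_bcontfun w s)))"
      by (rule continuous_on_compose2) (use cl in blast)
    then show ?thesis unfolding J_def by (intro continuous_on_add continuous_on_const)
  qed
  define P where "P w = Bcontfun (J w)" for w
  have P: "apply_bcontfun (P w) t = J w t" if "w \<in> S" for w t
  proof -
    have "norm (J w t) \<le> norm w0 + 1" for t
      using Jb[OF that, of t] norm_triangle_ineq[of w0 "J w t - w0"] by simp
    then have "J w \<in> bcontfun" by (rule bcontfun_normI[OF Jc])
    then show ?thesis by (simp add: P_def Bcontfun_inverse)
  qed
  have "\<exists>!w. w \<in> S \<and> P w = w"
  proof (rule Banach_fix)
    show "complete S" unfolding S_def
      by (simp add: complete_eq_closed closed_PiC)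
    show "S \<noteq> {}"
    proof -
      have "Bcontfun (\<lambda>_. w0) \<in> S"
        unfolding S by (simp add: Bcontfun_inverse const_bcontfun)
      then show ?thesis by blast
    qed
    show "P ` S \<subseteq> S" using Jb P by (auto simp: S)
    fix v w assume vw: "v \<in> S" "w \<in> S"
    show "dist (P v) (P w) \<le> 1 / 2 * dist v w"
    proof (rule dist_bound)
      fix t
      have d: "norm (apply_bcontfun v s - apply_bcontfun w s) \<le> dist v w" for s
        using dist_bounded[of v s w] by (simp add: dist_norm)
      have "J v t - J w t = integral {0..cl t} (\<lambda>s. G s (apply_bcontfun v s) - G s (apply_bcontfun w s))"
        unfolding J_def
        by (subst integral_diff) (auto intro!: integrable_continuous_interval continuous_on_subset[OF Gc sub])
      also have "norm \<dots> \<le> (L * dist v w) * (cl t - 0)"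
      proof (rule integral_norm_le)
        fix s assume "s \<in> {0..cl t}"
        then have "norm (G s (apply_bcontfun v s) - G s (apply_bcontfun w s)) \<le> L * norm (apply_bcontfun v s - apply_bcontfun w s)"
          using vw sub[of t] by (intro lip) (auto simp: S)
        also have "\<dots> \<le> L * dist v w" by (intro mult_left_mono d L)
        finally show "norm (G s (apply_bcontfun v s) - G s (apply_bcontfun w s)) \<le> L * dist v w" .
      qed (use cl(1)[of t] in \<open>auto intro!: continuous_intros continuous_on_subset[OF Gc sub]\<close>)
      also have "\<dots> \<le> (L * dist v w) * T"
        using cl(1)[of t] by (intro mult_left_mono) (auto intro!: mult_nonneg_nonneg L)
      also have "\<dots> = (L * T) * dist v w" by simp
      also have "\<dots> \<le> 1 / 2 * dist v w" by (intro mult_right_mono TL) auto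
      finally show "dist (apply_bcontfun (P v) t) (apply_bcontfun (P w) t) \<le> 1 / 2 * dist v w"
        using P vw by (simp add: dist_norm)
    qed
  qed auto
  then obtain w where w: "w \<in> S" "P w = w" by blast
  have wJ: "apply_bcontfun w t = J w t" for t using P[OF w(1)] w(2) by simp
  show ?thesis
  proof
    show "continuous_on {0..T} (apply_bcontfun w)" by simp
    show "apply_bcontfun w 0 = w0" unfolding wJ[of 0] J_def cl_def using T by simp
    fix t assume t: "t \<in> {0..T}"
    have "((\<lambda>t. w0 + integral {0..t} (\<lambda>s. G s (apply_bcontfun w s))) has_vector_derivative 0 + G t (apply_bcontfun w t)) (at t within {0..T})"
      by (intro has_vector_derivative_add has_vector_derivative_const integral_has_vector_derivative Gc t)
    then have "((\<lambda>t. w0 + integral {0..t} (\<lambda>s. G s (apply_bcontfun w s))) has_vector_derivative G t (apply_bcontfun w t)) (at t within {0..T})"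
      by (simp only: add_0_left)
    then show "(apply_bcontfun w has_vector_derivative G t (apply_bcontfun w t)) (at t within {0..T})"
      by (rule has_vector_derivative_transform[OF t, rotated]) (subst wJ, simp add: J_def cl)
  qed
qed

text \<open>Instead of Gronwall, the difference is measured with the weight exp (-2 M t). At the
  point where the weighted difference attains its maximum A, integration returns at most A / 2 of
  it, so A = 0.\<close>

lemma ode_unique:
  fixes v w :: "real \<Rightarrow> 'a :: banach"
  assumes v: "\<And>t. t \<in> {0..T} \<Longrightarrow> (v has_vector_derivative F t) (at t within {0..T})"
    and w: "\<And>t. t \<in> {0..T} \<Longrightarrow> (w has_vector_derivative H t) (at t within {0..T})"
    and lip: "\<And>t. t \<in> {0..T} \<Longrightarrow> norm (F t - H t) \<le> L * norm (v t - w t)"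
    and init: "v 0 = w 0" and t: "t \<in> {0..T}"
  shows "v t = w t"
proof -
  \<comment> \<open>The maximum with 1 makes the exponential rate positive whatever the sign of
    \<open>L\<close>.\<close>
  define M where "M = max L 1"
  have M: "M > 0" by (simp add: M_def)
  define d where "d t = v t - w t" for t
  have dd: "(d has_vector_derivative F t - H t) (at t within {0..T})" if "t \<in> {0..T}" for t
    unfolding d_def by (intro has_vector_derivative_diff v w that)
  have dc: "continuous_on {0..T} d"
    by (rule continuous_on_vector_derivative[OF dd])
  have ec: "continuous_on {0..T} (\<lambda>t. norm (d t) * exp (- 2 * M * t))"
    by (intro continuous_intros dc)
  have "{0..T} \<noteq> {}" using t by blast
  from continuous_attains_sup[OF compact_Icc this ec] obtain s where s: "s \<in> {0..T}" "\<And>t. t \<in> {0..T} \<Longrightarrow> norm (d t) * exp (- 2 * M * t) \<le> norm (d s) * exp (- 2 * M * s)"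
    by blast
  define A where "A = norm (d s) * exp (- 2 * M * s)"
  have A: "norm (d t) \<le> A * exp (2 * M * t)" if "t \<in> {0..T}" for t
    using s(2)[OF that] unfolding A_def[symmetric] by (simp add: exp_minus field_simps)
  have 1: "((\<lambda>t. F t - H t) has_integral (d s - d 0)) {0..s}"
    using s by (intro fundamental_theorem_of_calculus has_vector_derivative_within_subset[OF dd]) auto
  have 2: "((\<lambda>t. M * (A * exp (2 * M * t))) has_integral (A / 2 * exp (2 * M * s) - A / 2 * exp (2 * M * 0))) {0..s}"
    using s M by (intro fundamental_theorem_of_calculus)
      (auto intro!: derivative_eq_intros simp flip: has_real_derivative_iff_has_vector_derivative)
  have "norm (F t - H t) \<le> M * (A * exp (2 * M * t))" if "t \<in> {0..s}" for t
  proof -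
    have t: "t \<in> {0..T}" using that s by auto
    have "norm (F t - H t) \<le> L * norm (d t)" unfolding d_def by (rule lip[OF t])
    also have "\<dots> \<le> M * norm (d t)" by (intro mult_right_mono) (auto simp: M_def)
    also have "\<dots> \<le> M * (A * exp (2 * M * t))" using M by (intro mult_left_mono A t) auto
    finally show ?thesis .
  qed
  then have "norm (integral {0..s} (\<lambda>t. F t - H t)) \<le> integral {0..s} (\<lambda>t. M * (A * exp (2 * M * t)))"
    using 1 2 by (intro integral_norm_bound_integral) auto
  then have "norm (d s) \<le> A / 2 * exp (2 * M * s) - A / 2"
    unfolding integral_unique[OF 1] integral_unique[OF 2] using init by (simp add: d_def)
  moreover have "norm (d s) = A * exp (2 * M * s)"
    by (simp add: A_def exp_minus)
  ultimately have "A * exp (2 * M * s) \<le> - A" by (simp add: field_simps)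
  moreover have "A \<ge> 0" by (simp add: A_def)
  ultimately have "A * exp (2 * M * s) \<le> 0" by linarith
  then have "A = 0" using \<open>A \<ge> 0\<close> by (simp add: mult_le_0_iff)
  then have "norm (d t) \<le> 0" using A[OF t] by simp
  then show ?thesis by (simp add: d_def)
qed

section \<open>Sobolev spaces in coordinates\<close>

text \<open>Coordinates on H^r: up to the factor sqrt (2 pi) an isometry onto \<open>l2\<close>,
  with inverse \<open>dist_of r\<close>.\<close>

definition emb :: "real \<Rightarrow> pdist \<Rightarrow> l2" where
  "emb r u = Abs_l2 (\<lambda>k. of_real (br k powr (r / 2)) * fcoeff u k)"

lemma sobolev_br: "sobolev r = {u. (\<lambda>k. (cmod (of_real (br k powr (r / 2)) * fcoeff u k))\<^sup>2) summable_on UNIV}"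
  and sobolev_norm_br: "sobolev_norm r u = sqrt (2 * pi * (\<Sum>\<^sub>\<infinity>k. (cmod (of_real (br k powr (r / 2)) * fcoeff u k))\<^sup>2))"
proof -
  have "(cmod (of_real (br k powr (r / 2)) * fcoeff u k))\<^sup>2 = (1 + (real_of_int k)\<^sup>2) powr r * (cmod (fcoeff u k))\<^sup>2" for k u
    by (simp add: norm_mult power_mult_distrib power2_eq_square[of "_ powr _"] powr_add[symmetric] flip: br_def)
  then show "sobolev r = {u. (\<lambda>k. (cmod (of_real (br k powr (r / 2)) * fcoeff u k))\<^sup>2) summable_on UNIV}"
    "sobolev_norm r u = sqrt (2 * pi * (\<Sum>\<^sub>\<infinity>k. (cmod (of_real (br k powr (r / 2)) * fcoeff u k))\<^sup>2))"
    by (simp_all add: sobolev_def sobolev_norm_def)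
qed

lemma cf_emb: "u \<in> sobolev r \<Longrightarrow> cf (emb r u) k = of_real (br k powr (r / 2)) * fcoeff u k"
  by (simp add: emb_def cf_Abs sobolev_br)

lemma fcoeff_emb: "u \<in> sobolev r \<Longrightarrow> fcoeff u k = of_real (br k powr (- r / 2)) * cf (emb r u) k"
  by (simp add: cf_emb powr_minus)

lemma sobolev_norm_emb: "u \<in> sobolev r \<Longrightarrow> sobolev_norm r u = sqrt (2 * pi) * norm (emb r u)"
  by (simp add: sobolev_norm_br norm_l2_def cf_emb real_sqrt_mult)

text \<open>Matching weighted coefficients with an element of \<open>l2\<close> settles membership
  and coordinates at once; every operation below is transported by this rule.\<close>

lemma sobolev_embI:
  assumes "\<And>k. of_real (br k powr (r / 2)) * fcoeff u k = cf x k"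
  shows "u \<in> sobolev r" "emb r u = x"
proof -
  show *: "u \<in> sobolev r" unfolding sobolev_br using assms by (simp add: cf_summable)
  show "emb r u = x" by (rule l2_eqI) (simp add: cf_emb * assms)
qed

text \<open>Defined for every real r, since the weighted coefficients grow at most polynomially and
  therefore belong to a distribution.\<close>

definition dist_of :: "real \<Rightarrow> l2 \<Rightarrow> pdist" where
  "dist_of r x = pd_of_coeffs (\<lambda>k. of_real (br k powr (- r / 2)) * cf x k)"

lemma fcoeff_dist_of: "fcoeff (dist_of r x) k = of_real (br k powr (- r / 2)) * cf x k"
  unfolding dist_of_def
proof (rule fcoeff_pd_of_coeffs)
  fix k
  have "br k powr (- r / 2) \<le> br k powr real (nat \<lceil>\<bar>r\<bar>\<rceil>)"
    using br_ge_1[of k] by (intro powr_mono) linarith+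
  also have "\<dots> = br k ^ nat \<lceil>\<bar>r\<bar>\<rceil>" by (rule powr_realpow) simp
  finally show "cmod (of_real (br k powr (- r / 2)) * cf x k) \<le> norm x * br k ^ nat \<lceil>\<bar>r\<bar>\<rceil>"
    by (simp add: norm_mult mult.commute[of "norm x"] mult_mono cf_le_norm)
qed

lemma dist_of_sobolev [simp]: "dist_of r x \<in> sobolev r" and emb_dist_of [simp]: "emb r (dist_of r x) = x"
proof -
  have "of_real (br k powr (r / 2)) * fcoeff (dist_of r x) k = cf x k" for k
    by (simp add: fcoeff_dist_of powr_minus mult.assoc[symmetric] flip: of_real_mult)
  from sobolev_embI[OF this] show "dist_of r x \<in> sobolev r" "emb r (dist_of r x) = x" by auto
qed

lemma emb_inject: "u \<in> sobolev r \<Longrightarrow> v \<in> sobolev r \<Longrightarrow> emb r u = emb r v \<Longrightarrow> u = v"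
  by (intro pdist_fcoeff_eqI) (simp add: fcoeff_emb)

lemma dist_of_emb: "u \<in> sobolev r \<Longrightarrow> dist_of r (emb r u) = u"
  by (rule emb_inject[of _ r]) simp_all

lemma
  assumes "u \<in> sobolev r" "v \<in> sobolev r"
  shows sobolev_add: "u + v \<in> sobolev r" and emb_add: "emb r (u + v) = emb r u + emb r v"
    and sobolev_diff: "u - v \<in> sobolev r" and emb_diff: "emb r (u - v) = emb r u - emb r v"
proof -
  have 1: "of_real (br k powr (r / 2)) * fcoeff (u + v) k = cf (emb r u + emb r v) k"
    and 2: "of_real (br k powr (r / 2)) * fcoeff (u - v) k = cf (emb r u - emb r v) k" for k
    using assms by (simp_all add: cf_emb algebra_simps)
  show "u + v \<in> sobolev r" "emb r (u + v) = emb r u + emb r v" "u - v \<in> sobolev r" "emb r (u - v) = emb r u - emb r v"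
    using sobolev_embI[OF 1] sobolev_embI[OF 2] by auto
qed

lemma cf_mulop_const: "cf (mulop (\<lambda>_. c) x) k = c * cf x k"
  by (rule mulop_bound(1)[where B = "cmod c"]) simp

lemma
  assumes "u \<in> sobolev r"
  shows sobolev_scaleC: "c *\<^sub>C u \<in> sobolev r" and emb_scaleC: "emb r (c *\<^sub>C u) = mulop (\<lambda>_. c) (emb r u)"
    and sobolev_scaleR: "a *\<^sub>R u \<in> sobolev r" and emb_scaleR: "emb r (a *\<^sub>R u) = a *\<^sub>R emb r u"
    and sobolev_cnj: "pd_cnj u \<in> sobolev r" and emb_cnj: "emb r (pd_cnj u) = cnjop (emb r u)"
proof -
  have 1: "of_real (br k powr (r / 2)) * fcoeff (c *\<^sub>C u) k = cf (mulop (\<lambda>_. c) (emb r u)) k"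
    and 2: "of_real (br k powr (r / 2)) * fcoeff (a *\<^sub>R u) k = cf (a *\<^sub>R emb r u) k"
    and 3: "of_real (br k powr (r / 2)) * fcoeff (pd_cnj u) k = cf (cnjop (emb r u)) k" for k
    using assms by (simp_all add: cf_emb cf_mulop_const)
  show "c *\<^sub>C u \<in> sobolev r" "emb r (c *\<^sub>C u) = mulop (\<lambda>_. c) (emb r u)" "a *\<^sub>R u \<in> sobolev r" "emb r (a *\<^sub>R u) = a *\<^sub>R emb r u"
    "pd_cnj u \<in> sobolev r" "emb r (pd_cnj u) = cnjop (emb r u)"
    using sobolev_embI[OF 1] sobolev_embI[OF 2] sobolev_embI[OF 3] by auto
qed

text \<open>Coordinate form of the inclusion of H^r in H^(r-a).\<close>

definition lower :: "real \<Rightarrow> l2 \<Rightarrow> l2" where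
  "lower a = mulop (\<lambda>k. of_real (br k powr (- a / 2)))"

lemma lower_weight_le: "a \<ge> 0 \<Longrightarrow> cmod (of_real (br k powr (- a / 2))) \<le> 1"
  using powr_mono[of "- a / 2" 0 "br k"] br_ge_1[of k] by simp

lemma bounded_linear_lower: "a \<ge> 0 \<Longrightarrow> bounded_linear (lower a)"
  unfolding lower_def by (rule bounded_linear_mulop[OF lower_weight_le])

lemma cf_lower: "a \<ge> 0 \<Longrightarrow> cf (lower a x) k = of_real (br k powr (- a / 2)) * cf x k"
  unfolding lower_def by (rule mulop_bound(1)[OF lower_weight_le])

lemma
  assumes u: "u \<in> sobolev r" and r: "r' \<le> r"
  shows sobolev_mono: "u \<in> sobolev r'" and emb_mono: "emb r' u = lower (r - r') (emb r u)"
proof -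
  have "of_real (br k powr (r' / 2)) * fcoeff u k = cf (lower (r - r') (emb r u)) k" for k
  proof -
    have "br k powr (r' / 2) = br k powr (- (r - r') / 2) * br k powr (r / 2)"
      by (simp add: powr_add[symmetric] field_simps)
    then show ?thesis using r u by (simp add: cf_lower cf_emb)
  qed
  from sobolev_embI[OF this] show "u \<in> sobolev r'" "emb r' u = lower (r - r') (emb r u)" by auto
qed

text \<open>Coordinate form of differentiation from H^r to H^(r-1); the loss of one order makes the
  symbol bounded by 1, independently of r.\<close>

definition derivop :: "l2 \<Rightarrow> l2" where
  "derivop = mulop (\<lambda>k. \<i> * of_int k * of_real (br k powr (- 1 / 2)))"

lemma deriv_weight_le: "cmod (\<i> * of_int k * of_real (br k powr (- 1 / 2))) \<le> 1"
proof -
  have "\<bar>real_of_int k\<bar> \<le> sqrt (br k)" by (rule real_le_rsqrt) (simp add: br_def)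
  also have "sqrt (br k) = br k powr (1 / 2)" by (simp add: powr_half_sqrt)
  finally have "\<bar>real_of_int k\<bar> * br k powr (- 1 / 2) \<le> br k powr (1 / 2) * br k powr (- 1 / 2)"
    by (intro mult_right_mono) auto
  also have "\<dots> = 1" by (simp flip: powr_add)
  finally show ?thesis by (simp add: norm_mult)
qed

lemma bounded_linear_derivop: "bounded_linear derivop"
  unfolding derivop_def by (rule bounded_linear_mulop[OF deriv_weight_le])

lemma cf_derivop: "cf (derivop x) k = \<i> * of_int k * of_real (br k powr (- 1 / 2)) * cf x k"
  unfolding derivop_def by (rule mulop_bound(1)[OF deriv_weight_le])

lemma
  assumes u: "u \<in> sobolev r"
  shows sobolev_deriv: "\<partial>\<^sub>x u \<in> sobolev (r - 1)" and emb_deriv: "emb (r - 1) (\<partial>\<^sub>x u) = derivop (emb r u)"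
proof -
  have "of_real (br k powr ((r - 1) / 2)) * fcoeff (\<partial>\<^sub>x u) k = cf (derivop (emb r u)) k" for k
  proof -
    have "br k powr ((r - 1) / 2) = br k powr (- 1 / 2) * br k powr (r / 2)"
      by (simp add: powr_add[symmetric] field_simps)
    then show ?thesis using u by (simp add: cf_derivop cf_emb)
  qed
  from sobolev_embI[OF this] show "\<partial>\<^sub>x u \<in> sobolev (r - 1)" "emb (r - 1) (\<partial>\<^sub>x u) = derivop (emb r u)" by auto
qed

text \<open>Cauchy-Schwarz against the weights br^(-r/2), which are square summable exactly in the
  range of \<open>summable_br\<close>.\<close>

lemma sobolev_wiener:
  assumes u: "u \<in> sobolev r" and r: "r > 1 / 2"
  shows "u \<in> wiener"
proof -
  define w where "w = Abs_l2 (\<lambda>k. of_real (br k powr (- r / 2)))"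
  have "(\<lambda>k. (cmod (of_real (br k powr (- r / 2))))\<^sup>2) summable_on UNIV"
    using summable_br[OF r] by (simp add: power2_eq_square flip: powr_add)
  then have "cf w k = of_real (br k powr (- r / 2))" for k unfolding w_def by (rule cf_Abs)
  then show ?thesis
    using cf_mult_summable[OF bij_id, of w "emb r u"] by (simp add: wiener_def fcoeff_emb[OF u] norm_mult)
qed

lemma
  assumes u: "u \<in> sobolev r" and v: "v \<in> sobolev r" and r: "r > 1 / 2"
  shows sobolev_mult: "u \<cdot>\<^sub>d v \<in> sobolev r" and emb_mult: "emb r (u \<cdot>\<^sub>d v) = convop r (emb r u) (emb r v)"
proof -
  have "of_real (br k powr (r / 2)) * fcoeff (u \<cdot>\<^sub>d v) k = cf (convop r (emb r u) (emb r v)) k" for k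
  proof -
    have "of_real (conv_weight r k j) * (cf (emb r u) j * cf (emb r v) (k - j)) =
        of_real (br k powr (r / 2)) * (fcoeff u j * fcoeff v (k - j))" for j
      by (simp add: fcoeff_emb[OF u] fcoeff_emb[OF v] conv_weight_def)
    then show ?thesis
      by (simp add: fcoeff_mult sobolev_wiener[OF u r] sobolev_wiener[OF v r] conv_def convop_bound(1)[OF r]
          l2_pair_def infsum_cmult_right')
  qed
  from sobolev_embI[OF this] show "u \<cdot>\<^sub>d v \<in> sobolev r" "emb r (u \<cdot>\<^sub>d v) = convop r (emb r u) (emb r v)" by auto
qed

subsection \<open>Curves\<close>

text \<open>Since \<open>g\<close> is continuous, its integral is differentiable in norm;
  \<open>f\<close> agrees with that integral in each coordinate, hence altogether.\<close>

lemma l2_has_vector_derivativeI: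
  assumes g: "continuous_on {0..T} g"
    and d: "\<And>k t. t \<in> {0..T} \<Longrightarrow> ((\<lambda>t. cf (f t) k) has_vector_derivative cf (g t) k) (at t within {0..T})"
    and t: "t \<in> {0..T}"
  shows "(f has_vector_derivative g t) (at t within {0..T})"
proof -
  define h where "h t = f 0 + integral {0..t} g" for t
  have hd: "(h has_vector_derivative g t) (at t within {0..T})" if "t \<in> {0..T}" for t
    unfolding h_def using has_vector_derivative_add[OF has_vector_derivative_const integral_has_vector_derivative[OF g that], of "f 0"]
    by simp
  have "f t = h t" if t: "t \<in> {0..T}" for t
  proof (rule l2_eqI)
    fix k
    have "((\<lambda>t. cf (f t) k - cf (h t) k) has_vector_derivative 0) (at s within {0..T})" if "s \<in> {0..T}" for s
      using has_vector_derivative_diff[OF d[OF that] bounded_linear.has_vector_derivative[OF bounded_linear_cf hd[OF that]], of k k]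
      by simp
    then obtain c where "\<And>s. s \<in> {0..T} \<Longrightarrow> cf (f s) k - cf (h s) k = c"
      using has_vector_derivative_zero_constant[of "{0..T}"] convex_real_interval by blast
    from this[of 0] this[of t] show "cf (f t) k = cf (h t) k" using t by (auto simp: h_def)
  qed
  then show ?thesis
    using has_vector_derivative_transform[OF t, of f h "g t"] hd[OF t] by auto
qed

lemma tendsto_0_add_iff:
  fixes f g :: "'b \<Rightarrow> real"
  assumes "\<And>x. f x \<ge> 0" "\<And>x. g x \<ge> 0"
  shows "((\<lambda>x. f x + g x) \<longlongrightarrow> 0) F \<longleftrightarrow> (f \<longlongrightarrow> 0) F \<and> (g \<longlongrightarrow> 0) F"
proof
  assume h: "((\<lambda>x. f x + g x) \<longlongrightarrow> 0) F"
  show "(f \<longlongrightarrow> 0) F \<and> (g \<longlongrightarrow> 0) F"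
    using assms by (intro conjI tendsto_sandwich[OF _ _ tendsto_const h] always_eventually) auto
qed (auto intro: tendsto_eq_intros)

lemma sobolev_norm_nonneg: "sobolev_norm r u \<ge> 0"
  unfolding sobolev_norm_def by (intro real_sqrt_ge_zero mult_nonneg_nonneg infsum_nonneg) auto

text \<open>C([0,T]; H^r) in coordinates, where continuity is that of a curve in a Banach
  space.\<close>

definition H_C0 :: "real \<Rightarrow> real \<Rightarrow> (real \<Rightarrow> pdist) \<Rightarrow> bool" where
  "H_C0 r T u \<longleftrightarrow> (\<forall>t\<in>{0..T}. u t \<in> sobolev r) \<and> continuous_on {0..T} (\<lambda>t. emb r (u t))"

definition H_C1 :: "real \<Rightarrow> real \<Rightarrow> (real \<Rightarrow> pdist) \<Rightarrow> (real \<Rightarrow> pdist) \<Rightarrow> bool" where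
  "H_C1 r T u u' \<longleftrightarrow> H_C0 r T u \<and> H_C0 r T u' \<and>
     (\<forall>t\<in>{0..T}. ((\<lambda>t. emb r (u t)) has_vector_derivative emb r (u' t)) (at t within {0..T}))"

lemma sobolev_norm_tendsto_0:
  assumes "\<And>\<tau>. \<tau> \<in> S \<Longrightarrow> u \<tau> \<in> sobolev r"
  shows "((\<lambda>\<tau>. sobolev_norm r (u \<tau>)) \<longlongrightarrow> 0) (at t within S) \<longleftrightarrow> ((\<lambda>\<tau>. norm (emb r (u \<tau>))) \<longlongrightarrow> 0) (at t within S)"
proof -
  have "((\<lambda>\<tau>. sobolev_norm r (u \<tau>)) \<longlongrightarrow> 0) (at t within S) \<longleftrightarrow>
      ((\<lambda>\<tau>. sqrt (2 * pi) * norm (emb r (u \<tau>))) \<longlongrightarrow> 0) (at t within S)"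
    by (rule tendsto_cong, unfold eventually_at_filter, rule always_eventually) (simp add: sobolev_norm_emb assms)
  also have "\<dots> \<longleftrightarrow> ((\<lambda>\<tau>. norm (emb r (u \<tau>))) \<longlongrightarrow> 0) (at t within S)"
    using tendsto_mult_left_iff[of "sqrt (2 * pi)" "\<lambda>\<tau>. norm (emb r (u \<tau>))" 0 "at t within S"] by simp
  finally show ?thesis .
qed

definition real_pd :: "pdist \<Rightarrow> bool" where "real_pd u \<longleftrightarrow> pd_cnj u = u"

lemma Z_space_iff: "(u, v, w) \<in> Z_space r \<longleftrightarrow>
   u \<in> sobolev r \<and> v \<in> sobolev r \<and> w \<in> sobolev (r + 1) \<and> real_pd v \<and> real_pd w"
  by (auto simp: Z_space_def sobolev_real_def real_pd_def)

lemma Z_norm_tendsto_0: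
  "((\<lambda>\<tau>. Z_norm r (u \<tau>, v \<tau>, w \<tau>)) \<longlongrightarrow> 0) F \<longleftrightarrow>
   ((\<lambda>\<tau>. sobolev_norm r (u \<tau>)) \<longlongrightarrow> 0) F \<and> ((\<lambda>\<tau>. sobolev_norm r (v \<tau>)) \<longlongrightarrow> 0) F \<and> ((\<lambda>\<tau>. sobolev_norm (r + 1) (w \<tau>)) \<longlongrightarrow> 0) F"
  by (simp add: Z_norm_def tendsto_0_add_iff sobolev_norm_nonneg)

lemma H_C0_iff_tendsto:
  "H_C0 r T u \<longleftrightarrow> (\<forall>t\<in>{0..T}. u t \<in> sobolev r) \<and>
     (\<forall>t\<in>{0..T}. ((\<lambda>\<tau>. sobolev_norm r (u \<tau> - u t)) \<longlongrightarrow> 0) (at t within {0..T}))"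
proof (cases "\<forall>t\<in>{0..T}. u t \<in> sobolev r")
  case True
  have "((\<lambda>\<tau>. sobolev_norm r (u \<tau> - u t)) \<longlongrightarrow> 0) (at t within {0..T}) \<longleftrightarrow>
      ((\<lambda>t. emb r (u t)) \<longlongrightarrow> emb r (u t)) (at t within {0..T})" if t: "t \<in> {0..T}" for t
  proof -
    have "((\<lambda>\<tau>. sobolev_norm r (u \<tau> - u t)) \<longlongrightarrow> 0) (at t within {0..T}) \<longleftrightarrow>
        ((\<lambda>\<tau>. norm (emb r (u \<tau> - u t))) \<longlongrightarrow> 0) (at t within {0..T})"
      using True t by (intro sobolev_norm_tendsto_0 sobolev_diff) auto
    also have "\<dots> \<longleftrightarrow> ((\<lambda>\<tau>. norm (emb r (u \<tau>) - emb r (u t))) \<longlongrightarrow> 0) (at t within {0..T})"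
      using True t by (intro tendsto_cong) (auto intro!: always_eventually simp: eventually_at_filter emb_diff)
    finally show ?thesis by (simp add: tendsto_norm_zero_iff LIM_zero_iff)
  qed
  then show ?thesis using True by (simp add: H_C0_def continuous_on_def)
qed (auto simp: H_C0_def)

lemma C0_curve_Z:
  "C0_curve (Z_space r) (Z_norm r) T (\<lambda>t. (u t, v t, w t)) \<longleftrightarrow>
     H_C0 r T u \<and> H_C0 r T v \<and> H_C0 (r + 1) T w \<and>
     (\<forall>t\<in>{0..T}. real_pd (v t) \<and> real_pd (w t))"
  unfolding C0_curve_def H_C0_iff_tendsto diff_Pair Z_space_iff Z_norm_tendsto_0 by blast

lemma C1_curve_Z:
  "C1_curve (Z_space r) (Z_norm r) T (\<lambda>t. (u t, v t, w t)) (\<lambda>t. (u' t, v' t, w' t)) \<longleftrightarrow>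
     H_C1 r T u u' \<and> H_C1 r T v v' \<and> H_C1 (r + 1) T w w' \<and>
     (\<forall>t\<in>{0..T}. real_pd (v t) \<and> real_pd (w t) \<and> real_pd (v' t) \<and> real_pd (w' t))"
proof -
  have q: "((\<lambda>\<tau>. sobolev_norm r ((1 / (\<tau> - t)) *\<^sub>R (u \<tau> - u t) - u' t)) \<longlongrightarrow> 0) (at t within {0..T}) \<longleftrightarrow>
      ((\<lambda>t. emb r (u t)) has_vector_derivative emb r (u' t)) (at t within {0..T})"
    if "H_C0 r T u" "H_C0 r T u'" "t \<in> {0..T}" for r u u' t
  proof -
    note s = that[unfolded H_C0_def]
    have "((\<lambda>\<tau>. sobolev_norm r ((1 / (\<tau> - t)) *\<^sub>R (u \<tau> - u t) - u' t)) \<longlongrightarrow> 0) (at t within {0..T}) \<longleftrightarrow>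
      ((\<lambda>\<tau>. norm (emb r ((1 / (\<tau> - t)) *\<^sub>R (u \<tau> - u t) - u' t))) \<longlongrightarrow> 0) (at t within {0..T})"
      using s by (intro sobolev_norm_tendsto_0 sobolev_diff sobolev_scaleR) auto
    also have "\<dots> \<longleftrightarrow> ((\<lambda>\<tau>. norm ((1 / (\<tau> - t)) *\<^sub>R (emb r (u \<tau>) - emb r (u t)) - emb r (u' t))) \<longlongrightarrow> 0) (at t within {0..T})"
      using s by (intro tendsto_cong) (auto intro!: always_eventually simp: eventually_at_filter emb_diff emb_scaleR sobolev_diff sobolev_scaleR)
    finally show ?thesis by (simp add: has_vector_derivative_quotient)
  qed
  show ?thesis
    unfolding C1_curve_def C0_curve_Z H_C1_def diff_Pair scaleR_Pair Z_norm_tendsto_0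
    using q by blast
qed

lemma H_C0I:
  assumes "\<And>t. t \<in> {0..T} \<Longrightarrow> u t \<in> sobolev r" "continuous_on {0..T} f" "\<And>t. t \<in> {0..T} \<Longrightarrow> emb r (u t) = f t"
  shows "H_C0 r T u"
  using assms unfolding H_C0_def by (auto intro: continuous_on_eq[of _ f])

lemma
  assumes "H_C0 r T u"
  shows H_C0_mem: "t \<in> {0..T} \<Longrightarrow> u t \<in> sobolev r"
    and H_C0_cont: "continuous_on {0..T} (\<lambda>t. emb r (u t))"
  using assms by (auto simp: H_C0_def)

lemma H_C0_mono:
  assumes "H_C0 r T u" "r' \<le> r"
  shows "H_C0 r' T u"
proof (rule H_C0I)
  show "continuous_on {0..T} (\<lambda>t. lower (r - r') (emb r (u t)))"
    using assms by (intro bounded_linear.continuous_on[OF bounded_linear_lower] H_C0_cont) auto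
qed (use assms in \<open>auto intro: sobolev_mono emb_mono dest: H_C0_mem\<close>)

lemma
  assumes u: "H_C0 r T u" and v: "H_C0 r T v"
  shows H_C0_add: "H_C0 r T (\<lambda>t. u t + v t)"
    and H_C0_diff: "H_C0 r T (\<lambda>t. u t - v t)"
    and H_C0_mult: "r > 1 / 2 \<Longrightarrow> H_C0 r T (\<lambda>t. u t \<cdot>\<^sub>d v t)"
proof -
  note c = H_C0_cont[OF u] H_C0_cont[OF v]
  note m = H_C0_mem[OF u] H_C0_mem[OF v]
  show "H_C0 r T (\<lambda>t. u t + v t)"
    by (rule H_C0I[OF _ continuous_on_add[OF c]]) (blast intro: sobolev_add emb_add m)+
  show "H_C0 r T (\<lambda>t. u t - v t)"
    by (rule H_C0I[OF _ continuous_on_diff[OF c]]) (blast intro: sobolev_diff emb_diff m)+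
  show "H_C0 r T (\<lambda>t. u t \<cdot>\<^sub>d v t)" if r: "r > 1 / 2"
    by (rule H_C0I[OF _ bounded_bilinear.continuous_on[OF bounded_bilinear_convop[OF r] c]])
       (auto intro!: sobolev_mult emb_mult m r)
qed

lemma bounded_linear_mulop_const: "bounded_linear (mulop (\<lambda>_. c))"
  by (rule bounded_linear_mulop[where B = "cmod c"]) simp

lemma
  assumes u: "H_C0 r T u"
  shows H_C0_scaleR: "H_C0 r T (\<lambda>t. a *\<^sub>R u t)"
    and H_C0_scaleC: "H_C0 r T (\<lambda>t. c *\<^sub>C u t)"
    and H_C0_cnj: "H_C0 r T (\<lambda>t. pd_cnj (u t))"
    and H_C0_deriv: "r' \<le> r - 1 \<Longrightarrow> H_C0 r' T (\<lambda>t. \<partial>\<^sub>x (u t))"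
proof -
  note c = H_C0_cont[OF u] and m = H_C0_mem[OF u]
  show "H_C0 r T (\<lambda>t. a *\<^sub>R u t)"
    by (rule H_C0I[OF _ continuous_on_scaleR[OF continuous_on_const[of _ a] c]]) (blast intro: sobolev_scaleR emb_scaleR m)+
  show "H_C0 r T (\<lambda>t. c *\<^sub>C u t)"
    by (rule H_C0I[OF _ bounded_linear.continuous_on[OF bounded_linear_mulop_const c]]) (blast intro: sobolev_scaleC emb_scaleC m)+
  show "H_C0 r T (\<lambda>t. pd_cnj (u t))"
    by (rule H_C0I[OF _ bounded_linear.continuous_on[OF bounded_linear_cnjop c]]) (blast intro: sobolev_cnj emb_cnj m)+
  have "H_C0 (r - 1) T (\<lambda>t. \<partial>\<^sub>x (u t))"
    by (rule H_C0I[OF _ bounded_linear.continuous_on[OF bounded_linear_derivop c]]) (blast intro: sobolev_deriv emb_deriv m)+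
  then show "r' \<le> r - 1 \<Longrightarrow> H_C0 r' T (\<lambda>t. \<partial>\<^sub>x (u t))" by (rule H_C0_mono)
qed

lemma H_C0_uminus: "H_C0 r T u \<Longrightarrow> H_C0 r T (\<lambda>t. - u t)"
  using H_C0_scaleR[of r T u "-1"] by simp

lemma H_C0_dist_of: "continuous_on {0..T} f \<Longrightarrow> H_C0 r T (\<lambda>t. dist_of r (f t))"
  by (simp add: H_C0_def)

lemma H_C0_fcoeff:
  assumes "H_C0 r T u"
  shows "continuous_on {0..T} (\<lambda>t. fcoeff (u t) k)"
proof -
  have "continuous_on {0..T} (\<lambda>t. of_real (br k powr (- r / 2)) * cf (emb r (u t)) k)"
    using assms unfolding H_C0_def by (intro continuous_intros continuous_on_cf) auto
  then show ?thesis
    by (rule continuous_on_eq) (rule fcoeff_emb[OF H_C0_mem[OF assms], symmetric])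
qed

lemma H_C1_fcoeff:
  assumes "H_C1 r T u u'" "t \<in> {0..T}"
  shows "((\<lambda>t. fcoeff (u t) k) has_vector_derivative fcoeff (u' t) k) (at t within {0..T})"
proof -
  have d: "((\<lambda>t. emb r (u t)) has_vector_derivative emb r (u' t)) (at t within {0..T})"
    and s: "\<And>t. t \<in> {0..T} \<Longrightarrow> u t \<in> sobolev r" "\<And>t. t \<in> {0..T} \<Longrightarrow> u' t \<in> sobolev r"
    using assms by (auto simp: H_C1_def H_C0_def)
  have "((\<lambda>t. of_real (br k powr (- r / 2)) * cf (emb r (u t)) k) has_vector_derivative
      of_real (br k powr (- r / 2)) * cf (emb r (u' t)) k) (at t within {0..T})"
    by (intro has_vector_derivative_mult_right bounded_linear.has_vector_derivative[OF bounded_linear_cf d])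
  then show ?thesis
    unfolding fcoeff_emb[OF s(2)[OF assms(2)], symmetric]
    by (rule has_vector_derivative_transform[OF assms(2), rotated]) (rule fcoeff_emb[OF s(1)])
qed

text \<open>Reduces C^1 regularity to a scalar derivative in each mode plus continuity of the
  candidate derivative in H^r, so no difference quotient has to be estimated in a Sobolev
  norm.\<close>

lemma H_C1I:
  assumes u: "H_C0 r T u" and u': "H_C0 r T u'"
    and d: "\<And>k t. t \<in> {0..T} \<Longrightarrow> ((\<lambda>t. fcoeff (u t) k) has_vector_derivative fcoeff (u' t) k) (at t within {0..T})"
  shows "H_C1 r T u u'"
  unfolding H_C1_def
proof (intro conjI u u' ballI)
  fix t assume t: "t \<in> {0..T}"
  have s: "\<And>t. t \<in> {0..T} \<Longrightarrow> u t \<in> sobolev r" "\<And>t. t \<in> {0..T} \<Longrightarrow> u' t \<in> sobolev r"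
    and c: "continuous_on {0..T} (\<lambda>t. emb r (u' t))"
    using u u' by (auto simp: H_C0_def)
  show "((\<lambda>t. emb r (u t)) has_vector_derivative emb r (u' t)) (at t within {0..T})"
  proof (rule l2_has_vector_derivativeI[OF c _ t])
    fix k t assume t: "t \<in> {0..T}"
    have "((\<lambda>t. of_real (br k powr (r / 2)) * fcoeff (u t) k) has_vector_derivative
        of_real (br k powr (r / 2)) * fcoeff (u' t) k) (at t within {0..T})"
      by (intro has_vector_derivative_mult_right d t)
    then show "((\<lambda>t. cf (emb r (u t)) k) has_vector_derivative cf (emb r (u' t)) k) (at t within {0..T})"
      unfolding cf_emb[OF s(2)[OF t]]
      by (rule has_vector_derivative_transform[OF t, rotated]) (simp add: cf_emb s)
  qed
qed

lemma H_C1_mono: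
  assumes "H_C1 r T u u'" "r' \<le> r"
  shows "H_C1 r' T u u'"
  using assms H_C1_fcoeff[OF assms(1)]
  by (intro H_C1I) (auto simp: H_C1_def intro: H_C0_mono)

lemma H_C1_cnj:
  assumes "H_C1 r T u u'"
  shows "H_C1 r T (\<lambda>t. pd_cnj (u t)) (\<lambda>t. pd_cnj (u' t))"
  using assms H_C1_fcoeff[OF assms(1)]
  by (intro H_C1I) (auto simp: H_C1_def intro!: H_C0_cnj has_vector_derivative_cnj)

subsection \<open>Real distributions\<close>

lemma real_pd_iff: "real_pd u \<longleftrightarrow> (\<forall>k. cnj (fcoeff u (- k)) = fcoeff u k)"
  unfolding real_pd_def by (metis fcoeff_cnj pdist_fcoeff_eqI)

lemma real_pd_lin:
  "real_pd u \<Longrightarrow> real_pd v \<Longrightarrow> real_pd (u + v)" "real_pd u \<Longrightarrow> real_pd v \<Longrightarrow> real_pd (u - v)"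
  "real_pd u \<Longrightarrow> real_pd (- u)" "real_pd u \<Longrightarrow> real_pd (a *\<^sub>R u)" "real_pd u \<Longrightarrow> real_pd (\<partial>\<^sub>x u)"
  by (simp_all add: real_pd_iff)

lemma pd_cnj_cnj [simp]: "pd_cnj (pd_cnj u) = u"
  by (rule pdist_fcoeff_eqI) simp

lemma pd_cnj_deriv: "pd_cnj (\<partial>\<^sub>x u) = \<partial>\<^sub>x (pd_cnj u)"
  by (rule pdist_fcoeff_eqI) simp

lemma pd_cnj_mult:
  assumes "u \<in> wiener" "v \<in> wiener"
  shows "pd_cnj (u \<cdot>\<^sub>d v) = pd_cnj u \<cdot>\<^sub>d pd_cnj v"
proof (rule pdist_fcoeff_eqI)
  fix k
  have "cnj (conv (fcoeff u) (fcoeff v) (- k)) = (\<Sum>\<^sub>\<infinity>j. cnj (fcoeff u j) * cnj (fcoeff v (- k - j)))"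
    by (simp add: conv_def flip: infsum_cnj)
  also have "\<dots> = (\<Sum>\<^sub>\<infinity>j. cnj (fcoeff u (- j)) * cnj (fcoeff v (- (k - j))))"
    by (subst infsum_reindex_bij_betw[OF bij_uminus, symmetric]) simp
  finally show "fcoeff (pd_cnj (u \<cdot>\<^sub>d v)) k = fcoeff (pd_cnj u \<cdot>\<^sub>d pd_cnj v) k"
    by (simp add: fcoeff_mult assms wiener_cnj conv_def)
qed

lemma real_pd_abs2: "u \<in> wiener \<Longrightarrow> real_pd (pd_abs2 u)"
  by (simp add: real_pd_def pd_cnj_mult wiener_cnj pd_mult_commute)

text \<open>Conjugation exchanges the two products in the current. Multiplied by -\<i> the current
  is therefore real, which makes \<open>L1\<close> and \<open>L2\<close> real.\<close>

lemma pd_current_imag: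
  assumes "u \<in> wiener" "\<partial>\<^sub>x u \<in> wiener"
  shows "pd_cnj (pd_current u) = - pd_current u"
proof -
  have "\<partial>\<^sub>x (pd_cnj u) \<in> wiener" using wiener_cnj[OF assms(2)] by (simp add: pd_cnj_deriv)
  then have 1: "pd_cnj (pd_cnj u \<cdot>\<^sub>d (\<partial>\<^sub>x u)) = u \<cdot>\<^sub>d (\<partial>\<^sub>x (pd_cnj u))"
    and 2: "pd_cnj (u \<cdot>\<^sub>d (\<partial>\<^sub>x (pd_cnj u))) = pd_cnj u \<cdot>\<^sub>d (\<partial>\<^sub>x u)"
    using assms by (simp_all add: pd_cnj_mult wiener_cnj pd_cnj_deriv)
  have "pd_cnj (a - b) = pd_cnj a - pd_cnj b" for a b
    by (rule pdist_fcoeff_eqI) simp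
  then show ?thesis unfolding pd_current_def using 1 2 by simp
qed

lemma real_pd_imag_scale: "pd_cnj u = - u \<Longrightarrow> real_pd ((- \<i> * of_real a) *\<^sub>C u)"
  unfolding real_pd_iff by (metis fcoeff_cnj fcoeff_simps(3,4) complex_cnj_complex_of_real complex_cnj_i complex_cnj_minus complex_cnj_mult minus_minus mult_minus_left mult_minus_right)

section \<open>Evolution of the density\<close>

text \<open>Peetre's inequality.\<close>

lemma br_product: "br (k - j) \<le> 4 * (br k * br j)"
proof -
  have "br (k - j) \<le> 2 * (br k + br j)" using br_triangle[of "k - j" k] by simp
  moreover have "br k \<le> br k * br j" "br j \<le> br k * br j"
    using br_ge_1[of j] br_ge_1[of k] by (simp_all add: mult_le_cancel_left1 mult_le_cancel_right1)
  moreover define P where "P = br k * br j"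
  ultimately show ?thesis unfolding P_def[symmetric] distrib_left by linarith
qed

text \<open>Weight of coefficient k in the product of H^1 and H^(-1). It is bounded in j for fixed k
  but grows with k, which suffices because coefficients are used one at a time.\<close>

definition dual_weight :: "int \<Rightarrow> int \<Rightarrow> real" where
  "dual_weight k j = br j powr (- 1 / 2) * br (k - j) powr (1 / 2)"

lemma dual_weight_bound: "\<bar>dual_weight k j\<bar> \<le> (4 * br k) powr (1 / 2)" (is "?a \<le> ?b")
  and dual_weight_bound': "\<bar>dual_weight k (k - j)\<bar> \<le> (4 * br k) powr (1 / 2)"
proof -
  have "dual_weight k j \<le> (4 * br k) powr (1 / 2)" for j
  proof -
    have "br (k - j) powr (1 / 2) \<le> (4 * br k * br j) powr (1 / 2)"
      using br_product[of k j] by (intro powr_mono2) auto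
    also have "\<dots> = (4 * br k) powr (1 / 2) * br j powr (1 / 2)" by (simp add: powr_mult)
    finally have "dual_weight k j \<le> br j powr (- 1 / 2) * ((4 * br k) powr (1 / 2) * br j powr (1 / 2))"
      unfolding dual_weight_def by (intro mult_left_mono) auto
    also have "\<dots> = (4 * br k) powr (1 / 2) * (br j powr (- 1 / 2) * br j powr (1 / 2))" by simp
    also have "br j powr (- 1 / 2) * br j powr (1 / 2) = 1" by (simp flip: powr_add)
    finally show ?thesis by simp
  qed
  moreover have "dual_weight k j \<ge> 0" for j by (simp add: dual_weight_def)
  ultimately show "?a \<le> ?b" "\<bar>dual_weight k (k - j)\<bar> \<le> (4 * br k) powr (1 / 2)" by simp_all
qed

lemma conv_dual:
  assumes "u \<in> sobolev 1" "v \<in> sobolev (- 1)"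
  shows conv_dual_summable: "(\<lambda>j. fcoeff u j * fcoeff v (k - j)) summable_on UNIV"
    "conv (fcoeff u) (fcoeff v) k = l2_pair (dual_weight k) k (emb 1 u) (emb (- 1) v)"
    and conv_dual_summable': "(\<lambda>j. fcoeff v j * fcoeff u (k - j)) summable_on UNIV"
    "conv (fcoeff v) (fcoeff u) k = l2_pair (\<lambda>j. dual_weight k (k - j)) k (emb (- 1) v) (emb 1 u)"
proof -
  have e: "of_real (dual_weight k j) * (cf (emb 1 u) j * cf (emb (- 1) v) (k - j)) = fcoeff u j * fcoeff v (k - j)"
    "of_real (dual_weight k (k - j)) * (cf (emb (- 1) v) j * cf (emb 1 u) (k - j)) = fcoeff v j * fcoeff u (k - j)" for j
    using assms by (simp_all add: fcoeff_emb dual_weight_def)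
  have "(\<lambda>j. cmod (of_real (dual_weight k j) * (cf (emb 1 u) j * cf (emb (- 1) v) (k - j)))) summable_on UNIV"
    by (rule l2_pair_summable[OF dual_weight_bound])
  from abs_summable_summable[OF this] show "(\<lambda>j. fcoeff u j * fcoeff v (k - j)) summable_on UNIV"
    unfolding e .
  have "(\<lambda>j. cmod (of_real (dual_weight k (k - j)) * (cf (emb (- 1) v) j * cf (emb 1 u) (k - j)))) summable_on UNIV"
    by (rule l2_pair_summable[OF dual_weight_bound'])
  from abs_summable_summable[OF this] show "(\<lambda>j. fcoeff v j * fcoeff u (k - j)) summable_on UNIV"
    unfolding e .
  show "conv (fcoeff u) (fcoeff v) k = l2_pair (dual_weight k) k (emb 1 u) (emb (- 1) v)"
    "conv (fcoeff v) (fcoeff u) k = l2_pair (\<lambda>j. dual_weight k (k - j)) k (emb (- 1) v) (emb 1 u)"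
    unfolding conv_def l2_pair_def e by auto
qed

text \<open>Leibniz rule for one Fourier coefficient: \<open>u\<close> is continuous in H^1 while
  its difference quotients converge only in H^(-1), and the pairing of \<open>conv_dual\<close> is
  continuous in both arguments.\<close>

lemma density_derivative:
  assumes u: "H_C0 s T u" and s: "s > 1 / 2" "s \<ge> 1" and d: "H_C1 (- 1) T u u'" and t: "t \<in> {0..T}"
  shows "((\<lambda>t. fcoeff (pd_abs2 (u t)) k) has_vector_derivative
     conv (fcoeff (u t)) (fcoeff (pd_cnj (u' t))) k + conv (fcoeff (u' t)) (fcoeff (pd_cnj (u t))) k) (at t within {0..T})"
proof -
  let ?P = "l2_pair (dual_weight k) k" and ?Q = "l2_pair (\<lambda>j. dual_weight k (k - j)) k"
  interpret P: bounded_bilinear ?P by (rule bounded_bilinear_l2_pair[OF dual_weight_bound])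
  interpret Q: bounded_bilinear ?Q by (rule bounded_bilinear_l2_pair[OF dual_weight_bound'])
  have u1: "H_C0 1 T u" by (rule H_C0_mono[OF u s(2)])
  have um1: "H_C0 (- 1) T u" by (rule H_C0_mono[OF u1]) simp
  have S: "u \<tau> \<in> sobolev 1" "u \<tau> \<in> sobolev (- 1)" "u' \<tau> \<in> sobolev (- 1)"
    "pd_cnj (u \<tau>) \<in> sobolev 1" "pd_cnj (u \<tau>) \<in> sobolev (- 1)" "pd_cnj (u' \<tau>) \<in> sobolev (- 1)"
    "u \<tau> \<in> wiener" "pd_cnj (u \<tau>) \<in> wiener" if "\<tau> \<in> {0..T}" for \<tau>
  proof -
    show 1: "u \<tau> \<in> sobolev 1" "u \<tau> \<in> sobolev (- 1)" "u' \<tau> \<in> sobolev (- 1)"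
      using u1 um1 d that by (auto simp: H_C0_def H_C1_def)
    then show "pd_cnj (u \<tau>) \<in> sobolev 1" "pd_cnj (u \<tau>) \<in> sobolev (- 1)" "pd_cnj (u' \<tau>) \<in> sobolev (- 1)"
      by (auto intro: sobolev_cnj)
    show "u \<tau> \<in> wiener" "pd_cnj (u \<tau>) \<in> wiener"
      using sobolev_wiener[OF 1(1)] by (auto intro: wiener_cnj)
  qed
  define q where "q v \<tau> = (1 / (\<tau> - t)) *\<^sub>R (emb (- 1) (v \<tau>) - emb (- 1) (v t))" for v \<tau>
  have lim: "(q v \<longlongrightarrow> emb (- 1) (v' t)) (at t within {0..T})" if "H_C1 (- 1) T v v'" for v v'
    using that t unfolding H_C1_def has_vector_derivative_quotient q_def
    by (auto simp: tendsto_norm_zero_iff LIM_zero_iff)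
  have c1: "((\<lambda>\<tau>. emb 1 (u \<tau>)) \<longlongrightarrow> emb 1 (u t)) (at t within {0..T})"
    using u1 t by (auto simp: H_C0_def continuous_on_def)
  have "((\<lambda>\<tau>. ?P (emb 1 (u \<tau>)) (q (\<lambda>t. pd_cnj (u t)) \<tau>) + ?Q (q u \<tau>) (emb 1 (pd_cnj (u t)))) \<longlongrightarrow>
      ?P (emb 1 (u t)) (emb (- 1) (pd_cnj (u' t))) + ?Q (emb (- 1) (u' t)) (emb 1 (pd_cnj (u t)))) (at t within {0..T})"
    by (intro tendsto_add P.tendsto Q.tendsto c1 tendsto_const lim d H_C1_cnj)
  also have "?P (emb 1 (u t)) (emb (- 1) (pd_cnj (u' t))) + ?Q (emb (- 1) (u' t)) (emb 1 (pd_cnj (u t)))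
      = conv (fcoeff (u t)) (fcoeff (pd_cnj (u' t))) k + conv (fcoeff (u' t)) (fcoeff (pd_cnj (u t))) k"
    using S[OF t] by (simp add: conv_dual)
  finally have L: "((\<lambda>\<tau>. ?P (emb 1 (u \<tau>)) (q (\<lambda>t. pd_cnj (u t)) \<tau>) + ?Q (q u \<tau>) (emb 1 (pd_cnj (u t)))) \<longlongrightarrow>
      conv (fcoeff (u t)) (fcoeff (pd_cnj (u' t))) k + conv (fcoeff (u' t)) (fcoeff (pd_cnj (u t))) k) (at t within {0..T})" .
  \<comment> \<open>Discrete product rule: conjugates are subtracted with the first factor at time
    \<tau>, then first factors with the conjugate at time t. The mixed terms cancel because both
    pairings represent the same convolution.\<close>
  have eq: "?P (emb 1 (u \<tau>)) (q (\<lambda>t. pd_cnj (u t)) \<tau>) + ?Q (q u \<tau>) (emb 1 (pd_cnj (u t)))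
      = (1 / (\<tau> - t)) *\<^sub>R (fcoeff (pd_abs2 (u \<tau>)) k - fcoeff (pd_abs2 (u t)) k)" if \<tau>: "\<tau> \<in> {0..T}" for \<tau>
  proof -
    have a: "?P (emb 1 (u \<tau>)) (emb (- 1) (pd_cnj (u \<tau>))) = fcoeff (pd_abs2 (u \<tau>)) k"
      "?P (emb 1 (u \<tau>)) (emb (- 1) (pd_cnj (u t))) = conv (fcoeff (u \<tau>)) (fcoeff (pd_cnj (u t))) k"
      "?Q (emb (- 1) (u \<tau>)) (emb 1 (pd_cnj (u t))) = conv (fcoeff (u \<tau>)) (fcoeff (pd_cnj (u t))) k"
      "?Q (emb (- 1) (u t)) (emb 1 (pd_cnj (u t))) = fcoeff (pd_abs2 (u t)) k"
      using fcoeff_mult[OF S(7,8)[OF \<tau>], of k] fcoeff_mult[OF S(7,8)[OF t], of k]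
          conv_dual(2)[OF S(1)[OF \<tau>] S(5)[OF \<tau>], of k] conv_dual(2)[OF S(1)[OF \<tau>] S(5)[OF t], of k]
          conv_dual(4)[OF S(4)[OF t] S(2)[OF \<tau>], of k] conv_dual(4)[OF S(4)[OF t] S(2)[OF t], of k]
      by metis+
    show ?thesis
      unfolding q_def P.scaleR_right Q.scaleR_left P.diff_right Q.diff_left a
      by (simp flip: scaleR_add_right)
  qed
  have "((\<lambda>\<tau>. (1 / (\<tau> - t)) *\<^sub>R (fcoeff (pd_abs2 (u \<tau>)) k - fcoeff (pd_abs2 (u t)) k)) \<longlongrightarrow>
      conv (fcoeff (u t)) (fcoeff (pd_cnj (u' t))) k + conv (fcoeff (u' t)) (fcoeff (pd_cnj (u t))) k) (at t within {0..T})"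
    using L by (rule tendsto_cong[THEN iffD1, rotated], unfold eventually_at_filter, intro always_eventually) (use eq in blast)
  then show ?thesis
    unfolding has_vector_derivative_quotient by (simp add: tendsto_norm_zero_iff LIM_zero_iff)
qed

lemma wiener_conv_has_sum:
  assumes "u \<in> wiener" "v \<in> wiener"
  shows "((\<lambda>j. fcoeff u j * fcoeff v (k - j)) has_sum fcoeff (u \<cdot>\<^sub>d v) k) UNIV"
proof -
  have 1: "(\<lambda>j. cmod (fcoeff u j)) summable_on UNIV" using assms by (simp add: wiener_def)
  have b: "cmod (fcoeff v i) \<le> (\<Sum>\<^sub>\<infinity>j. cmod (fcoeff v j))" for i
    using finite_sum_le_infsum[of "\<lambda>j. cmod (fcoeff v j)" UNIV "{i}"] assms by (simp add: wiener_def)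
  have "(\<lambda>j. cmod (fcoeff u j * fcoeff v (k - j))) summable_on UNIV"
    by (rule summable_on_comparison_test[OF summable_on_cmult_left[OF 1, of "\<Sum>\<^sub>\<infinity>j. cmod (fcoeff v j)"]])
       (auto simp: norm_mult intro!: mult_left_mono b)
  from has_sum_infsum[OF abs_summable_summable[OF this]] show ?thesis
    by (simp add: fcoeff_mult[OF assms] conv_def)
qed

lemma has_sum_diff:
  fixes f g :: "'a \<Rightarrow> complex"
  assumes "(f has_sum a) A" "(g has_sum b) A"
  shows "((\<lambda>x. f x - g x) has_sum (a - b)) A"
  using has_sum_add[OF assms(1) has_sum_uminusI[OF assms(2)]] by simp

text \<open>The potential \<open>B\<close> cancels because it is real.\<close>

lemma density_flux:
  assumes u: "u \<in> sobolev s" and s: "s > 3 / 2" and B: "B \<in> wiener" "real_pd B" and u': "u' \<in> sobolev (- 1)"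
    and eq: "u' = a *\<^sub>R (\<partial>\<^sub>x u) + (\<i> * of_real b) *\<^sub>C (\<partial>\<^sub>x (\<partial>\<^sub>x u)) - (\<i> * of_real e) *\<^sub>C (B \<cdot>\<^sub>d u)"
  shows "conv (fcoeff u) (fcoeff (pd_cnj u')) k + conv (fcoeff u') (fcoeff (pd_cnj u)) k
     = \<i> * of_int k * (of_real a * fcoeff (pd_abs2 u) k + \<i> * of_real b * fcoeff (pd_current u) k)"
proof -
  define c where "c = pd_cnj u"
  have w: "u \<in> wiener" "\<partial>\<^sub>x u \<in> wiener" using sobolev_wiener[OF u] sobolev_wiener[OF sobolev_deriv[OF u]] s by auto
  have cw: "c \<in> wiener" "\<partial>\<^sub>x c \<in> wiener" using wiener_cnj[OF w(1)] wiener_cnj[OF w(2)] by (auto simp: c_def pd_cnj_deriv)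
  have u1: "u \<in> sobolev 1" "c \<in> sobolev 1" unfolding c_def using sobolev_mono[OF u] s by (auto intro: sobolev_cnj)
  have cB: "pd_cnj (B \<cdot>\<^sub>d u) = B \<cdot>\<^sub>d c" using B by (simp add: pd_cnj_mult w real_pd_def c_def)
  have fu': "fcoeff u' j = of_real a * (\<i> * of_int j * fcoeff u j) + \<i> * of_real b * (\<i> * of_int j * (\<i> * of_int j * fcoeff u j))
      - \<i> * of_real e * fcoeff (B \<cdot>\<^sub>d u) j" for j
    by (simp add: eq)
  have fc': "fcoeff (pd_cnj u') m = of_real a * (\<i> * of_int m * fcoeff c m) - \<i> * of_real b * (\<i> * of_int m * (\<i> * of_int m * fcoeff c m))
      + \<i> * of_real e * fcoeff (B \<cdot>\<^sub>d c) m" for m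
  proof -
    have "cnj (fcoeff (B \<cdot>\<^sub>d u) (- m)) = fcoeff (B \<cdot>\<^sub>d c) m"
      using arg_cong[OF cB, of "\<lambda>v. fcoeff v m"] by simp
    then show ?thesis by (simp add: fu' c_def)
  qed
  have h1: "((\<lambda>j. fcoeff u j * fcoeff (pd_cnj u') (k - j)) has_sum conv (fcoeff u) (fcoeff (pd_cnj u')) k) UNIV"
    unfolding conv_def by (intro has_sum_infsum conv_dual_summable u1 sobolev_cnj u')
  have h2: "((\<lambda>j. fcoeff u' j * fcoeff c (k - j)) has_sum conv (fcoeff u') (fcoeff c) k) UNIV"
    unfolding conv_def by (intro has_sum_infsum conv_dual_summable' u1 u')
  \<comment> \<open>By commutativity and associativity this sum and the one in \<open>h4\<close>
    have the same total, so the contributions of \<open>B\<close> cancel.\<close>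
  have h3: "((\<lambda>j. fcoeff u j * fcoeff (B \<cdot>\<^sub>d c) (k - j)) has_sum fcoeff (u \<cdot>\<^sub>d (B \<cdot>\<^sub>d c)) k) UNIV"
    by (intro wiener_conv_has_sum wiener_mult w cw B)
  have "u \<cdot>\<^sub>d (B \<cdot>\<^sub>d c) = (B \<cdot>\<^sub>d u) \<cdot>\<^sub>d c"
    by (simp add: pd_mult_assoc[OF w(1) B(1) cw(1), symmetric] pd_mult_commute[of u B])
  then have h4: "((\<lambda>j. fcoeff (B \<cdot>\<^sub>d u) j * fcoeff c (k - j)) has_sum fcoeff (u \<cdot>\<^sub>d (B \<cdot>\<^sub>d c)) k) UNIV"
    using wiener_conv_has_sum[OF wiener_mult[OF B(1) w(1)] cw(1), of k] by simp
  have h5: "((\<lambda>j. fcoeff u j * fcoeff c (k - j)) has_sum fcoeff (pd_abs2 u) k) UNIV"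
    unfolding c_def[symmetric] by (intro wiener_conv_has_sum w cw)
  have J: "pd_current u = (\<partial>\<^sub>x u) \<cdot>\<^sub>d c - u \<cdot>\<^sub>d (\<partial>\<^sub>x c)"
    by (simp add: pd_current_def c_def pd_mult_commute[of "pd_cnj u"])
  have h6: "((\<lambda>j. fcoeff (\<partial>\<^sub>x u) j * fcoeff c (k - j) - fcoeff u j * fcoeff (\<partial>\<^sub>x c) (k - j)) has_sum fcoeff (pd_current u) k) UNIV"
    unfolding J fcoeff_simps by (intro has_sum_diff wiener_conv_has_sum w cw)
  have "((\<lambda>j. fcoeff u j * fcoeff (pd_cnj u') (k - j) + fcoeff u' j * fcoeff c (k - j)
        - (\<i> * of_real e) * (fcoeff u j * fcoeff (B \<cdot>\<^sub>d c) (k - j) - fcoeff (B \<cdot>\<^sub>d u) j * fcoeff c (k - j))) has_sum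
      (conv (fcoeff u) (fcoeff (pd_cnj u')) k + conv (fcoeff u') (fcoeff c) k
        - (\<i> * of_real e) * (fcoeff (u \<cdot>\<^sub>d (B \<cdot>\<^sub>d c)) k - fcoeff (u \<cdot>\<^sub>d (B \<cdot>\<^sub>d c)) k))) UNIV"
    by (intro has_sum_diff has_sum_add has_sum_cmult_right h1 h2 h3 h4)
  moreover have "((\<lambda>j. \<i> * of_int k * (of_real a * (fcoeff u j * fcoeff c (k - j))
        + \<i> * of_real b * (fcoeff (\<partial>\<^sub>x u) j * fcoeff c (k - j) - fcoeff u j * fcoeff (\<partial>\<^sub>x c) (k - j)))) has_sum
      \<i> * of_int k * (of_real a * fcoeff (pd_abs2 u) k + \<i> * of_real b * fcoeff (pd_current u) k)) UNIV"
    by (intro has_sum_add has_sum_cmult_right h5 h6)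
  \<comment> \<open>The overall factor k comes from j + (k - j) = k in the first-order terms and
    from j^2 - (k - j)^2 = k (j - (k - j)) in the second-order ones.\<close>
  moreover have "fcoeff u j * fcoeff (pd_cnj u') (k - j) + fcoeff u' j * fcoeff c (k - j)
        - (\<i> * of_real e) * (fcoeff u j * fcoeff (B \<cdot>\<^sub>d c) (k - j) - fcoeff (B \<cdot>\<^sub>d u) j * fcoeff c (k - j))
      = \<i> * of_int k * (of_real a * (fcoeff u j * fcoeff c (k - j))
        + \<i> * of_real b * (fcoeff (\<partial>\<^sub>x u) j * fcoeff c (k - j) - fcoeff u j * fcoeff (\<partial>\<^sub>x c) (k - j)))" for j
    unfolding fu' fc' fcoeff_deriv by (simp add: algebra_simps)
  ultimately show ?thesis
    unfolding c_def[symmetric] by (simp add: has_sum_unique)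
qed

section \<open>The modified Zakharov-Rubenchik system\<close>

lemma cis_has_vector_derivative:
  "((\<lambda>t. cis (a * t)) has_vector_derivative \<i> * of_real a * cis (a * t)) (at t within S)"
proof -
  have "((\<lambda>z. exp (\<i> * of_real a * z)) has_field_derivative \<i> * of_real a * exp (\<i> * of_real a * of_real t)) (at (of_real t))"
    by (auto intro!: derivative_eq_intros)
  from has_vector_derivative_real_field[OF this] show ?thesis
    by (auto simp: cis_conv_exp mult.assoc intro: has_vector_derivative_at_within)
qed

lemma linear_ode_cis:
  fixes f :: "real \<Rightarrow> complex"
  assumes d: "\<And>t. t \<in> {0..T} \<Longrightarrow> (f has_vector_derivative \<i> * of_real a * f t) (at t within {0..T})" and t: "t \<in> {0..T}"
  shows "f t = cis (a * t) * f 0"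
proof -
  have "((\<lambda>t. cis (- a * t) * f t) has_vector_derivative 0) (at t within {0..T})" if "t \<in> {0..T}" for t
    using has_vector_derivative_mult[OF cis_has_vector_derivative[of "- a" t "{0..T}"] d[OF that]]
    by (simp add: algebra_simps)
  then obtain c where c: "\<And>t. t \<in> {0..T} \<Longrightarrow> cis (- a * t) * f t = c"
    using has_vector_derivative_zero_constant[of "{0..T}"] convex_real_interval by blast
  have "cis (a * t) * (cis (- a * t) * f t) = cis (a * t) * f 0"
    using c[of 0] c[OF t] t by simp
  then show ?thesis by (simp add: mult.assoc[symmetric] cis_mult)
qed

text \<open>The heart of the choice of corrections, for one mode with \<open>K\<close> = \<i> k. The
  terms in \<open>J\<close> cancel because \<open>L1\<close> and \<open>L2\<close> carry
  \<open>a1\<close> and \<open>a2\<close> as factors. The terms in \<open>n\<close> are rewritten by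
  the two relations for \<open>a1\<close>, \<open>a2\<close>: the first turns - D - s3 a1 into a2 /
  M, the second turns - 1 - s3 a2 / M into a1 / M^2.\<close>

lemma wave_algebra:
  fixes K :: complex
  assumes M: "M \<noteq> 0" and a: "a2 + M * D = - s3 * M * a1" "a1 + M * M = - s3 * M * a2"
    and \<rho>t: "\<rho>t = - (K * (K * \<phi>)) - D * (K * n) - e * ((- \<i> * d * a1) * (K * J))"
    and \<phi>t: "\<phi>t = - (1 / M\<^sup>2 * \<rho>) - n - e * ((- (\<i> / M) * d * a2) * J)"
    and nt: "nt = K * (s3 * n + \<i> * (e * d) * J)"
  shows "\<rho>t - a1 * nt = - (K * (K * \<phi> - a2 / M * n))"
    and "K * \<phi>t - a2 / M * nt = - (K / M\<^sup>2 * (\<rho> - a1 * n))"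
proof -
  have "D = (M * D) / M" using M by simp
  also have "M * D = - a2 - M * (s3 * a1)" using a(1) by algebra
  finally have D: "D = - a2 / M - s3 * a1" using M by (simp add: diff_divide_distrib)
  show "\<rho>t - a1 * nt = - (K * (K * \<phi> - a2 / M * n))"
    unfolding \<rho>t nt D by (simp add: algebra_simps)
  define r where "r = 1 / M"
  have r: "M * r = 1" using M by (simp add: r_def)
  have e: "1 / M\<^sup>2 = r * r" "\<i> / M = \<i> * r" "a2 / M = a2 * r" "K / M\<^sup>2 = K * (r * r)"
    by (simp_all add: r_def power2_eq_square)
  show "K * \<phi>t - a2 / M * nt = - (K / M\<^sup>2 * (\<rho> - a1 * n))"
    unfolding \<phi>t nt e using r a(2) by algebra
qed

text \<open>Coordinate form of the antiderivative from H^s to H^(s+1). Division by zero gives 0 at k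
  = 0, so the result has mean zero; the bound 2 holds since \<open>br k\<close> is at most 4 k^2 for
  k \<noteq> 0.\<close>

definition antiop :: "l2 \<Rightarrow> l2" where
  "antiop = mulop (\<lambda>k. of_real (br k powr (1 / 2)) / (\<i> * of_int k))"

lemma anti_weight_le: "cmod (of_real (br k powr (1 / 2)) / (\<i> * of_int k)) \<le> 2"
proof (cases "k = 0")
  case False
  then have "1 \<le> \<bar>real_of_int k\<bar>" by linarith
  then have "1 \<le> \<bar>real_of_int k\<bar>\<^sup>2" by (simp only: one_le_power)
  then have "br k \<le> (2 * \<bar>real_of_int k\<bar>)\<^sup>2"
    unfolding br_def power_mult_distrib power2_abs by simp
  then have "sqrt (br k) \<le> 2 * \<bar>real_of_int k\<bar>" by (intro real_le_lsqrt) auto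
  then show ?thesis using False by (simp add: norm_divide norm_mult powr_half_sqrt divide_simps)
qed simp

lemma bounded_linear_antiop: "bounded_linear antiop"
  unfolding antiop_def by (rule bounded_linear_mulop[OF anti_weight_le])

lemma cf_antiop: "cf (antiop x) k = of_real (br k powr (1 / 2)) / (\<i> * of_int k) * cf x k"
  unfolding antiop_def by (rule mulop_bound(1)[OF anti_weight_le])

text \<open>The data are fixed but \<epsilon> is not, so every constant defined here without an
  \<epsilon> argument is independent of it.\<close>

locale mZR =
  fixes s M \<sigma>2 \<sigma>3 \<delta> D W \<alpha>1 \<alpha>2 :: real and \<psi>0 \<rho>0 \<phi>0 :: pdist
  assumes s: "s > 3 / 2" and M: "M > 0" and alpha: "alpha_system M \<sigma>3 D \<alpha>1 \<alpha>2"
    and data: "(\<psi>0, \<rho>0, \<phi>0) \<in> Z_space s"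
begin

lemma alpha_complex:
  "complex_of_real M \<noteq> 0"
  "complex_of_real \<alpha>2 + of_real M * of_real D = - of_real \<sigma>3 * of_real M * of_real \<alpha>1"
  "complex_of_real \<alpha>1 + of_real M * of_real M = - of_real \<sigma>3 * of_real M * of_real \<alpha>2"
proof -
  have "\<alpha>2 + M * D = - \<sigma>3 * M * \<alpha>1" "\<alpha>1 + M * M = - \<sigma>3 * M * \<alpha>2"
    using alpha M unfolding alpha_system_def by (simp_all add: field_simps)
  then show "complex_of_real M \<noteq> 0"
    "complex_of_real \<alpha>2 + of_real M * of_real D = - of_real \<sigma>3 * of_real M * of_real \<alpha>1"
    "complex_of_real \<alpha>1 + of_real M * of_real M = - of_real \<sigma>3 * of_real M * of_real \<alpha>2"
    using M by (simp_all flip: of_real_mult of_real_add of_real_minus)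
qed

lemma data_mem: "\<psi>0 \<in> sobolev s" "\<rho>0 \<in> sobolev s" "\<phi>0 \<in> sobolev (s + 1)" "real_pd \<rho>0" "real_pd \<phi>0"
  using data by (auto simp: Z_space_iff)

lemma abs2_mem: "\<psi> \<in> sobolev s \<Longrightarrow> pd_abs2 \<psi> \<in> sobolev s"
  using s by (intro sobolev_mult sobolev_cnj) auto

lemma mem_wiener: "u \<in> sobolev s \<Longrightarrow> u \<in> wiener"
  using s by (auto intro: sobolev_wiener)

lemma deriv_wiener: "u \<in> sobolev s \<Longrightarrow> \<partial>\<^sub>x u \<in> wiener"
  using s by (auto intro: sobolev_wiener[OF sobolev_deriv])

lemma dphi_mem: "\<phi> \<in> sobolev (s + 1) \<Longrightarrow> \<partial>\<^sub>x \<phi> \<in> sobolev s"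
  using sobolev_deriv[of \<phi> "s + 1"] by simp

text \<open>\<open>riemann m\<close> for \<open>m = M\<close> and \<open>m = - M\<close> are the Riemann invariants of the wave equation
  satisfied by \<open>\<rho> - \<alpha>1 |\<psi>|\<^sup>2\<close> and \<open>\<phi>\<^sub>x - (\<alpha>2 / M) |\<psi>|\<^sup>2\<close>.\<close>

definition riemann :: "real \<Rightarrow> pdist \<Rightarrow> pdist \<Rightarrow> pdist \<Rightarrow> pdist" where
  "riemann m \<psi> \<rho> \<phi> = \<rho> - \<alpha>1 *\<^sub>R pd_abs2 \<psi> + m *\<^sub>R (\<partial>\<^sub>x \<phi> - (\<alpha>2 / M) *\<^sub>R pd_abs2 \<psi>)"

text \<open>The invariant for \<open>m\<close> is transported at speed 1 / m; this is its value at
  time \<open>t\<close> as determined by the data alone, in H^s coordinates.\<close>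

definition rinv :: "real \<Rightarrow> real \<Rightarrow> l2" where
  "rinv m t = phase (\<lambda>k. - of_int k / m) t (emb s (riemann m \<psi>0 \<rho>0 \<phi>0))"

definition rho_wave :: "real \<Rightarrow> l2" where "rho_wave t = (1 / 2) *\<^sub>R (rinv M t + rinv (- M) t)"
definition u_wave :: "real \<Rightarrow> l2" where "u_wave t = (1 / (2 * M)) *\<^sub>R (rinv M t - rinv (- M) t)"
definition potential :: "real \<Rightarrow> l2" where "potential t = W *\<^sub>R (rho_wave t + D *\<^sub>R u_wave t)"
text \<open>Effective cubic coefficient, obtained by inserting the density parts of
  \<open>\<rho>\<close> and of the x-derivative of \<open>\<phi>\<close> into the potential.\<close>

definition \<kappa> :: real where "\<kappa> = \<sigma>2 + W * (\<alpha>1 + D * \<alpha>2 / M)"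

lemma riemann_mem: "riemann m \<psi>0 \<rho>0 \<phi>0 \<in> sobolev s"
  unfolding riemann_def by (intro sobolev_add sobolev_diff sobolev_scaleR data_mem abs2_mem dphi_mem)

lemma riemann_real: "real_pd (riemann m \<psi>0 \<rho>0 \<phi>0)"
  unfolding riemann_def by (intro real_pd_lin data_mem real_pd_abs2 mem_wiener)

lemma continuous_waves:
  "continuous_on S rho_wave" "continuous_on S u_wave" "continuous_on S potential"
proof -
  have "continuous_on S (rinv m)" for m
    unfolding rinv_def by (intro continuous_on_phase continuous_on_const continuous_on_id)
  then show 1: "continuous_on S rho_wave" and 2: "continuous_on S u_wave"
    unfolding rho_wave_def u_wave_def by (auto intro!: continuous_intros)
  then show "continuous_on S potential" unfolding potential_def by (intro continuous_intros)
qed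

lemma fcoeff_waves:
  "fcoeff (dist_of s (rho_wave t)) k = (1 / 2) * (cis (- of_int k / M * t) * fcoeff (riemann M \<psi>0 \<rho>0 \<phi>0) k
      + cis (of_int k / M * t) * fcoeff (riemann (- M) \<psi>0 \<rho>0 \<phi>0) k)"
  "fcoeff (dist_of s (u_wave t)) k = (1 / (2 * of_real M)) * (cis (- of_int k / M * t) * fcoeff (riemann M \<psi>0 \<rho>0 \<phi>0) k
      - cis (of_int k / M * t) * fcoeff (riemann (- M) \<psi>0 \<rho>0 \<phi>0) k)"
  unfolding fcoeff_dist_of rho_wave_def u_wave_def rinv_def fcoeff_emb[OF riemann_mem]
  by (simp_all add: algebra_simps)

lemma fcoeff_potential:
  "fcoeff (dist_of s (potential t)) k =
     of_real W * (fcoeff (dist_of s (rho_wave t)) k + of_real D * fcoeff (dist_of s (u_wave t)) k)"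
  by (simp add: fcoeff_dist_of potential_def algebra_simps)

text \<open>Makes the potential real, as \<open>density_flux\<close> requires.\<close>

lemma waves_real: "real_pd (dist_of s (rho_wave t))" "real_pd (dist_of s (u_wave t))" "real_pd (dist_of s (potential t))"
proof -
  have c: "cnj (fcoeff (riemann m \<psi>0 \<rho>0 \<phi>0) (- k)) = fcoeff (riemann m \<psi>0 \<rho>0 \<phi>0) k" for m k
    using riemann_real unfolding real_pd_iff by blast
  show 1: "real_pd (dist_of s (rho_wave t))" and 2: "real_pd (dist_of s (u_wave t))"
    unfolding real_pd_iff fcoeff_waves by (simp_all add: c cis_cnj)
  then show "real_pd (dist_of s (potential t))"
    unfolding real_pd_iff fcoeff_potential by simp
qed

lemma waves_derivative:
  "((\<lambda>t. fcoeff (dist_of s (rho_wave t)) k) has_vector_derivative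
      - (\<i> * of_int k * fcoeff (dist_of s (u_wave t)) k)) (at t within S)"
  "((\<lambda>t. fcoeff (dist_of s (u_wave t)) k) has_vector_derivative
      - (\<i> * of_int k / (of_real M)\<^sup>2 * fcoeff (dist_of s (rho_wave t)) k)) (at t within S)"
proof -
  note c = cis_has_vector_derivative[of "- of_int k / M" t S] cis_has_vector_derivative[of "of_int k / M" t S]
  have M0: "complex_of_real M \<noteq> 0" using M by simp
  show "((\<lambda>t. fcoeff (dist_of s (rho_wave t)) k) has_vector_derivative
      - (\<i> * of_int k * fcoeff (dist_of s (u_wave t)) k)) (at t within S)"
    unfolding fcoeff_waves
    by (rule has_vector_derivative_eq_rhs, rule has_vector_derivative_mult_right,
        rule has_vector_derivative_add[OF has_vector_derivative_mult_left[OF c(1)] has_vector_derivative_mult_left[OF c(2)]])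
       (use M0 in \<open>simp add: field_simps\<close>)
  show "((\<lambda>t. fcoeff (dist_of s (u_wave t)) k) has_vector_derivative
      - (\<i> * of_int k / (of_real M)\<^sup>2 * fcoeff (dist_of s (rho_wave t)) k)) (at t within S)"
    unfolding fcoeff_waves
    by (rule has_vector_derivative_eq_rhs, rule has_vector_derivative_mult_right,
        rule has_vector_derivative_diff[OF has_vector_derivative_mult_left[OF c(1)] has_vector_derivative_mult_left[OF c(2)]])
       (use M0 in \<open>simp add: field_simps power2_eq_square\<close>)
qed

lemma waves_initial:
  "dist_of s (rho_wave 0) = \<rho>0 - \<alpha>1 *\<^sub>R pd_abs2 \<psi>0"
  "dist_of s (u_wave 0) = \<partial>\<^sub>x \<phi>0 - (\<alpha>2 / M) *\<^sub>R pd_abs2 \<psi>0"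
  using M by (auto intro!: pdist_fcoeff_eqI simp: fcoeff_waves riemann_def field_simps)

section \<open>The reduced Schroedinger nonlinearity and its Lipschitz constant\<close>

definition pot :: "real \<Rightarrow> pdist \<Rightarrow> pdist" where
  "pot t \<psi> = \<kappa> *\<^sub>R pd_abs2 \<psi> + dist_of s (potential t)"

lemma pot_eq:
  assumes "\<rho> = \<alpha>1 *\<^sub>R pd_abs2 \<psi> + dist_of s (rho_wave t)" "\<partial>\<^sub>x \<phi> = (\<alpha>2 / M) *\<^sub>R pd_abs2 \<psi> + dist_of s (u_wave t)"
  shows "\<sigma>2 *\<^sub>R pd_abs2 \<psi> + W *\<^sub>R (\<rho> + D *\<^sub>R (\<partial>\<^sub>x \<phi>)) = pot t \<psi>"
  unfolding assms by (rule pdist_fcoeff_eqI) (simp add: pot_def \<kappa>_def fcoeff_potential algebra_simps)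

text \<open>Coordinate form of the product of \<open>pot t \<psi>\<close> with
  \<open>\<psi>\<close>, as \<open>pot_mem\<close> shows. It loses no derivative, since it uses only
  products in the algebra H^s.\<close>

definition F :: "real \<Rightarrow> l2 \<Rightarrow> l2" where
  "F t x = convop s (\<kappa> *\<^sub>R convop s x (cnjop x) + potential t) x"

lemma pot_mem:
  assumes "\<psi> \<in> sobolev s"
  shows "pot t \<psi> \<in> sobolev s" "real_pd (pot t \<psi>)" "pot t \<psi> \<cdot>\<^sub>d \<psi> \<in> sobolev s" "emb s (pot t \<psi> \<cdot>\<^sub>d \<psi>) = F t (emb s \<psi>)"
proof -
  have s2: "s > 1 / 2" using s by simp
  note a = abs2_mem[OF assms]
  show 1: "pot t \<psi> \<in> sobolev s" unfolding pot_def by (intro sobolev_add sobolev_scaleR a dist_of_sobolev)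
  show "real_pd (pot t \<psi>)" unfolding pot_def by (intro real_pd_lin real_pd_abs2 waves_real mem_wiener assms)
  show "pot t \<psi> \<cdot>\<^sub>d \<psi> \<in> sobolev s" by (intro sobolev_mult 1 assms s2)
  have "emb s (pot t \<psi>) = \<kappa> *\<^sub>R convop s (emb s \<psi>) (cnjop (emb s \<psi>)) + potential t"
    unfolding pot_def
    by (simp add: emb_add emb_scaleR sobolev_scaleR a emb_mult[OF assms sobolev_cnj[OF assms] s2] emb_cnj assms)
  then show "emb s (pot t \<psi> \<cdot>\<^sub>d \<psi>) = F t (emb s \<psi>)"
    by (simp add: emb_mult[OF 1 assms s2] F_def)
qed

definition pot_bound :: real where
  "pot_bound = \<bar>W\<bar> * (1 / 2 * (norm (rinv M 0) + norm (rinv (- M) 0))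
     + \<bar>D\<bar> * (1 / (2 * M) * (norm (rinv M 0) + norm (rinv (- M) 0))))"

text \<open>Transport is an isometry of H^s, so the bound at time 0 holds for all times, in
  particular up to times of order 1 / \<epsilon>.\<close>

lemma norm_potential: "norm (potential t) \<le> pot_bound"
proof -
  have n: "norm (rinv m t) = norm (rinv m 0)" for m by (simp add: rinv_def)
  have 1: "norm (rho_wave t) \<le> 1 / 2 * (norm (rinv M 0) + norm (rinv (- M) 0))"
    using norm_triangle_ineq[of "rinv M t" "rinv (- M) t"] unfolding n by (simp add: rho_wave_def)
  have 2: "norm (u_wave t) \<le> 1 / (2 * M) * (norm (rinv M 0) + norm (rinv (- M) 0))"
    using mult_left_mono[OF norm_triangle_ineq4[of "rinv M t" "rinv (- M) t"], of "1 / (2 * M)"] M unfolding n by (simp add: u_wave_def)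
  have "norm (rho_wave t + D *\<^sub>R u_wave t) \<le> norm (rho_wave t) + \<bar>D\<bar> * norm (u_wave t)"
    using norm_triangle_ineq[of "rho_wave t" "D *\<^sub>R u_wave t"] by simp
  also have "\<dots> \<le> 1 / 2 * (norm (rinv M 0) + norm (rinv (- M) 0)) + \<bar>D\<bar> * (1 / (2 * M) * (norm (rinv M 0) + norm (rinv (- M) 0)))"
    by (intro add_mono mult_left_mono 1 2) auto
  finally show ?thesis unfolding potential_def pot_bound_def by (simp only: norm_scaleR) (intro mult_left_mono; simp)
qed

lemma pot_bound_nonneg: "pot_bound \<ge> 0"
  using norm_potential[of 0] norm_ge_zero[of "potential 0"] by linarith

text \<open>The factor 3 counts the places where a cubic term can vary: the outer factor and the two
  factors of the density.\<close>

definition lipF :: "real \<Rightarrow> real" where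
  "lipF R = conv_const s * pot_bound + 3 * (conv_const s)\<^sup>2 * \<bar>\<kappa>\<bar> * R\<^sup>2"

lemma F_estimates:
  assumes x: "norm x \<le> R" and y: "norm y \<le> R"
  shows "norm (F t x - F t y) \<le> lipF R * norm (x - y)" "norm (F t x) \<le> lipF R * R" "lipF R \<ge> 0"
proof -
  have s2: "s > 1 / 2" using s by simp
  define C where "C = conv_const s"
  have C: "C \<ge> 0" by (simp add: C_def conv_const_sq)
  have R: "R \<ge> 0" using x norm_ge_zero[of x] by linarith
  interpret c: bounded_bilinear "convop s" by (rule bounded_bilinear_convop[OF s2])
  have b: "norm (convop s v w) \<le> C * (A * B)" if "norm v \<le> A" "norm w \<le> B" for v w A B
  proof -
    have "norm v * norm w \<le> A * B"
      using that by (intro mult_mono) (auto intro: order_trans[OF norm_ge_zero])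
    then show ?thesis using convop_bound(2)[OF s2, of v w] C mult_left_mono[of "norm v * norm w" "A * B" C]
      by (simp add: C_def)
  qed
  define d where "d = norm (x - y)"
  have e1: "norm (\<kappa> *\<^sub>R convop s x (cnjop x) + potential t) \<le> \<bar>\<kappa>\<bar> * (C * (R * R)) + pot_bound"
    using norm_triangle_ineq[of "\<kappa> *\<^sub>R convop s x (cnjop x)" "potential t"] norm_potential[of t]
      mult_left_mono[OF b[of x R "cnjop x" R], of "\<bar>\<kappa>\<bar>"] x by simp
  have e2: "norm (convop s x (cnjop x - cnjop y) + convop s (x - y) (cnjop y)) \<le> C * (R * d) + C * (d * R)"
    by (intro norm_triangle_le add_mono b) (auto simp: d_def x y simp flip: cnjop_diff)
  have e3: "norm (\<kappa> *\<^sub>R (convop s x (cnjop x - cnjop y) + convop s (x - y) (cnjop y))) \<le> \<bar>\<kappa>\<bar> * (C * (R * d) + C * (d * R))"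
    unfolding norm_scaleR by (intro mult_left_mono e2) auto
  have "F t x - F t y = convop s (\<kappa> *\<^sub>R convop s x (cnjop x) + potential t) (x - y)
      + convop s (\<kappa> *\<^sub>R (convop s x (cnjop x - cnjop y) + convop s (x - y) (cnjop y))) y"
    unfolding F_def by (simp add: c.add_left c.add_right c.diff_left c.diff_right c.scaleR_left c.scaleR_right scaleR_diff_right scaleR_add_right)
  also have "norm \<dots> \<le> C * ((\<bar>\<kappa>\<bar> * (C * (R * R)) + pot_bound) * d) + C * ((\<bar>\<kappa>\<bar> * (C * (R * d) + C * (d * R))) * R)"
    by (rule norm_triangle_le[OF add_mono[OF b[OF e1 eq_refl[OF d_def[symmetric]]] b[OF e3 y]]])
  also have "\<dots> = lipF R * d" by (simp add: lipF_def C_def algebra_simps power2_eq_square)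
  finally show "norm (F t x - F t y) \<le> lipF R * norm (x - y)" by (simp add: d_def)
  show "lipF R \<ge> 0" unfolding lipF_def using pot_bound_nonneg conv_const_sq(2)[of s] by (intro add_nonneg_nonneg mult_nonneg_nonneg) auto
  have "norm (F t x) \<le> C * ((\<bar>\<kappa>\<bar> * (C * (R * R)) + pot_bound) * R)"
    unfolding F_def by (intro b e1 x)
  also have "\<dots> \<le> C * ((3 * (\<bar>\<kappa>\<bar> * (C * (R * R))) + pot_bound) * R)"
    using C R by (intro mult_left_mono mult_right_mono add_right_mono) (auto intro!: mult_nonneg_nonneg)
  also have "\<dots> = lipF R * R" by (simp add: lipF_def C_def algebra_simps power2_eq_square)
  finally show "norm (F t x) \<le> lipF R * R" .
qed

section \<open>The interaction picture and the existence time\<close>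

definition disp :: "real \<Rightarrow> int \<Rightarrow> real" where
  "disp \<epsilon> k = \<sigma>3 * of_int k - \<epsilon> * \<delta> * (of_int k)\<^sup>2"

text \<open>Right-hand side of the equation for \<open>\<psi>\<close> after conjugation with the
  linear group: \<i> times \<open>disp \<epsilon>\<close> is the symbol of the linear part, and what
  remains carries the whole factor \<epsilon>.\<close>

definition G :: "real \<Rightarrow> real \<Rightarrow> l2 \<Rightarrow> l2" where
  "G \<epsilon> t x = mulop (\<lambda>_. - \<i> * of_real \<epsilon>) (phase (disp \<epsilon>) (- t) (F t (phase (disp \<epsilon>) t x)))"

lemma cf_G: "cf (G \<epsilon> t x) k = - \<i> * of_real \<epsilon> * (cis (- disp \<epsilon> k * t) * cf (F t (phase (disp \<epsilon>) t x)) k)"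
  by (simp add: G_def cf_mulop_const)

lemma norm_mulop_eps: "norm (mulop (\<lambda>_. - \<i> * of_real \<epsilon>) x) \<le> \<bar>\<epsilon>\<bar> * norm x"
  by (rule mulop_bound(2)) (simp add: norm_mult)

lemma G_estimates:
  assumes x: "norm x \<le> R" and y: "norm y \<le> R"
  shows "norm (G \<epsilon> t x - G \<epsilon> t y) \<le> (\<bar>\<epsilon>\<bar> * lipF R) * norm (x - y)" "norm (G \<epsilon> t x) \<le> \<bar>\<epsilon>\<bar> * (lipF R * R)"
proof -
  let ?U = "phase (disp \<epsilon>)"
  have "G \<epsilon> t x - G \<epsilon> t y = mulop (\<lambda>_. - \<i> * of_real \<epsilon>) (?U (- t) (F t (?U t x) - F t (?U t y)))"
    by (intro l2_eqI) (simp add: cf_G cf_mulop_const algebra_simps)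
  also have "norm \<dots> \<le> \<bar>\<epsilon>\<bar> * norm (F t (?U t x) - F t (?U t y))"
    using norm_mulop_eps[of \<epsilon> "?U (- t) (F t (?U t x) - F t (?U t y))"] by simp
  also have "\<dots> \<le> \<bar>\<epsilon>\<bar> * (lipF R * norm (?U t x - ?U t y))"
    by (intro mult_left_mono F_estimates) (auto simp: x y)
  finally show "norm (G \<epsilon> t x - G \<epsilon> t y) \<le> (\<bar>\<epsilon>\<bar> * lipF R) * norm (x - y)"
    by (simp add: mult.assoc flip: phase_diff)
  have "norm (G \<epsilon> t x) \<le> \<bar>\<epsilon>\<bar> * norm (F t (?U t x))"
    unfolding G_def using norm_mulop_eps[of \<epsilon> "?U (- t) (F t (?U t x))"] by simp
  also have "\<dots> \<le> \<bar>\<epsilon>\<bar> * (lipF R * R)"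
    by (intro mult_left_mono F_estimates[where y = 0]) (use x in \<open>auto intro: order_trans[OF norm_ge_zero]\<close>)
  finally show "norm (G \<epsilon> t x) \<le> \<bar>\<epsilon>\<bar> * (lipF R * R)" .
qed

lemma continuous_on_F:
  assumes "continuous_on S x"
  shows "continuous_on S (\<lambda>t. F t (x t))"
proof -
  have s2: "s > 1 / 2" using s by simp
  note c = bounded_bilinear.continuous_on[OF bounded_bilinear_convop[OF s2]]
  show ?thesis
    unfolding F_def
    by (intro c continuous_on_add continuous_on_scaleR continuous_on_const continuous_waves assms
        bounded_linear.continuous_on[OF bounded_linear_cnjop])
qed

lemma continuous_on_G:
  assumes "continuous_on S x"
  shows "continuous_on S (\<lambda>t. G \<epsilon> t (x t))"
  unfolding G_def
  by (intro bounded_linear.continuous_on[OF bounded_linear_mulop_const] continuous_on_phase continuous_on_F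
      continuous_on_minus continuous_on_id assms)

abbreviation solution :: "real \<Rightarrow> real \<Rightarrow> (real \<Rightarrow> pdist \<times> pdist \<times> pdist) \<Rightarrow> bool" where
  "solution \<epsilon> T \<equiv> mZR_solution s M \<sigma>2 \<sigma>3 \<delta> D W \<alpha>1 \<alpha>2 \<epsilon> T (\<psi>0, \<rho>0, \<phi>0)"

abbreviation picture :: "real \<Rightarrow> real \<Rightarrow> (real \<Rightarrow> l2) \<Rightarrow> bool" where
  "picture \<epsilon> T w \<equiv> \<forall>t\<in>{0..T}. (w has_vector_derivative G \<epsilon> t (w t)) (at t within {0..T})"

lemma interaction_picture_existence:
  obtains c where "c > 0" "\<And>\<epsilon>. \<epsilon> > 0 \<Longrightarrow> \<exists>w. continuous_on {0..c / \<epsilon>} w \<and> w 0 = emb s \<psi>0 \<and>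
     picture \<epsilon> (c / \<epsilon>) w"
proof -
  \<comment> \<open>Contains the unit ball around the initial value, which is the ball of
    \<open>picard_local_existence\<close>.\<close>
  define R where "R = norm (emb s \<psi>0) + 1"
  have R: "R \<ge> 0" "norm x \<le> R" if "norm (x - emb s \<psi>0) \<le> 1" for x
    using norm_triangle_ineq[of "x - emb s \<psi>0" "emb s \<psi>0"] that by (auto simp: R_def)
  have R0: "R \<ge> 0" by (simp add: R_def)
  have l0: "lipF R \<ge> 0" using F_estimates(3)[of 0 R 0] R0 by simp
  \<comment> \<open>On the interval of length c / \<epsilon> the factor \<epsilon> cancels; the
    denominator dominates both \<open>lipF R * R\<close> and \<open>lipF R\<close>, as the two
    smallness conditions need, and the summand 1 keeps it positive.\<close>
  define c where "c = 1 / (2 * (lipF R * R + lipF R + 1))"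
  have den: "lipF R * R + lipF R + 1 > 0" using l0 R0 mult_nonneg_nonneg[OF l0 R0] by linarith
  have c: "c > 0" using den by (simp add: c_def)
  show ?thesis
  proof (rule that[OF c])
    fix \<epsilon> :: real assume e: "\<epsilon> > 0"
    have T: "c / \<epsilon> \<ge> 0" using c e by simp
    have 1: "(\<bar>\<epsilon>\<bar> * (lipF R * R)) * (c / \<epsilon>) \<le> 1"
      using e den l0 mult_nonneg_nonneg[OF l0 R0] mult_nonneg_nonneg[OF R0 l0] by (simp add: c_def divide_simps)
    have 2: "(\<bar>\<epsilon>\<bar> * lipF R) * (c / \<epsilon>) \<le> 1 / 2"
      using e den l0 mult_nonneg_nonneg[OF l0 R0] mult_nonneg_nonneg[OF R0 l0] by (simp add: c_def divide_simps)
    have 3: "\<bar>\<epsilon>\<bar> * lipF R \<ge> 0" using l0 by simp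
    show "\<exists>w. continuous_on {0..c / \<epsilon>} w \<and> w 0 = emb s \<psi>0 \<and>
       picture \<epsilon> (c / \<epsilon>) w"
      by (rule picard_local_existence[OF T, of "G \<epsilon>" "emb s \<psi>0", OF continuous_on_G _ _ 1 2 3])
         (auto intro!: G_estimates R)
  qed
qed

subsection \<open>Uniqueness\<close>

definition rhs_psi :: "real \<Rightarrow> pdist \<Rightarrow> pdist \<Rightarrow> pdist" where
  "rhs_psi \<epsilon> B \<psi> = \<sigma>3 *\<^sub>R (\<partial>\<^sub>x \<psi>) + (\<i> * of_real (\<epsilon> * \<delta>)) *\<^sub>C (\<partial>\<^sub>x (\<partial>\<^sub>x \<psi>)) - (\<i> * of_real \<epsilon>) *\<^sub>C (B \<cdot>\<^sub>d \<psi>)"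

lemma fcoeff_rhs_psi: "fcoeff (rhs_psi \<epsilon> B \<psi>) k = \<i> * of_real (disp \<epsilon> k) * fcoeff \<psi> k - \<i> * of_real \<epsilon> * fcoeff (B \<cdot>\<^sub>d \<psi>) k"
  by (simp add: rhs_psi_def disp_def algebra_simps power2_eq_square)

lemma density_equation:
  assumes \<psi>: "H_C0 s T \<psi>" and d: "H_C1 (s - 2) T \<psi> \<psi>t" and t: "t \<in> {0..T}"
    and B: "B \<in> wiener" "real_pd B" and eq: "\<psi>t t = rhs_psi \<epsilon> B (\<psi> t)"
  shows "((\<lambda>t. fcoeff (pd_abs2 (\<psi> t)) k) has_vector_derivative
     \<i> * of_int k * (of_real \<sigma>3 * fcoeff (pd_abs2 (\<psi> t)) k + \<i> * (of_real \<epsilon> * of_real \<delta>) * fcoeff (pd_current (\<psi> t)) k)) (at t within {0..T})"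
proof -
  have d1: "H_C1 (- 1) T \<psi> \<psi>t" using s by (intro H_C1_mono[OF d]) auto
  have m: "\<psi> t \<in> sobolev s" "\<psi>t t \<in> sobolev (- 1)"
    using H_C0_mem[OF \<psi> t] d1 t by (auto simp: H_C1_def H_C0_def)
  show ?thesis
    using density_derivative[OF \<psi> _ _ d1 t, of k] s
      density_flux[OF m(1) s B m(2) eq[unfolded rhs_psi_def], of k] by simp
qed

lemma fcoeff_corrections:
  "fcoeff (\<epsilon> *\<^sub>R L1 \<delta> \<alpha>1 \<psi>) k = of_real \<epsilon> * ((- \<i> * of_real \<delta> * of_real \<alpha>1) * (\<i> * of_int k * fcoeff (pd_current \<psi>) k))"
  "fcoeff (\<epsilon> *\<^sub>R L2 M \<delta> \<alpha>2 \<psi>) k = of_real \<epsilon> * ((- (\<i> / of_real M) * of_real \<delta> * of_real \<alpha>2) * fcoeff (pd_current \<psi>) k)"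
  unfolding L1_def L2_def by simp_all

text \<open>The phase cancels the terms with derivatives in each mode. Although
  \<open>\<psi>\<close> is differentiable only in H^(s-2), the transformed curve is differentiable
  in H^s, because what remains is continuous there.\<close>

lemma interaction_picture_ode:
  assumes \<psi>: "H_C0 s T \<psi>" and d: "H_C1 (s - 2) T \<psi> \<psi>t"
    and eq: "\<And>t. t \<in> {0..T} \<Longrightarrow> \<psi>t t = rhs_psi \<epsilon> (pot t (\<psi> t)) (\<psi> t)" and t: "t \<in> {0..T}"
  defines "w \<equiv> \<lambda>t. phase (disp \<epsilon>) (- t) (emb s (\<psi> t))"
  shows "(w has_vector_derivative G \<epsilon> t (w t)) (at t within {0..T})"
proof (rule l2_has_vector_derivativeI[OF _ _ t])
  have "continuous_on {0..T} w"
    unfolding w_def by (intro continuous_on_phase H_C0_cont[OF \<psi>] continuous_intros)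
  then show "continuous_on {0..T} (\<lambda>t. G \<epsilon> t (w t))" by (rule continuous_on_G)
  fix k t assume t: "t \<in> {0..T}"
  note m = H_C0_mem[OF \<psi>]
  have "((\<lambda>t. of_real (br k powr (s / 2)) * (cis (- disp \<epsilon> k * t) * fcoeff (\<psi> t) k)) has_vector_derivative
      of_real (br k powr (s / 2)) * (cis (- disp \<epsilon> k * t) * fcoeff (\<psi>t t) k + \<i> * of_real (- disp \<epsilon> k) * cis (- disp \<epsilon> k * t) * fcoeff (\<psi> t) k)) (at t within {0..T})"
    by (intro has_vector_derivative_mult_right has_vector_derivative_mult cis_has_vector_derivative H_C1_fcoeff[OF d t])
  also have "of_real (br k powr (s / 2)) * (cis (- disp \<epsilon> k * t) * fcoeff (\<psi>t t) k + \<i> * of_real (- disp \<epsilon> k) * cis (- disp \<epsilon> k * t) * fcoeff (\<psi> t) k)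
      = - \<i> * of_real \<epsilon> * (cis (- disp \<epsilon> k * t) * (of_real (br k powr (s / 2)) * fcoeff (pot t (\<psi> t) \<cdot>\<^sub>d \<psi> t) k))"
    unfolding eq[OF t] fcoeff_rhs_psi by (simp add: algebra_simps)
  also have "\<dots> = cf (G \<epsilon> t (w t)) k"
    by (simp add: cf_G w_def cf_emb[OF pot_mem(3)[OF m[OF t]], symmetric] pot_mem(4)[OF m[OF t]])
  finally show "((\<lambda>t. cf (w t) k) has_vector_derivative cf (G \<epsilon> t (w t)) k) (at t within {0..T})"
    by (rule has_vector_derivative_transform[OF t, rotated]) (simp add: w_def cf_emb m)
qed

text \<open>Two given solutions are bounded on a compact interval, so the Lipschitz constant on a
  ball containing both suffices; no a priori bound enters.\<close>

lemma interaction_picture_unique: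
  assumes v: "\<And>t. t \<in> {0..T} \<Longrightarrow> (v has_vector_derivative G \<epsilon> t (v t)) (at t within {0..T})"
    and w: "\<And>t. t \<in> {0..T} \<Longrightarrow> (w has_vector_derivative G \<epsilon> t (w t)) (at t within {0..T})"
    and init: "v 0 = w 0" and t: "t \<in> {0..T}"
  shows "v t = w t"
proof -
  have b: "\<exists>R. \<forall>t\<in>{0..T}. norm (f t) \<le> R"
    if "\<And>t. t \<in> {0..T} \<Longrightarrow> (f has_vector_derivative G \<epsilon> t (f t)) (at t within {0..T})" for f
  proof -
    have "compact (f ` {0..T})"
      by (intro compact_continuous_image continuous_on_vector_derivative[OF that] compact_Icc)
    from compact_imp_bounded[OF this] obtain R where "\<forall>x\<in>f ` {0..T}. norm x \<le> R"
      unfolding bounded_iff by blast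
    then show ?thesis by blast
  qed
  obtain R1 where R1: "\<And>t. t \<in> {0..T} \<Longrightarrow> norm (v t) \<le> R1" using b[OF v] by blast
  obtain R2 where R2: "\<And>t. t \<in> {0..T} \<Longrightarrow> norm (w t) \<le> R2" using b[OF w] by blast
  show ?thesis
  proof (rule ode_unique[OF v w _ init t])
    show "norm (G \<epsilon> t (v t) - G \<epsilon> t (w t)) \<le> (\<bar>\<epsilon>\<bar> * lipF (max R1 R2)) * norm (v t - w t)" if "t \<in> {0..T}" for t
      using R1[OF that] R2[OF that] by (intro G_estimates) auto
  qed
qed

lemma ab_group_solve:
  fixes a b c d :: "'z :: ab_group_add"
  shows "a - b - c + d = 0 \<Longrightarrow> a = b + c - d" "a + b + c + d = 0 \<Longrightarrow> a = - b - c - d"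
proof -
  have "a = (a - b - c + d) + (b + c - d)" by simp
  then show "a - b - c + d = 0 \<Longrightarrow> a = b + c - d" by simp
  have "a = (a + b + c + d) + (- b - c - d)" by simp
  then show "a + b + c + d = 0 \<Longrightarrow> a = - b - c - d" by simp
qed

text \<open>The reduction performed on an arbitrary solution. The fourth conclusion keeps the
  equation for the modes of \<open>\<phi>\<close>, because the second one says nothing about mode
  0.\<close>

lemma solution_structure:
  assumes T: "T \<ge> 0"
    and sol: "solution \<epsilon> T (\<lambda>t. (\<psi> t, \<rho> t, \<phi> t))"
  shows "\<And>t. t \<in> {0..T} \<Longrightarrow> \<rho> t = \<alpha>1 *\<^sub>R pd_abs2 (\<psi> t) + dist_of s (rho_wave t)" (is "\<And>t. _ \<Longrightarrow> ?rho t")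
    and "\<And>t. t \<in> {0..T} \<Longrightarrow> \<partial>\<^sub>x (\<phi> t) = (\<alpha>2 / M) *\<^sub>R pd_abs2 (\<psi> t) + dist_of s (u_wave t)" (is "\<And>t. _ \<Longrightarrow> ?phi t")
    and "\<And>t. t \<in> {0..T} \<Longrightarrow> ((\<lambda>t. phase (disp \<epsilon>) (- t) (emb s (\<psi> t))) has_vector_derivative
        G \<epsilon> t (phase (disp \<epsilon>) (- t) (emb s (\<psi> t)))) (at t within {0..T})"
    and "\<And>t k. t \<in> {0..T} \<Longrightarrow> ((\<lambda>t. fcoeff (\<phi> t) k) has_vector_derivative
        fcoeff (- ((1 / M\<^sup>2) *\<^sub>R \<rho> t) - pd_abs2 (\<psi> t) - \<epsilon> *\<^sub>R L2 M \<delta> \<alpha>2 (\<psi> t)) k) (at t within {0..T})"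
    and "\<And>t. t \<in> {0..T} \<Longrightarrow> \<psi> t \<in> sobolev s"
    and "\<psi> 0 = \<psi>0" "\<phi> 0 = \<phi>0"
proof -
  from sol obtain \<Psi>t where
    C0: "C0_curve (Z_space s) (Z_norm s) T (\<lambda>t. (\<psi> t, \<rho> t, \<phi> t))"
    and C1': "C1_curve (Z_space (s - 2)) (Z_norm (s - 2)) T (\<lambda>t. (\<psi> t, \<rho> t, \<phi> t)) \<Psi>t"
    and eq': "\<And>t. t \<in> {0..T} \<Longrightarrow> mZR_system M \<sigma>2 \<sigma>3 \<delta> D W \<alpha>1 \<alpha>2 \<epsilon> (\<psi> t, \<rho> t, \<phi> t) (\<Psi>t t)"
    and init: "\<psi> 0 = \<psi>0" "\<rho> 0 = \<rho>0" "\<phi> 0 = \<phi>0"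
    unfolding mZR_solution_def by auto
  define \<psi>t \<rho>t \<phi>t where "\<psi>t t = fst (\<Psi>t t)" and "\<rho>t t = fst (snd (\<Psi>t t))" and "\<phi>t t = snd (snd (\<Psi>t t))" for t
  have P: "\<Psi>t = (\<lambda>t. (\<psi>t t, \<rho>t t, \<phi>t t))" by (simp add: \<psi>t_def \<rho>t_def \<phi>t_def)
  have \<psi>: "H_C0 s T \<psi>" and \<rho>: "H_C0 s T \<rho>" and \<phi>: "H_C0 (s + 1) T \<phi>"
    and re: "\<And>t. t \<in> {0..T} \<Longrightarrow> real_pd (\<rho> t) \<and> real_pd (\<phi> t)"
    using C0 by (auto simp: C0_curve_Z)
  have d\<psi>: "H_C1 (s - 2) T \<psi> \<psi>t" and d\<rho>: "H_C1 (s - 2) T \<rho> \<rho>t"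
    and d\<phi>: "H_C1 (s - 2 + 1) T \<phi> \<phi>t"
    using C1' unfolding P C1_curve_Z by blast+
  define B where "B t = \<sigma>2 *\<^sub>R pd_abs2 (\<psi> t) + W *\<^sub>R (\<rho> t + D *\<^sub>R (\<partial>\<^sub>x (\<phi> t)))" for t
  note m = H_C0_mem[OF \<psi>] H_C0_mem[OF \<rho>] H_C0_mem[OF \<phi>]
  have e\<psi>: "\<psi>t t = rhs_psi \<epsilon> (B t) (\<psi> t)" and e\<rho>: "\<rho>t t = - (\<partial>\<^sub>x (\<partial>\<^sub>x (\<phi> t))) - D *\<^sub>R (\<partial>\<^sub>x (pd_abs2 (\<psi> t))) - \<epsilon> *\<^sub>R L1 \<delta> \<alpha>1 (\<psi> t)"
    and e\<phi>: "\<phi>t t = - ((1 / M\<^sup>2) *\<^sub>R \<rho> t) - pd_abs2 (\<psi> t) - \<epsilon> *\<^sub>R L2 M \<delta> \<alpha>2 (\<psi> t)" if "t \<in> {0..T}" for t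
  proof -
    have E: "\<psi>t t - \<sigma>3 *\<^sub>R (\<partial>\<^sub>x (\<psi> t)) - (\<i> * of_real \<epsilon> * of_real \<delta>) *\<^sub>C (\<partial>\<^sub>x (\<partial>\<^sub>x (\<psi> t))) + (\<i> * of_real \<epsilon>) *\<^sub>C (B t \<cdot>\<^sub>d \<psi> t) = 0"
      "\<rho>t t + (\<partial>\<^sub>x (\<partial>\<^sub>x (\<phi> t))) + D *\<^sub>R (\<partial>\<^sub>x (pd_abs2 (\<psi> t))) + \<epsilon> *\<^sub>R L1 \<delta> \<alpha>1 (\<psi> t) = 0"
      "\<phi>t t + (1 / M\<^sup>2) *\<^sub>R \<rho> t + pd_abs2 (\<psi> t) + \<epsilon> *\<^sub>R L2 M \<delta> \<alpha>2 (\<psi> t) = 0"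
      using eq'[OF that] unfolding P mZR_system_def B_def by auto
    show "\<psi>t t = rhs_psi \<epsilon> (B t) (\<psi> t)"
      unfolding rhs_psi_def of_real_mult mult.assoc[symmetric] by (rule ab_group_solve(1)[OF E(1)])
    show "\<rho>t t = - (\<partial>\<^sub>x (\<partial>\<^sub>x (\<phi> t))) - D *\<^sub>R (\<partial>\<^sub>x (pd_abs2 (\<psi> t))) - \<epsilon> *\<^sub>R L1 \<delta> \<alpha>1 (\<psi> t)"
      by (rule ab_group_solve(2)[OF E(2)])
    show "\<phi>t t = - ((1 / M\<^sup>2) *\<^sub>R \<rho> t) - pd_abs2 (\<psi> t) - \<epsilon> *\<^sub>R L2 M \<delta> \<alpha>2 (\<psi> t)"
      by (rule ab_group_solve(2)[OF E(3)])
  qed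
  have Bw: "B t \<in> wiener" "real_pd (B t)" if t: "t \<in> {0..T}" for t
  proof -
    have "B t \<in> sobolev s"
      unfolding B_def by (intro sobolev_add sobolev_scaleR abs2_mem dphi_mem m t)
    then show "B t \<in> wiener" by (rule mem_wiener)
    show "real_pd (B t)"
      unfolding B_def by (intro real_pd_lin real_pd_abs2 mem_wiener m t re[OF t, THEN conjunct1] re[OF t, THEN conjunct2])
  qed
  note dn = density_equation[OF \<psi> d\<psi> _ Bw e\<psi>]
  \<comment> \<open>Each mode of a Riemann invariant solves a scalar linear equation, hence is
    determined by the data.\<close>
  have wave: "fcoeff (riemann m (\<psi> t) (\<rho> t) (\<phi> t)) k = cis (- of_int k / m * t) * fcoeff (riemann m \<psi>0 \<rho>0 \<phi>0) k"
    if m: "m = M \<or> m = - M" and t: "t \<in> {0..T}" for m t k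
  proof -
    have "((\<lambda>t. fcoeff (riemann m (\<psi> t) (\<rho> t) (\<phi> t)) k) has_vector_derivative
       \<i> * of_real (- of_int k / m) * fcoeff (riemann m (\<psi> t) (\<rho> t) (\<phi> t)) k) (at t within {0..T})" if t: "t \<in> {0..T}" for t
    proof -
      define K where "K = \<i> * complex_of_int k"
      define nt where "nt = K * (of_real \<sigma>3 * fcoeff (pd_abs2 (\<psi> t)) k + \<i> * (of_real \<epsilon> * of_real \<delta>) * fcoeff (pd_current (\<psi> t)) k)"
      have "((\<lambda>t. fcoeff (\<rho> t) k - of_real \<alpha>1 * fcoeff (pd_abs2 (\<psi> t)) k
          + of_real m * (K * fcoeff (\<phi> t) k - of_real (\<alpha>2 / M) * fcoeff (pd_abs2 (\<psi> t)) k)) has_vector_derivative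
          fcoeff (\<rho>t t) k - of_real \<alpha>1 * nt + of_real m * (K * fcoeff (\<phi>t t) k - of_real (\<alpha>2 / M) * nt)) (at t within {0..T})"
        unfolding nt_def K_def
        by (intro has_vector_derivative_add has_vector_derivative_diff has_vector_derivative_mult_right
            H_C1_fcoeff[OF d\<rho> t] H_C1_fcoeff[OF d\<phi> t] dn t)
      moreover have "fcoeff (\<rho>t t) k = - (K * (K * fcoeff (\<phi> t) k)) - of_real D * (K * fcoeff (pd_abs2 (\<psi> t)) k)
          - of_real \<epsilon> * ((- \<i> * of_real \<delta> * of_real \<alpha>1) * (K * fcoeff (pd_current (\<psi> t)) k))"
        unfolding e\<rho>[OF t] K_def fcoeff_simps(1,2,3) fcoeff_corrections by simp
      moreover have "fcoeff (\<phi>t t) k = - (1 / (of_real M)\<^sup>2 * fcoeff (\<rho> t) k) - fcoeff (pd_abs2 (\<psi> t)) k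
          - of_real \<epsilon> * ((- (\<i> / of_real M) * of_real \<delta> * of_real \<alpha>2) * fcoeff (pd_current (\<psi> t)) k)"
        unfolding e\<phi>[OF t] K_def fcoeff_simps(1,2,3) fcoeff_corrections by simp
      note wave_algebra[OF alpha_complex calculation(2) this nt_def]
      \<comment> \<open>Both signs of \<open>m\<close> satisfy m^2 = M^2, so the two wave equations
        combine into a multiple of the invariant itself.\<close>
      moreover have "- (K * u) + of_real m * (- (K / (of_real M)\<^sup>2 * r)) = \<i> * of_real (- of_int k / m) * (r + of_real m * u)" for r u
        using m M by (auto simp: K_def field_simps power2_eq_square)
      ultimately show ?thesis
        unfolding riemann_def by (simp add: K_def)
    qed
    from linear_ode_cis[OF this t] show ?thesis by (simp add: init)
  qed
  show rho: "?rho t" and phi: "?phi t" if t: "t \<in> {0..T}" for t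
  proof -
    have 1: "fcoeff (riemann M (\<psi> t) (\<rho> t) (\<phi> t)) k = cis (- of_int k / M * t) * fcoeff (riemann M \<psi>0 \<rho>0 \<phi>0) k"
     and 2: "fcoeff (riemann (- M) (\<psi> t) (\<rho> t) (\<phi> t)) k = cis (of_int k / M * t) * fcoeff (riemann (- M) \<psi>0 \<rho>0 \<phi>0) k" for k
      using wave[of M t k] wave[of "- M" t k] t by auto
    show "?rho t"
      by (rule pdist_fcoeff_eqI, unfold fcoeff_simps fcoeff_waves 1[symmetric] 2[symmetric])
         (simp add: riemann_def field_simps)
    show "?phi t"
      by (rule pdist_fcoeff_eqI, unfold fcoeff_simps fcoeff_waves 1[symmetric] 2[symmetric])
         (use M in \<open>simp add: riemann_def field_simps\<close>)
  qed
  have "B t = pot t (\<psi> t)" if "t \<in> {0..T}" for t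
    unfolding B_def by (rule pot_eq[OF rho[OF that] phi[OF that]])
  then show "((\<lambda>t. phase (disp \<epsilon>) (- t) (emb s (\<psi> t))) has_vector_derivative
        G \<epsilon> t (phase (disp \<epsilon>) (- t) (emb s (\<psi> t)))) (at t within {0..T})" if "t \<in> {0..T}" for t
    using e\<psi> by (intro interaction_picture_ode[OF \<psi> d\<psi> _ that]) auto
  show "((\<lambda>t. fcoeff (\<phi> t) k) has_vector_derivative
        fcoeff (- ((1 / M\<^sup>2) *\<^sub>R \<rho> t) - pd_abs2 (\<psi> t) - \<epsilon> *\<^sub>R L2 M \<delta> \<alpha>2 (\<psi> t)) k) (at t within {0..T})" if t: "t \<in> {0..T}" for t k
    using H_C1_fcoeff[OF d\<phi> t, of k] unfolding e\<phi>[OF t] .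
  show "t \<in> {0..T} \<Longrightarrow> \<psi> t \<in> sobolev s" for t by (rule m)
  show "\<psi> 0 = \<psi>0" "\<phi> 0 = \<phi>0" by (rule init)+
qed

text \<open>The first components agree by the equation in the interaction picture; this fixes the
  second ones and all nonzero modes of the third.\<close>

lemma uniqueness:
  assumes "T \<ge> 0" "solution \<epsilon> T \<Psi>"
    "solution \<epsilon> T \<Phi>" and t: "t \<in> {0..T}"
  shows "\<Psi> t = \<Phi> t"
proof -
  have "solution \<epsilon> T (\<lambda>t. (fst (\<Psi> t), fst (snd (\<Psi> t)), snd (snd (\<Psi> t))))"
    "solution \<epsilon> T (\<lambda>t. (fst (\<Phi> t), fst (snd (\<Phi> t)), snd (snd (\<Phi> t))))"
    using assms(2,3) by simp_all
  note A = solution_structure[OF assms(1) this(1)] and B = solution_structure[OF assms(1) this(2)]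
  have psi: "fst (\<Psi> t) = fst (\<Phi> t)" if t: "t \<in> {0..T}" for t
  proof -
    have "phase (disp \<epsilon>) (- t) (emb s (fst (\<Psi> t))) = phase (disp \<epsilon>) (- t) (emb s (fst (\<Phi> t)))"
      by (rule interaction_picture_unique[OF A(3) B(3) _ t]) (simp_all add: A B)
    then have "phase (disp \<epsilon>) t (phase (disp \<epsilon>) (- t) (emb s (fst (\<Psi> t)))) = phase (disp \<epsilon>) t (phase (disp \<epsilon>) (- t) (emb s (fst (\<Phi> t))))"
      by simp
    then show ?thesis
      using emb_inject[OF A(5)[OF t] B(5)[OF t]] by simp
  qed
  have rho: "fst (snd (\<Psi> t)) = fst (snd (\<Phi> t))" if "t \<in> {0..T}" for t
    using A(1)[OF that] B(1)[OF that] psi[OF that] by simp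
  have "fcoeff (snd (snd (\<Psi> t))) k = fcoeff (snd (snd (\<Phi> t))) k" for k
  proof (cases "k = 0")
    case False
    have "\<partial>\<^sub>x (snd (snd (\<Psi> t))) = \<partial>\<^sub>x (snd (snd (\<Phi> t)))"
      using A(2)[OF t] B(2)[OF t] psi[OF t] by simp
    from arg_cong[OF this, of "\<lambda>u. fcoeff u k"] False show ?thesis by simp
  next
    \<comment> \<open>Mode 0 is lost under the x-derivative; its time derivative depends only on the
      first two components, which already agree, so the initial value decides.\<close>
    case True
    have "((\<lambda>t. fcoeff (snd (snd (\<Psi> t))) k - fcoeff (snd (snd (\<Phi> t))) k) has_vector_derivative 0) (at t within {0..T})"
      if t: "t \<in> {0..T}" for t
      using has_vector_derivative_diff[OF A(4)[OF t, of k] B(4)[OF t, of k]] by (simp add: psi[OF t] rho[OF t])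
    then obtain c where "\<And>t. t \<in> {0..T} \<Longrightarrow> fcoeff (snd (snd (\<Psi> t))) k - fcoeff (snd (snd (\<Phi> t))) k = c"
      using has_vector_derivative_zero_constant[of "{0..T}"] convex_real_interval by blast
    from this[of 0] this[OF t] show ?thesis using assms(1) A(7) B(7) by simp
  qed
  then have "snd (snd (\<Psi> t)) = snd (snd (\<Phi> t))" by (rule pdist_fcoeff_eqI)
  then show ?thesis using psi[OF t] rho[OF t] by (simp add: prod_eq_iff)
qed

subsection \<open>Existence\<close>

lemma corrections_real:
  assumes "\<psi> \<in> sobolev s"
  shows "real_pd (\<epsilon> *\<^sub>R L1 \<delta> \<alpha>1 \<psi>)" "real_pd (\<epsilon> *\<^sub>R L2 M \<delta> \<alpha>2 \<psi>)"
proof -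
  have J: "pd_cnj (pd_current \<psi>) = - pd_current \<psi>"
    by (intro pd_current_imag mem_wiener deriv_wiener assms)
  have dJ: "pd_cnj (\<partial>\<^sub>x (pd_current \<psi>)) = - (\<partial>\<^sub>x (pd_current \<psi>))"
    unfolding pd_cnj_deriv J by (rule pdist_fcoeff_eqI) simp
  have "- \<i> * complex_of_real \<delta> * of_real \<alpha>1 = - \<i> * of_real (\<delta> * \<alpha>1)"
    "- (\<i> / complex_of_real M) * of_real \<delta> * of_real \<alpha>2 = - \<i> * of_real (\<delta> * \<alpha>2 / M)" by simp_all
  then show "real_pd (\<epsilon> *\<^sub>R L1 \<delta> \<alpha>1 \<psi>)" "real_pd (\<epsilon> *\<^sub>R L2 M \<delta> \<alpha>2 \<psi>)"
    unfolding L1_def L2_def by (simp_all only: real_pd_lin real_pd_imag_scale J dJ)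
qed

text \<open>The reduction read backwards. The components and their prospective time derivatives are
  defined so that the system holds almost by construction; the work lies in showing that these
  really are the derivatives.\<close>

lemma existence:
  assumes T: "T \<ge> 0" and wc: "continuous_on {0..T} w" and w0: "w 0 = emb s \<psi>0"
    and dw: "\<And>t. t \<in> {0..T} \<Longrightarrow> (w has_vector_derivative G \<epsilon> t (w t)) (at t within {0..T})"
  shows "\<exists>\<Psi>. solution \<epsilon> T \<Psi>"
proof -
  define \<psi> where "\<psi> t = dist_of s (phase (disp \<epsilon>) t (w t))" for t
  define \<psi>t where "\<psi>t t = rhs_psi \<epsilon> (pot t (\<psi> t)) (\<psi> t)" for t
  define \<rho> where "\<rho> t = \<alpha>1 *\<^sub>R pd_abs2 (\<psi> t) + dist_of s (rho_wave t)" for t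
  \<comment> \<open>Candidate for the x-derivative of \<open>\<phi>\<close>, available before
    \<open>\<phi>\<close> itself.\<close>
  define u where "u t = (\<alpha>2 / M) *\<^sub>R pd_abs2 (\<psi> t) + dist_of s (u_wave t)" for t
  define \<phi>t where "\<phi>t t = - ((1 / M\<^sup>2) *\<^sub>R \<rho> t) - pd_abs2 (\<psi> t) - \<epsilon> *\<^sub>R L2 M \<delta> \<alpha>2 (\<psi> t)" for t
  \<comment> \<open>Mode 0 of \<open>\<phi>\<close>, integrated from the third equation. Taking the
    real part makes \<open>z\<close> visibly real; it is harmless as \<open>\<phi>t\<close> turns
    out to be real.\<close>
  define z where "z t = fcoeff \<phi>0 0 + of_real (integral {0..t} (\<lambda>\<tau>. Re (fcoeff (\<phi>t \<tau>) 0)))" for t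
  define \<phi> where "\<phi> t = dist_of (s + 1) (antiop (emb s (u t)) + unit_l2 0 (z t))" for t
  define \<rho>t where "\<rho>t t = - (\<partial>\<^sub>x (\<partial>\<^sub>x (\<phi> t))) - D *\<^sub>R (\<partial>\<^sub>x (pd_abs2 (\<psi> t))) - \<epsilon> *\<^sub>R L1 \<delta> \<alpha>1 (\<psi> t)" for t
  have s2: "s > 1 / 2" using s by simp
  have \<psi>c: "H_C0 s T \<psi>"
    unfolding \<psi>_def by (intro H_C0_dist_of continuous_on_phase wc continuous_on_id)
  have nc: "H_C0 s T (\<lambda>t. pd_abs2 (\<psi> t))" by (intro H_C0_mult H_C0_cnj \<psi>c s2)
  have \<rho>c: "H_C0 s T \<rho>" and uc: "H_C0 s T u" and potc: "H_C0 s T (\<lambda>t. pot t (\<psi> t))"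
    unfolding \<rho>_def u_def pot_def
    by (intro H_C0_add H_C0_scaleR nc H_C0_dist_of continuous_waves)+
  have \<psi>d: "H_C0 (s - 1) T (\<lambda>t. \<partial>\<^sub>x (\<psi> t))" by (rule H_C0_deriv[OF \<psi>c]) simp
  have \<psi>1: "H_C0 (s - 1) T \<psi>" by (rule H_C0_mono[OF \<psi>c]) simp
  have Jc: "H_C0 (s - 1) T (\<lambda>t. pd_current (\<psi> t))"
    unfolding pd_current_def pd_cnj_deriv[symmetric]
    by (intro H_C0_diff H_C0_mult H_C0_cnj \<psi>d \<psi>1) (use s in auto)
  have \<psi>tc: "H_C0 (s - 2) T \<psi>t"
  proof -
    have 1: "H_C0 (s - 2) T (\<lambda>t. \<partial>\<^sub>x (\<psi> t))" by (rule H_C0_mono[OF \<psi>d]) simp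
    have 2: "H_C0 (s - 2) T (\<lambda>t. \<partial>\<^sub>x (\<partial>\<^sub>x (\<psi> t)))" by (rule H_C0_deriv[OF \<psi>d]) simp
    have 3: "H_C0 (s - 2) T (\<lambda>t. pot t (\<psi> t) \<cdot>\<^sub>d \<psi> t)"
      by (rule H_C0_mono[OF H_C0_mult[OF potc \<psi>c s2]]) simp
    show ?thesis unfolding \<psi>t_def rhs_psi_def
      by (intro H_C0_add H_C0_diff H_C0_scaleR H_C0_scaleC 1 2 3)
  qed
  note m = H_C0_mem[OF \<psi>c]
  have em: "emb s (\<psi> t) = phase (disp \<epsilon>) t (w t)" for t by (simp add: \<psi>_def)
  \<comment> \<open>The converse of \<open>interaction_picture_ode\<close>: undoing the phase
    restores the linear terms mode by mode, now with values in H^(s-2).\<close>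
  have d\<psi>: "H_C1 (s - 2) T \<psi> \<psi>t"
  proof (rule H_C1I[OF _ \<psi>tc])
    show "H_C0 (s - 2) T \<psi>" by (rule H_C0_mono[OF \<psi>c]) simp
    fix k t assume t: "t \<in> {0..T}"
    have "((\<lambda>t. of_real (br k powr (- s / 2)) * (cis (disp \<epsilon> k * t) * cf (w t) k)) has_vector_derivative
      of_real (br k powr (- s / 2)) * (cis (disp \<epsilon> k * t) * cf (G \<epsilon> t (w t)) k + \<i> * of_real (disp \<epsilon> k) * cis (disp \<epsilon> k * t) * cf (w t) k)) (at t within {0..T})"
      by (intro has_vector_derivative_mult_right has_vector_derivative_mult cis_has_vector_derivative
          bounded_linear.has_vector_derivative[OF bounded_linear_cf dw[OF t]])
    also have "cis (disp \<epsilon> k * t) * cf (G \<epsilon> t (w t)) k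
        = (cis (disp \<epsilon> k * t) * cis (- disp \<epsilon> k * t)) * (- \<i> * of_real \<epsilon> * cf (emb s (pot t (\<psi> t) \<cdot>\<^sub>d \<psi> t)) k)"
      unfolding cf_G pot_mem(4)[OF m[OF t]] em by simp
    also have "\<dots> = - \<i> * of_real \<epsilon> * cf (emb s (pot t (\<psi> t) \<cdot>\<^sub>d \<psi> t)) k" by (simp add: cis_mult)
    also have "of_real (br k powr (- s / 2)) * (- \<i> * of_real \<epsilon> * cf (emb s (pot t (\<psi> t) \<cdot>\<^sub>d \<psi> t)) k + \<i> * of_real (disp \<epsilon> k) * cis (disp \<epsilon> k * t) * cf (w t) k)
       = fcoeff (\<psi>t t) k"
      unfolding \<psi>t_def fcoeff_rhs_psi fcoeff_emb[OF pot_mem(3)[OF m[OF t]]] by (simp add: \<psi>_def fcoeff_dist_of algebra_simps)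
    finally show "((\<lambda>t. fcoeff (\<psi> t) k) has_vector_derivative fcoeff (\<psi>t t) k) (at t within {0..T})"
      by (simp add: \<psi>_def fcoeff_dist_of)
  qed
  note dn = density_equation[OF \<psi>c d\<psi> _ mem_wiener[OF pot_mem(1)[OF m]] pot_mem(2)[OF m] \<psi>t_def]
  define nt where "nt k t = \<i> * of_int k * (of_real \<sigma>3 * fcoeff (pd_abs2 (\<psi> t)) k + \<i> * (of_real \<epsilon> * of_real \<delta>) * fcoeff (pd_current (\<psi> t)) k)" for k t
  have \<phi>tk: "fcoeff (\<phi>t t) k = - (1 / (of_real M)\<^sup>2 * fcoeff (\<rho> t) k) - fcoeff (pd_abs2 (\<psi> t)) k
      - of_real \<epsilon> * ((- (\<i> / of_real M) * of_real \<delta> * of_real \<alpha>2) * fcoeff (pd_current (\<psi> t)) k)" for t k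
    unfolding \<phi>t_def fcoeff_simps(1,2,3) fcoeff_corrections by simp
  have \<rho>tk: "fcoeff (\<rho>t t) k = - (\<i> * of_int k * (\<i> * of_int k * fcoeff (\<phi> t) k)) - of_real D * (\<i> * of_int k * fcoeff (pd_abs2 (\<psi> t)) k)
      - of_real \<epsilon> * ((- \<i> * of_real \<delta> * of_real \<alpha>1) * (\<i> * of_int k * fcoeff (pd_current (\<psi> t)) k))" for t k
    unfolding \<rho>t_def fcoeff_simps(1,2,3) fcoeff_corrections by simp
  note wa = wave_algebra[OF alpha_complex \<rho>tk \<phi>tk nt_def]
  \<comment> \<open>Compatibility of \<open>u\<close> and \<open>\<phi>t\<close>: the time
    derivative of the one is the x-derivative of the other, by the second identity of
    \<open>wave_algebra\<close>.\<close>
  have du: "((\<lambda>t. fcoeff (u t) k) has_vector_derivative \<i> * of_int k * fcoeff (\<phi>t t) k) (at t within {0..T})" if t: "t \<in> {0..T}" for t k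
  proof -
    have "((\<lambda>t. of_real (\<alpha>2 / M) * fcoeff (pd_abs2 (\<psi> t)) k + fcoeff (dist_of s (u_wave t)) k) has_vector_derivative
        of_real (\<alpha>2 / M) * nt k t + - (\<i> * of_int k / (of_real M)\<^sup>2 * fcoeff (dist_of s (rho_wave t)) k)) (at t within {0..T})"
      unfolding nt_def by (intro has_vector_derivative_add has_vector_derivative_mult_right dn waves_derivative t)
    moreover have rw: "fcoeff (dist_of s (rho_wave t)) k = fcoeff (\<rho> t) k - of_real \<alpha>1 * fcoeff (pd_abs2 (\<psi> t)) k"
      by (simp add: \<rho>_def)
    have "of_real (\<alpha>2 / M) * nt k t + - (\<i> * of_int k / (of_real M)\<^sup>2 * fcoeff (dist_of s (rho_wave t)) k) = \<i> * of_int k * fcoeff (\<phi>t t) k"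
      using wa(2)[of k t] unfolding rw by (simp add: algebra_simps)
    ultimately show ?thesis by (simp add: u_def)
  qed
  have \<psi>0: "\<psi> 0 = \<psi>0" by (simp add: \<psi>_def w0 dist_of_emb data_mem)
  have u0: "u 0 = \<partial>\<^sub>x \<phi>0" and \<rho>0: "\<rho> 0 = \<rho>0" by (simp_all add: u_def \<rho>_def \<psi>0 waves_initial)
  \<comment> \<open>The time derivative of mode 0 carries the factor k = 0, and \<open>u\<close>
    starts as an x-derivative; hence \<open>u\<close> keeps mean zero and has a periodic
    antiderivative.\<close>
  have uk0: "fcoeff (u t) 0 = 0" if t: "t \<in> {0..T}" for t
  proof -
    obtain c where "\<And>t. t \<in> {0..T} \<Longrightarrow> fcoeff (u t) 0 = c"
      using has_vector_derivative_zero_constant[of "{0..T}" "\<lambda>t. fcoeff (u t) 0"] du[of _ 0] convex_real_interval by auto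
    from this[of 0] this[OF t] show ?thesis using T by (simp add: u0)
  qed
  \<comment> \<open>The current costs one derivative, which gives exactly the order s - 1 of the
    third component of the weaker space.\<close>
  have \<phi>tc: "H_C0 (s - 1) T \<phi>t"
  proof -
    have "H_C0 (s - 1) T \<rho>" "H_C0 (s - 1) T (\<lambda>t. pd_abs2 (\<psi> t))"
      by (rule H_C0_mono[OF \<rho>c] H_C0_mono[OF nc]; simp)+
    then show ?thesis unfolding \<phi>t_def L2_def
      by (intro H_C0_diff H_C0_uminus H_C0_scaleR H_C0_scaleC Jc)
  qed
  have re\<rho>: "real_pd (\<rho> t)" and reu: "real_pd (u t)" and re\<phi>t: "real_pd (\<phi>t t)" if t: "t \<in> {0..T}" for t
  proof -
    have n: "real_pd (pd_abs2 (\<psi> t))" by (intro real_pd_abs2 mem_wiener m t)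
    show "real_pd (\<rho> t)" "real_pd (u t)" unfolding \<rho>_def u_def by (intro real_pd_lin n waves_real)+
    then show "real_pd (\<phi>t t)" unfolding \<phi>t_def by (intro real_pd_lin n corrections_real m t)
  qed
  have rez: "cnj (z t) = z t" for t
    using data_mem(5) unfolding real_pd_iff z_def by (metis complex_cnj_add complex_cnj_complex_of_real minus_zero)
  have dz: "(z has_vector_derivative fcoeff (\<phi>t t) 0) (at t within {0..T})" if t: "t \<in> {0..T}" for t
  proof -
    have "continuous_on {0..T} (\<lambda>\<tau>. Re (fcoeff (\<phi>t \<tau>) 0))"
      by (intro continuous_intros H_C0_fcoeff[OF \<phi>tc])
    from integral_has_vector_derivative[OF this t]
    have "((\<lambda>t. integral {0..t} (\<lambda>\<tau>. Re (fcoeff (\<phi>t \<tau>) 0))) has_vector_derivative Re (fcoeff (\<phi>t t) 0)) (at t within {0..T})" .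
    from has_vector_derivative_add[OF has_vector_derivative_const bounded_linear.has_vector_derivative[OF bounded_linear_of_real this], of "fcoeff \<phi>0 0"]
    have "(z has_vector_derivative of_real (Re (fcoeff (\<phi>t t) 0))) (at t within {0..T})"
      unfolding z_def[abs_def] by simp
    moreover have "cnj (fcoeff (\<phi>t t) 0) = fcoeff (\<phi>t t) 0"
      using re\<phi>t[OF t] unfolding real_pd_iff by (metis minus_zero)
    then have "of_real (Re (fcoeff (\<phi>t t) 0)) = fcoeff (\<phi>t t) 0"
      by (simp add: complex_eq_iff)
    ultimately show ?thesis by simp
  qed
  have \<phi>k: "fcoeff (\<phi> t) k = fcoeff (u t) k / (\<i> * of_int k) + (if k = 0 then z t else 0)" if t: "t \<in> {0..T}" for t k
  proof -
    have p: "br k powr (- (s + 1) / 2) * (br k powr (1 / 2) * br k powr (s / 2)) = 1"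
      by (simp flip: powr_add) (simp add: field_simps)
    have "fcoeff (\<phi> t) k = of_real (br k powr (- (s + 1) / 2) * (br k powr (1 / 2) * br k powr (s / 2))) * (fcoeff (u t) k / (\<i> * of_int k))
        + of_real (br k powr (- (s + 1) / 2)) * (if k = 0 then z t else 0)"
      unfolding \<phi>_def fcoeff_dist_of cf_plus cf_antiop cf_unit_l2 cf_emb[OF H_C0_mem[OF uc t]]
      by (simp only: of_real_mult) (simp add: algebra_simps)
    \<comment> \<open>The remaining weight stands only on mode 0, where \<open>br 0\<close> is
      1.\<close>
    then show ?thesis unfolding p by (auto simp: br_def)
  qed
  have dphi: "\<partial>\<^sub>x (\<phi> t) = u t" if t: "t \<in> {0..T}" for t
    by (rule pdist_fcoeff_eqI) (use uk0[OF t] in \<open>auto simp: \<phi>k[OF t]\<close>)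
  have d\<phi>: "((\<lambda>t. fcoeff (\<phi> t) k) has_vector_derivative fcoeff (\<phi>t t) k) (at t within {0..T})" if t: "t \<in> {0..T}" for t k
  proof (rule has_vector_derivative_transform[OF t])
    show "((\<lambda>t. fcoeff (u t) k / (\<i> * of_int k) + (if k = 0 then z t else 0)) has_vector_derivative fcoeff (\<phi>t t) k) (at t within {0..T})"
    proof (cases "k = 0")
      case True
      then show ?thesis using dz[OF t] by simp
    next
      case False
      then show ?thesis using has_vector_derivative_divide[OF du[OF t, of k], of "\<i> * of_int k"] by simp
    qed
  qed (rule \<phi>k)
  have d\<rho>: "((\<lambda>t. fcoeff (\<rho> t) k) has_vector_derivative fcoeff (\<rho>t t) k) (at t within {0..T})" if t: "t \<in> {0..T}" for t k
  proof -
    have "((\<lambda>t. of_real \<alpha>1 * fcoeff (pd_abs2 (\<psi> t)) k + fcoeff (dist_of s (rho_wave t)) k) has_vector_derivative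
        of_real \<alpha>1 * nt k t + - (\<i> * of_int k * fcoeff (dist_of s (u_wave t)) k)) (at t within {0..T})"
      unfolding nt_def by (intro has_vector_derivative_add has_vector_derivative_mult_right dn waves_derivative t)
    moreover have "fcoeff (dist_of s (u_wave t)) k = \<i> * of_int k * fcoeff (\<phi> t) k - of_real \<alpha>2 / of_real M * fcoeff (pd_abs2 (\<psi> t)) k"
      using arg_cong[OF dphi[OF t], of "\<lambda>v. fcoeff v k"] by (simp add: u_def)
    ultimately show ?thesis using wa(1)[of t k] by (simp add: \<rho>_def algebra_simps)
  qed
  have \<phi>c: "H_C0 (s + 1) T \<phi>"
    unfolding \<phi>_def
    by (intro H_C0_dist_of continuous_on_add bounded_linear.continuous_on[OF bounded_linear_antiop] H_C0_cont[OF uc]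
        bounded_linear.continuous_on[OF bounded_linear_unit_l2] continuous_on_vector_derivative[OF dz])
  have \<rho>tc: "H_C0 (s - 2) T \<rho>t"
  proof -
    have "H_C0 s T (\<lambda>t. \<partial>\<^sub>x (\<phi> t))" by (rule H_C0_deriv[OF \<phi>c]) simp
    then have "H_C0 (s - 2) T (\<lambda>t. \<partial>\<^sub>x (\<partial>\<^sub>x (\<phi> t)))" by (rule H_C0_deriv) simp
    moreover have "H_C0 (s - 2) T (\<lambda>t. \<partial>\<^sub>x (pd_abs2 (\<psi> t)))" by (rule H_C0_deriv[OF nc]) simp
    moreover have "H_C0 (s - 2) T (\<lambda>t. \<partial>\<^sub>x (pd_current (\<psi> t)))" by (rule H_C0_deriv[OF Jc]) simp
    ultimately show ?thesis unfolding \<rho>t_def L1_def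
      by (intro H_C0_diff H_C0_uminus H_C0_scaleR H_C0_scaleC)
  qed
  have re\<phi>: "real_pd (\<phi> t)" if t: "t \<in> {0..T}" for t
  proof -
    have "cnj (fcoeff (u t) (- k)) = fcoeff (u t) k" for k using reu[OF t] unfolding real_pd_iff by blast
    then show ?thesis unfolding real_pd_iff \<phi>k[OF t] by (auto simp: rez)
  qed
  have re\<rho>t: "real_pd (\<rho>t t)" if t: "t \<in> {0..T}" for t
    unfolding \<rho>t_def by (intro real_pd_lin re\<phi> corrections_real real_pd_abs2 mem_wiener m t)
  have \<phi>0: "\<phi> 0 = \<phi>0"
    using T by (intro pdist_fcoeff_eqI) (auto simp: \<phi>k u0 z_def)
  have C0: "C0_curve (Z_space s) (Z_norm s) T (\<lambda>t. (\<psi> t, \<rho> t, \<phi> t))"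
    unfolding C0_curve_Z using \<psi>c \<rho>c \<phi>c re\<rho> re\<phi> by blast
  have C1: "C1_curve (Z_space (s - 2)) (Z_norm (s - 2)) T (\<lambda>t. (\<psi> t, \<rho> t, \<phi> t)) (\<lambda>t. (\<psi>t t, \<rho>t t, \<phi>t t))"
    unfolding C1_curve_Z
  proof (intro conjI ballI d\<psi> re\<rho> re\<phi> re\<rho>t re\<phi>t)
    show "H_C1 (s - 2) T \<rho> \<rho>t"
      by (rule H_C1I[OF H_C0_mono[OF \<rho>c] \<rho>tc d\<rho>]) auto
    show "H_C1 (s - 2 + 1) T \<phi> \<phi>t"
      by (rule H_C1I[OF H_C0_mono[OF \<phi>c] H_C0_mono[OF \<phi>tc] d\<phi>]) auto
  qed
  have sys: "mZR_system M \<sigma>2 \<sigma>3 \<delta> D W \<alpha>1 \<alpha>2 \<epsilon> (\<psi> t, \<rho> t, \<phi> t) (\<psi>t t, \<rho>t t, \<phi>t t)" if t: "t \<in> {0..T}" for t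
  proof -
    have B: "\<sigma>2 *\<^sub>R pd_abs2 (\<psi> t) + W *\<^sub>R (\<rho> t + D *\<^sub>R (\<partial>\<^sub>x (\<phi> t))) = pot t (\<psi> t)"
      by (rule pot_eq) (simp_all add: \<rho>_def dphi[OF t] u_def)
    show ?thesis unfolding mZR_system_def split B
      by (simp add: \<psi>t_def \<rho>t_def \<phi>t_def rhs_psi_def mult.assoc)
  qed
  show ?thesis
    unfolding mZR_solution_def using C0 C1 sys \<psi>0 \<rho>0 \<phi>0
    by (intro exI[of _ "\<lambda>t. (\<psi> t, \<rho> t, \<phi> t)"] conjI exI[of _ "\<lambda>t. (\<psi>t t, \<rho>t t, \<phi>t t)"]) auto
qed

end

theorem mainTheorem3:
  fixes s M \<sigma>2 \<sigma>3 \<delta> D W \<alpha>1 \<alpha>2 :: real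
  assumes "s > 3 / 2" and "M > 0" and "M \<noteq> 1"
    and "\<sigma>2 \<in> {1, -1}" and "\<sigma>3 \<in> {1, -1}" and "W > 0"
    and "alpha_system M \<sigma>3 D \<alpha>1 \<alpha>2"
  shows "\<forall>\<Psi>\<^sub>0 \<in> Z_space s. \<exists>c>0. \<forall>\<epsilon>>0.
           (\<exists>\<Psi>. mZR_solution s M \<sigma>2 \<sigma>3 \<delta> D W \<alpha>1 \<alpha>2 \<epsilon> (c / \<epsilon>) \<Psi>\<^sub>0 \<Psi>) \<and>
           (\<forall>\<Psi> \<Phi>. mZR_solution s M \<sigma>2 \<sigma>3 \<delta> D W \<alpha>1 \<alpha>2 \<epsilon> (c / \<epsilon>) \<Psi>\<^sub>0 \<Psi> \<longrightarrow>
                  mZR_solution s M \<sigma>2 \<sigma>3 \<delta> D W \<alpha>1 \<alpha>2 \<epsilon> (c / \<epsilon>) \<Psi>\<^sub>0 \<Phi> \<longrightarrow>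
                  (\<forall>t\<in>{0..c / \<epsilon>}. \<Psi> t = \<Phi> t))"
proof
  fix \<Psi>\<^sub>0 assume "\<Psi>\<^sub>0 \<in> Z_space s"
  moreover obtain \<psi>0 \<rho>0 \<phi>0 where \<Psi>\<^sub>0: "\<Psi>\<^sub>0 = (\<psi>0, \<rho>0, \<phi>0)" by (cases \<Psi>\<^sub>0)
  ultimately interpret mZR s M \<sigma>2 \<sigma>3 \<delta> D W \<alpha>1 \<alpha>2 \<psi>0 \<rho>0 \<phi>0
    using assms by unfold_locales auto
  \<comment> \<open>\<open>c\<close> is obtained from the data before any \<epsilon> is
    fixed.\<close>
  obtain c where c: "c > 0" "\<And>\<epsilon>. \<epsilon> > 0 \<Longrightarrow> \<exists>w. continuous_on {0..c / \<epsilon>} w \<and> w 0 = emb s \<psi>0 \<and>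
     picture \<epsilon> (c / \<epsilon>) w"
    by (rule interaction_picture_existence) blast
  show "\<exists>c>0. \<forall>\<epsilon>>0.
           (\<exists>\<Psi>. mZR_solution s M \<sigma>2 \<sigma>3 \<delta> D W \<alpha>1 \<alpha>2 \<epsilon> (c / \<epsilon>) \<Psi>\<^sub>0 \<Psi>) \<and>
           (\<forall>\<Psi> \<Phi>. mZR_solution s M \<sigma>2 \<sigma>3 \<delta> D W \<alpha>1 \<alpha>2 \<epsilon> (c / \<epsilon>) \<Psi>\<^sub>0 \<Psi> \<longrightarrow>
                  mZR_solution s M \<sigma>2 \<sigma>3 \<delta> D W \<alpha>1 \<alpha>2 \<epsilon> (c / \<epsilon>) \<Psi>\<^sub>0 \<Phi> \<longrightarrow>
                  (\<forall>t\<in>{0..c / \<epsilon>}. \<Psi> t = \<Phi> t))"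
  proof (intro exI[of _ c] conjI c(1) allI impI ballI)
    fix \<epsilon> :: real assume e: "\<epsilon> > 0"
    then have T: "c / \<epsilon> \<ge> 0" using c by simp
    show "\<exists>\<Psi>. mZR_solution s M \<sigma>2 \<sigma>3 \<delta> D W \<alpha>1 \<alpha>2 \<epsilon> (c / \<epsilon>) \<Psi>\<^sub>0 \<Psi>"
      using c(2)[OF e] existence[OF T, of _ \<epsilon>] unfolding \<Psi>\<^sub>0 by blast
    show "\<Psi> t = \<Phi> t" if "mZR_solution s M \<sigma>2 \<sigma>3 \<delta> D W \<alpha>1 \<alpha>2 \<epsilon> (c / \<epsilon>) \<Psi>\<^sub>0 \<Psi>"
      "mZR_solution s M \<sigma>2 \<sigma>3 \<delta> D W \<alpha>1 \<alpha>2 \<epsilon> (c / \<epsilon>) \<Psi>\<^sub>0 \<Phi>" "t \<in> {0..c / \<epsilon>}" for \<Psi> \<Phi> t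
      using uniqueness[OF T that[unfolded \<Psi>\<^sub>0]] .
  qed
qed

end
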